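(* Let $m\ge1$ be an integer. (i) For every integer $b\ge2$, both $W(mb+1,b)$ and $W(mb-1,b)$ are log-concave whenever the first block is positive. (ii) If $b\ge3$ is odd, then both $W(mb+2,b)$ and $W(mb-2,b)$ are log-concave. (iii) If $b\ge4$ and $3\nmid b$, then both $W(mb+3,b)$ and $W(mb-3,b)$ are log-concave. There is no upper bound on $b$ or $m$ in any of these families.
   Context: For positive integers $a,b$, let $$W(a,b)=\left\{\begin{pmatrix}X&Z\\0&Y\end{pmatrix}: X\in\operatorname{Mat}_a(\mathbb C),\ Y\in\operatorname{Mat}_b(\mathbb C),\ Z\in\operatorname{Mat}_{a\times b}(\mathbb C),\ \operatorname{tr}X+\operatorname{tr}Y=0\right\},$$ a Lie algebra under the commutator (a maximal parabolic of type $A$). A finite-dimensional complex Lie algebra $\mathfrak g$ is Frobenius if there is $\varphi\in\mathfrak g^*$ such that the bilinear form $B_\varphi(x,y)=\varphi([x,y])$ is nondegenerate; such $\varphi$ is called a Frobenius functional and determines a unique principal element $h\in\mathfrak g$ by $\varphi([h,x])=\varphi(x)$ for all $x\in\mathfrak g$. It is known that $W(a,b)$ is Frobenius exactly when $\gcd(a,b)=1$, and that the multiset of eigenvalues of $\operatorname{ad}h$ (with algebraic multiplicities) does not depend on the choice of Frobenius functional; this multiset is the Ooms spectrum. The distinct eigenvalues are integers forming an unbroken interval. The multiplicity sequence is the sequence of multiplicities, listed in order of increasing distinct eigenvalue. A positive sequence $(c_0,\ldots,c_t)$ is log-concave if $c_j^2\ge c_{j-1}c_{j+1}$ for $1\le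 j<t$. "$W(a,b)$ is log-concave" means that the multiplicity sequence of its Ooms spectrum is log-concave. *)

theory Defs
  imports "Jordan_Normal_Form.Char_Poly"
begin

definition mat_trace :: "complex mat \<Rightarrow> complex" where
  "mat_trace A = (\<Sum>i<dim_row A. A $$ (i, i))"

definition parabolic :: "nat \<Rightarrow> nat \<Rightarrow> complex mat set" where
  "parabolic a b =
     {four_block_mat X Z (0\<^sub>m b a) Y | X Y Z.
        X \<in> carrier_mat a a \<and> Y \<in> carrier_mat b b \<and> Z \<in> carrier_mat a b \<and>
        mat_trace X + mat_trace Y = 0}"

definition commutator :: "complex mat \<Rightarrow> complex mat \<Rightarrow> complex mat" where
  "commutator x y = x * y - y * x"

text \<open>
  The notions below are stated for a Lie algebra \<open>g\<close> of complex \<open>n \<times> n\<close> matrices, that is, a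
  linear subspace \<open>g\<close> of \<open>carrier_mat n n\<close> closed under the commutator.
  An element of the dual space is represented by a function on all matrices that is linear
  on \<open>g\<close>; its values outside \<open>g\<close> are irrelevant.
\<close>

definition linear_functional_on :: "complex mat set \<Rightarrow> (complex mat \<Rightarrow> complex) \<Rightarrow> bool" where
  "linear_functional_on g \<phi> \<longleftrightarrow>
     (\<forall>x\<in>g. \<forall>y\<in>g. \<phi> (x + y) = \<phi> x + \<phi> y) \<and>
     (\<forall>c. \<forall>x\<in>g. \<phi> (c \<cdot>\<^sub>m x) = c * \<phi> x)"

text \<open>
  The form \<open>\<phi> [x, y]\<close> is alternating, so its left and right radicals coincide and
  nondegeneracy amounts to the vanishing of the left one.
\<close>

definition frobenius_functional ::
  "nat \<Rightarrow> complex mat set \<Rightarrow> (complex mat \<Rightarrow> complex) \<Rightarrow> bool" where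
  "frobenius_functional n g \<phi> \<longleftrightarrow>
     linear_functional_on g \<phi> \<and>
     (\<forall>x\<in>g. (\<forall>y\<in>g. \<phi> (commutator x y) = 0) \<longrightarrow> x = 0\<^sub>m n n)"

definition principal_element ::
  "complex mat set \<Rightarrow> (complex mat \<Rightarrow> complex) \<Rightarrow> complex mat \<Rightarrow> bool" where
  "principal_element g \<phi> h \<longleftrightarrow> h \<in> g \<and> (\<forall>x\<in>g. \<phi> (commutator h x) = \<phi> x)"

definition mat_lincomb :: "nat \<Rightarrow> complex mat list \<Rightarrow> complex vec \<Rightarrow> complex mat" where
  "mat_lincomb n bs c = mat n n (\<lambda>(i, j). \<Sum>k<length bs. c $ k * (bs ! k) $$ (i, j))"

definition ordered_basis :: "nat \<Rightarrow> complex mat set \<Rightarrow> complex mat list \<Rightarrow> bool" where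
  "ordered_basis n g bs \<longleftrightarrow>
     set bs \<subseteq> g \<and>
     (\<forall>x\<in>g. \<exists>!c. c \<in> carrier_vec (length bs) \<and> x = mat_lincomb n bs c)"

definition matrix_of_operator ::
  "nat \<Rightarrow> complex mat list \<Rightarrow> (complex mat \<Rightarrow> complex mat) \<Rightarrow> complex mat \<Rightarrow> bool" where
  "matrix_of_operator n bs T A \<longleftrightarrow>
     A \<in> carrier_mat (length bs) (length bs) \<and>
     (\<forall>j<length bs. T (bs ! j) = mat_lincomb n bs (col A j))"

text \<open>
  \<open>M\<close> is the multiset of eigenvalues, with algebraic multiplicities, of the operator
  \<open>ad h\<close> on \<open>g\<close> for some Frobenius functional with principal element \<open>h\<close>. The characteristic
  polynomial of \<open>ad h\<close> is computed in some basis of \<open>g\<close>; the choice is immaterial.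
\<close>

definition ooms_spectrum :: "nat \<Rightarrow> complex mat set \<Rightarrow> complex multiset \<Rightarrow> bool" where
  "ooms_spectrum n g M \<longleftrightarrow>
     (\<exists>\<phi> h bs A. frobenius_functional n g \<phi> \<and> principal_element g \<phi> h \<and>
        ordered_basis n g bs \<and> matrix_of_operator n bs (commutator h) A \<and>
        M = proots (char_poly A))"

text \<open>
  The eigenvalues are complex numbers, so listing them in increasing order presupposes that
  they are real.
\<close>

definition multiplicity_sequence :: "complex multiset \<Rightarrow> nat list \<Rightarrow> bool" where
  "multiplicity_sequence M c \<longleftrightarrow>
     (\<exists>es :: real list. sorted_wrt (<) es \<and> complex_of_real ` set es = set_mset M \<and>
        c = map (\<lambda>e. count M (complex_of_real e)) es)"

definition log_concave_seq :: "nat list \<Rightarrow> bool" where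
  "log_concave_seq c \<longleftrightarrow>
     (\<forall>x\<in>set c. 0 < x) \<and>
     (\<forall>j. 1 \<le> j \<and> j + 1 < length c \<longrightarrow> c ! (j - 1) * c ! (j + 1) \<le> (c ! j)\<^sup>2)"

text \<open>
  The first conjunct says that the parabolic is Frobenius, so that there is a spectrum to speak
  of; the second does not presuppose that the spectrum is independent of the Frobenius functional.
\<close>

definition W_log_concave :: "nat \<Rightarrow> nat \<Rightarrow> bool" where
  "W_log_concave a b \<longleftrightarrow>
     (\<exists>M. ooms_spectrum (a + b) (parabolic a b) M) \<and>
     (\<forall>M. ooms_spectrum (a + b) (parabolic a b) M \<longrightarrow>
        (\<exists>c. multiplicity_sequence M c \<and> log_concave_seq c))"

end

theory Submission
  imports Defs "Jordan_Normal_Form.Schur_Decomposition" "Jordan_Normal_Form.Gauss_Jordan_Elimination"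
    "HOL-Library.Multiset"
begin

text \<open>
  A functional on \<open>W(a, b)\<close> is the trace form of a block matrix with blocks \<open>A\<close>, \<open>0\<close>, \<open>C\<close>, \<open>D\<close>.
  Nondegeneracy and the equation of the principal element become equations for these blocks
  (\<open>rigid\<close> and \<open>principal_triple\<close>). For a nondegenerate form \<open>C\<close> has full rank; normalizing it to
  \<open>[1 0]\<close> passes from \<open>(a + b, b)\<close> to \<open>(a, b)\<close>, and transposition exchanges the two blocks. Hence
  Euclid's algorithm computes the eigenvalues of the two diagonal blocks of the principal element: up to
  a common shift they are integer multisets \<open>p\<close> and \<open>q\<close>, and the spectrum of \<open>ad h\<close> consists
  of the differences inside \<open>p\<close>, inside \<open>q\<close> and from \<open>p\<close> to \<open>q\<close>, with one \<open>0\<close> removed.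

  Let \<open>F\<close> be the multiplicity function, \<open>G k\<close> the number of differences \<open>k\<close> from \<open>p\<close> to
  \<open>q\<close>, and \<open>v k = G k - G (- k)\<close>. An invariant of Euclid's algorithm gives \<open>F (1 - k) - F (- k) = v k\<close>.
  So \<open>F\<close> is symmetric about \<open>1/2\<close>, and its log-concavity follows from that of the odd function
  \<open>v\<close> on the positive integers. For \<open>W(mb \<plusminus> r, b)\<close> with \<open>r \<le> 3\<close> and \<open>c = b div r\<close>, the
  second difference of \<open>v\<close> is the sum of three functions located at \<open>m\<close>, \<open>- m\<close> and \<open>0\<close>,
  each of which only has its plateaus stretched when \<open>c\<close> grows. It is nonpositive up to \<open>m\<close>;
  beyond, its positive part is increasing except near the end of the support. Monotonicity propagates
  log-concavity downwards from that end, where, as for small \<open>c\<close>, finitely many inequalities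
  remain to be computed.
\<close>

section \<open>Log-concavity from second differences\<close>

text \<open>Log-concavity is not additive, so a function assembled from three pieces cannot be
  treated piece by piece. The order of differencing makes the families tractable. A Euclid step
  translates \<open>G\<close> by 1 and adds a translate of the difference count inside
  \<open>q\<close>; in second differences these additions telescope, so that after \<open>m\<close>
  steps one piece still sits at 0, another has moved to \<open>m\<close>, and neither has changed
  shape.

  Only points of positive second difference are delicate: at a concave point the
  arithmetic-geometric inequality suffices. At a convex point log-concavity passes from
  \<open>k + 1\<close> to \<open>k\<close> as soon as the second difference does not grow on the way
  down, and this condition can be checked separately on the three pieces.

  The constants come from the supports. The plateaus occupy \<open>[4, c - 4]\<close>, so
  \<open>c = 8\<close> is the first case that shows the general shape. The pieces end at
  \<open>c + 4\<close>, so for \<open>c <= 8\<close> arguments up to 12 suffice. For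
  \<open>m >= 8\<close> the nine topmost points see only the piece located at \<open>m\<close>, so
  nothing new happens beyond \<open>m = 8\<close>.\<close>

text \<open>
  The list holds second differences read downwards from the end of the support; \<open>v\<close> is the current
  value and \<open>d\<close> the last drop. Log-concavity has to be tested only while the function is convex.
\<close>

fun lc_window :: "int list \<Rightarrow> int \<Rightarrow> int \<Rightarrow> bool" where
  "lc_window [] v d = True"
| "lc_window (e # es) v d =
     (if e < 0 then list_all (\<lambda>x. x \<le> 0) es
      else v * e \<le> d * (d + e) \<and> lc_window es (v + (d + e)) (d + e))"

definition second_diff :: "(int \<Rightarrow> int) \<Rightarrow> int \<Rightarrow> int" where
  "second_diff v k = v (k + 1) - 2 * v k + v (k - 1)"

definition convex_from :: "(int \<Rightarrow> int) \<Rightarrow> int \<Rightarrow> bool" where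
  "convex_from v k \<longleftrightarrow> (\<forall>i\<ge>k. 0 \<le> second_diff v i \<and> v i \<le> v (i - 1) \<and> 0 \<le> v i \<and>
     v (i - 1) * v (i + 1) \<le> (v i)\<^sup>2)"

definition concave_convex_from :: "(int \<Rightarrow> int) \<Rightarrow> int \<Rightarrow> bool" where
  "concave_convex_from v k \<longleftrightarrow>
     (\<exists>T\<ge>k. (\<forall>i. k \<le> i \<and> i \<le> T \<longrightarrow> second_diff v i \<le> 0) \<and> second_diff v T < 0 \<and> convex_from v (T + 1))"

text \<open>The right-hand form compares \<open>v k\<close> times the second difference with the
  product of two neighbouring drops; it is the form tested by \<open>lc_window\<close>.\<close>

lemma log_concave_at_iff:
  "v (k - 1) * v (k + 1) \<le> (v k)\<^sup>2 \<longleftrightarrow>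
   v k * second_diff v k \<le> (v k - v (k + 1)) * (v (k - 1) - v k)" for v :: "int \<Rightarrow> int"
  by (simp add: second_diff_def power2_eq_square algebra_simps)

lemma convex_from_step:
  assumes "convex_from v (k + 1)" "0 \<le> second_diff v k" "v (k - 1) * v (k + 1) \<le> (v k)\<^sup>2"
  shows "convex_from v k"
proof -
  have a: "v (k + 1) \<le> v k" "0 \<le> v (k + 1)" using assms(1) unfolding convex_from_def by force+
  then have k: "v k \<le> v (k - 1)" using assms(2) by (simp add: second_diff_def)
  show ?thesis unfolding convex_from_def
  proof (intro allI impI)
    fix i assume "k \<le> i"
    then consider "i = k" | "k + 1 \<le> i" by linarith
    then show "0 \<le> second_diff v i \<and> v i \<le> v (i - 1) \<and> 0 \<le> v i \<and> v (i - 1) * v (i + 1) \<le> (v i)\<^sup>2"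
    proof cases
      case 1
      then show ?thesis using assms(2,3) a k by simp
    next
      case 2
      then show ?thesis using assms(1) unfolding convex_from_def by blast
    qed
  qed
qed

text \<open>The invariant of \<open>lc_window\<close>: everything above the current point is convex,
  decreasing and log-concave. Each nonnegative entry that passes the test extends this by one point.
  The first negative entry opens the concave range, where the test only asks that no positive entry
  follows.\<close>

lemma window_step:
  assumes "lc_window es (v k) (v k - v (k + 1))" "convex_from v (k + 1)"
    and "\<And>i. i < length es \<Longrightarrow> es ! i = second_diff v (k - int i)"
    and "i < length es"
  shows "convex_from v (k - int i) \<or> concave_convex_from v (k - int i)"
  using assms
proof (induction es arbitrary: k i)
  case (Cons a es)
  have a: "a = second_diff v k" using Cons.prems(3)[of 0] by simp
  have es: "es ! j = second_diff v (k - 1 - int j)" if "j < length es" for j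
    using Cons.prems(3)[of "Suc j"] that by (simp add: algebra_simps)
  show ?case
  proof (cases "a < 0")
    case True
    have neg: "second_diff v j \<le> 0" if "k - int i \<le> j" "j \<le> k" for j
    proof (cases "j = k")
      case False
      then have "nat (k - 1 - j) < length es" using that Cons.prems(4) by auto
      with es[OF this] False that True Cons.prems(1) show ?thesis
        by (force simp: list_all_length)
    qed (use True a in auto)
    then have "concave_convex_from v (k - int i)" unfolding concave_convex_from_def
      using True a Cons.prems(2) by (intro exI[of _ k]) auto
    then show ?thesis ..
  next
    case False
    have d: "v (k - 1) - v k = v k - v (k + 1) + a" unfolding a by (simp add: second_diff_def)
    have d': "v (k - 1) = v k + (v k - v (k + 1) + a)" using d by simp
    have lc: "v k * a \<le> (v k - v (k + 1)) * (v (k - 1) - v k)"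
      using False Cons.prems(1) unfolding d by simp
    have k: "convex_from v k"
    proof (rule convex_from_step[OF Cons.prems(2)])
      show "v (k - 1) * v (k + 1) \<le> (v k)\<^sup>2"
        using lc unfolding log_concave_at_iff a .
    qed (use False a in simp)
    show ?thesis
    proof (cases i)
      case 0
      then show ?thesis using k by simp
    next
      case (Suc j)
      have "convex_from v (k - 1 - int j) \<or> concave_convex_from v (k - 1 - int j)"
      proof (rule Cons.IH)
        show "lc_window es (v (k - 1)) (v (k - 1) - v (k - 1 + 1))"
          using False Cons.prems(1) by (simp flip: d d')
      qed (use k es Suc Cons.prems(4) in auto)
      then show ?thesis using Suc by (simp add: algebra_simps)
    qed
  qed
qed simp

text \<open>The last clause excludes internal zeros; without it log-concavity would not survive the
  summation of \<open>v\<close>.\<close>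

definition log_concave_tail :: "(int \<Rightarrow> int) \<Rightarrow> bool" where
  "log_concave_tail v \<longleftrightarrow>
     (\<forall>k\<ge>1. 0 \<le> v k \<and> v (k - 1) * v (k + 1) \<le> (v k)\<^sup>2 \<and> (v k = 0 \<longrightarrow> v (k + 1) = 0))"

text \<open>On passing from \<open>k + 1\<close> to \<open>k\<close> the left side of
  \<open>log_concave_at_iff\<close> gains at most, and the right side at least, the product of the
  drop \<open>d1\<close> and the second difference \<open>e0\<close> at \<open>k\<close>. The first
  bound uses that \<open>e0\<close> does not exceed the next second difference, the second that this
  one is nonnegative.\<close>

lemma log_concave_step:
  fixes v :: "int \<Rightarrow> int"
  assumes lc: "v k * v (k + 2) \<le> (v (k + 1))\<^sup>2"
    and e: "0 \<le> second_diff v k" "second_diff v k \<le> second_diff v (k + 1)"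
    and v: "v (k + 2) \<le> v (k + 1)" "0 \<le> v (k + 2)" "v (k + 1) \<le> v k"
  shows "v (k - 1) * v (k + 1) \<le> (v k)\<^sup>2"
proof -
  define d0 d1 d2 e0 where "d0 = v (k + 1) - v (k + 2)" and "d1 = v k - v (k + 1)"
    and "d2 = v (k - 1) - v k" and "e0 = second_diff v k"
  have r: "d2 = d1 + e0" "d1 = d0 + second_diff v (k + 1)"
    by (simp_all add: d0_def d1_def d2_def e0_def second_diff_def algebra_simps)
  have "v k * e0 = v (k + 1) * e0 + d1 * e0" by (simp add: d1_def algebra_simps)
  also have "\<dots> \<le> v (k + 1) * second_diff v (k + 1) + d1 * e0"
    using e v by (simp add: e0_def mult_left_mono)
  also have "\<dots> \<le> d0 * d1 + d1 * e0"
    using lc log_concave_at_iff[of v "k + 1"] by (simp add: d0_def d1_def algebra_simps)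
  also have "\<dots> = d1 * (d0 + e0)" by (simp add: algebra_simps)
  also have "\<dots> \<le> d1 * d2" using r e v by (intro mult_left_mono) (auto simp: e0_def d1_def)
  finally show ?thesis unfolding log_concave_at_iff by (simp add: e0_def d1_def d2_def)
qed

text \<open>Below the window a positive second difference is at most its upper neighbour, so it
  cannot occur under a nonpositive one. Going down, a convex range is therefore followed by a
  concave one, and \<open>log_concave_step\<close> carries log-concavity through the convex
  range.\<close>

lemma convex_concave_imp_log_concave_tail:
  fixes v :: "int \<Rightarrow> int"
  assumes v0: "v 0 = 0" and top: "\<And>k. k \<ge> N \<Longrightarrow> v k = 0"
    and lc_window: "lc_window (map (\<lambda>s. second_diff v (N - s)) [0..n]) 0 0"
    and low: "\<And>k. 1 \<le> k \<Longrightarrow> k < N - n \<Longrightarrow> 0 < second_diff v k \<Longrightarrow> second_diff v k \<le> second_diff v (k + 1)"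
    and n: "0 \<le> n" "n < N"
  shows "log_concave_tail v"
proof -
  let ?P = "\<lambda>k. convex_from v k \<or> concave_convex_from v k"
  have c1: "convex_from v (N + 1)" unfolding convex_from_def using top by (simp add: second_diff_def)
  define es where "es = map (\<lambda>s. second_diff v (N - s)) [0..n]"
  have len: "length es = nat (n + 1)" by (simp add: es_def)
  have nth: "es ! i = second_diff v (N - int i)" if "i < length es" for i
  proof -
    have "0 + int i \<le> n" using that n unfolding len by simp
    then show ?thesis using that by (simp add: es_def nth_upto)
  qed
  have w: "lc_window es (v N) (v N - v (N + 1))" using lc_window top by (simp add: es_def)
  have win': "?P (N - int i)" if "i < nat (n + 1)" for i
    by (rule window_step[OF w c1]) (use nth len that in auto)
  have "?P (N - n)" using win'[of "nat n"] n by simp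
  have P: "1 \<le> k \<longrightarrow> ?P k" if "k \<le> N - n" for k
    using that
  proof (induction rule: int_le_induct)
    case base
    show ?case using \<open>?P (N - n)\<close> by simp
  next
    case (step k)
    show ?case
    proof
      assume k: "1 \<le> k - 1"
      let ?e = "second_diff v"
      have mono: "0 < ?e (k - 1) \<Longrightarrow> ?e (k - 1) \<le> ?e k" using low[of "k - 1"] k step by simp
      from step k have "?P k" by simp
      then show "?P (k - 1)"
      proof
        assume c: "convex_from v k"
        consider "?e (k - 1) < 0" | "?e (k - 1) = 0" | "?e (k - 1) > 0" by linarith
        then show ?thesis
        proof cases
          case 1
          moreover have "i = k - 1" if "k - 1 \<le> i" "i \<le> k - 1" for i using that by simp
          ultimately have "concave_convex_from v (k - 1)"
            unfolding concave_convex_from_def using c by (intro exI[of _ "k - 1"]) (metis diff_add_cancel order_le_less)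
          then show ?thesis ..
        next
          case 2
          have "v (k - 1 + 1) \<le> v (k - 1)" using c[unfolded convex_from_def, rule_format, of k] by simp
          with 2 have "v (k - 1 - 1) * v (k - 1 + 1) \<le> (v (k - 1))\<^sup>2"
            unfolding log_concave_at_iff by (simp add: second_diff_def)
          with c 2 have "convex_from v (k - 1)" using convex_from_step[of v "k - 1"] by simp
          then show ?thesis ..
        next
          case 3
          have c1: "0 \<le> ?e k" "v k \<le> v (k - 1)" "v (k - 1) * v (k + 1) \<le> (v k)\<^sup>2"
            and c2: "v (k + 1) \<le> v k" "0 \<le> v (k + 1)"
            using c[unfolded convex_from_def, rule_format, of k]
              c[unfolded convex_from_def, rule_format, of "k + 1"] by simp_all
          have "v (k - 1 - 1) * v (k - 1 + 1) \<le> (v (k - 1))\<^sup>2"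
            using c1 c2 3 mono log_concave_step[of v "k - 1"] by (simp add: add.commute)
          with c 3 have "convex_from v (k - 1)" using convex_from_step[of v "k - 1"] by simp
          then show ?thesis ..
        qed
      next
        assume "concave_convex_from v k"
        then obtain T where T: "T \<ge> k" "\<And>i. k \<le> i \<Longrightarrow> i \<le> T \<Longrightarrow> ?e i \<le> 0" "?e T < 0" "convex_from v (T + 1)"
          unfolding concave_convex_from_def by blast
        have "?e (k - 1) \<le> 0" using T(2)[of k] T(1) mono by force
        with T(2) have "?e i \<le> 0" if "k - 1 \<le> i" "i \<le> T" for i
          using that by (cases "i = k - 1") auto
        with T(1,3,4) have "concave_convex_from v (k - 1)"
          unfolding concave_convex_from_def by (intro exI[of _ T]) auto
        then show ?thesis ..
      qed
    qed
  qed
  have P1: "?P 1" using P[of 1] n by simp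
  then obtain T where T: "T \<ge> 0" "\<And>i. 1 \<le> i \<Longrightarrow> i \<le> T \<Longrightarrow> second_diff v i \<le> 0" "convex_from v (T + 1)"
  proof
    assume "convex_from v 1"
    then show ?thesis using that[of 0] by simp
  next
    assume "concave_convex_from v 1"
    then show ?thesis using that unfolding concave_convex_from_def by (metis order_trans zero_le_one)
  qed
  have vT: "0 \<le> v T" "0 \<le> v (T + 1)" "v (T + 1) \<le> v T"
    using T(3)[unfolded convex_from_def, rule_format, of "T + 1"] T(3)[unfolded convex_from_def, rule_format, of "T + 2"] by auto
  have nonneg: "0 \<le> v k" if "0 \<le> k" for k
  proof (cases "k \<le> T")
    case False
    then show ?thesis using T(3) unfolding convex_from_def by simp
  next
    case True
    \<comment> \<open>On the concave range a function that starts at 0 and becomes negative keeps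
      falling, which contradicts the nonnegative value at \<open>T + 1\<close>.\<close>
    have drop: "v i < 0 \<Longrightarrow> i \<le> T + 1 \<Longrightarrow> v i < v (i - 1)" if "1 \<le> i" for i
      using that
    proof (induction rule: int_ge_induct)
      case (step i)
      then show ?case using T(2)[of i] by (cases "v i < 0") (auto simp: second_diff_def)
    qed (use v0 in simp)
    have neg: "v k < 0 \<Longrightarrow> i \<le> T + 1 \<Longrightarrow> v i < 0" if "k \<le> i" "1 \<le> k" for i
      using that
    proof (induction rule: int_ge_induct)
      case (step i)
      then show ?case using T(2)[of i] drop[of i] by (simp add: second_diff_def)
    qed
    show ?thesis
    proof (rule ccontr)
      assume "\<not> 0 \<le> v k"
      moreover from this v0 that have "1 \<le> k" by (cases "k = 0") auto
      ultimately show False using neg[of "T + 1"] vT(2) True by simp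
    qed
  qed
  have "0 \<le> v k \<and> v (k - 1) * v (k + 1) \<le> (v k)\<^sup>2 \<and> (v k = 0 \<longrightarrow> v (k + 1) = 0)" if k: "1 \<le> k" for k
  proof (cases "k \<le> T")
    case False
    then have "v (k - 1) * v (k + 1) \<le> (v k)\<^sup>2" "v (k + 1) \<le> v k" "0 \<le> v k" "0 \<le> v (k + 1)"
      using T(3)[unfolded convex_from_def, rule_format, of k] T(3)[unfolded convex_from_def, rule_format, of "k + 1"] by auto
    then show ?thesis by auto
  next
    case True
    have e: "v (k + 1) + v (k - 1) \<le> 2 * v k" using T(2)[of k] k True by (simp add: second_diff_def)
    have n: "0 \<le> v (k + 1)" "0 \<le> v (k - 1)" "0 \<le> v k" using nonneg k by simp_all
    have "4 * (v (k - 1) * v (k + 1)) \<le> (v (k + 1) + v (k - 1))\<^sup>2"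
      using zero_le_square[of "v (k + 1) - v (k - 1)"] by (simp add: power2_eq_square algebra_simps)
    also have "\<dots> \<le> (2 * v k)\<^sup>2" using e n by (intro power_mono) auto
    finally show ?thesis using e n by (auto simp: power2_eq_square)
  qed
  then show ?thesis unfolding log_concave_tail_def by blast
qed

text \<open>Up to reflection \<open>F\<close> is the sequence of tail sums of \<open>v\<close>, and
  tail sums of a nonnegative log-concave sequence without internal zeros are log-concave. Symmetry
  about 1/2, forced by oddness of \<open>v\<close>, settles the other half.\<close>

lemma log_concave_of_tail:
  fixes F v :: "int \<Rightarrow> int"
  assumes diff: "\<And>k. F (1 - k) - F (- k) = v k" and odd: "\<And>k. v (- k) = - v k"
    and fin: "\<And>j. N < \<bar>j\<bar> \<Longrightarrow> F j = 0" and tail: "log_concave_tail v"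
  shows "F (1 - j) = F j" and "F (j - 1) * F (j + 1) \<le> (F j)\<^sup>2" and "j \<le> 0 \<Longrightarrow> F (j - 1) \<le> F j"
proof -
  \<comment> \<open>Oddness of \<open>v\<close> makes this difference independent of
    \<open>j\<close>; far out both terms vanish, so it is 0.\<close>
  have shift: "F j - F (1 - j) = F 0 - F 1" for j
  proof (induction j rule: int_induct[of _ 0])
    case (step1 i)
    then show ?case using diff[of "- i"] diff[of i] odd[of i] by (simp add: add.commute)
  next
    case (step2 i)
    then show ?case using diff[of "1 - i"] diff[of "i - 1"] odd[of "i - 1"] by simp
  qed simp
  have "F (N + 2) = 0" "F (1 - (N + 2)) = 0" if "N \<ge> 0" using that by (auto intro!: fin)
  moreover have "F 0 = 0" "F 1 = 0" if "N < 0" using that by (auto intro!: fin)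
  ultimately have "F 0 - F 1 = 0" using shift[of "N + 2"] by (cases "N \<ge> 0") auto
  then have sym: "F (1 - j) = F j" for j using shift[of j] by simp
  show "F (1 - j) = F j" by (rule sym)
  have v: "0 \<le> v k" "v (k - 1) * v (k + 1) \<le> (v k)\<^sup>2" "v k = 0 \<Longrightarrow> v (k + 1) = 0" if "1 \<le> k" for k
    using tail that unfolding log_concave_tail_def by auto
  show "F (j - 1) \<le> F j" if "j \<le> 0" for j using diff[of "1 - j"] v(1)[of "1 - j"] that by simp
  define H where "H k = F (1 - k)" for k
  have H: "H k = v k + H (k + 1)" for k using diff[of k] by (simp add: H_def)
  define M where "M = \<bar>N\<bar> + 3"
  have H0: "H k = 0" if "M \<le> k" for k using that by (auto simp: H_def M_def intro!: fin)
  have Hnn: "0 \<le> H k \<and> (v k = 0 \<longrightarrow> H (k + 1) = 0)" if "1 \<le> k" for k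
  proof -
    have "1 \<le> k \<longrightarrow> 0 \<le> H k \<and> (v k = 0 \<longrightarrow> H (k + 1) = 0)" if "k \<le> M" for k
      using that
    proof (induction rule: int_le_induct)
      case (step k)
      then show ?case using H[of "k - 1"] H[of k] v[of "k - 1"] by auto
    qed (use H0 in auto)
    then show ?thesis using H0[of k] H0[of "k + 1"] that by (cases "k \<le> M") auto
  qed
  \<comment> \<open>This is what remains of the claim after expanding \<open>H\<close> by one step.
    The downward induction divides by \<open>v (k - 1)\<close>; if that is 0, the tail
    \<open>H k\<close> vanishes because there are no internal zeros.\<close>
  have key: "v (k - 1) * H (k + 1) \<le> v k * H k" if "1 \<le> k" for k
  proof -
    have "1 \<le> k \<longrightarrow> v (k - 1) * H (k + 1) \<le> v k * H k" if "k \<le> M" for k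
      using that
    proof (induction rule: int_le_induct)
      case (step k)
      show ?case
      proof
        assume k: "1 \<le> k - 1"
        then have IH: "v (k - 1) * H (k + 1) \<le> v k * H k" using step by simp
        define u where "u = v (k - 1)"
        have u: "0 \<le> u" "0 \<le> v (k - 2) \<or> k = 2" using v(1)[of "k - 1"] v(1)[of "k - 2"] k
          by (auto simp: u_def)
        have v2: "0 \<le> v (k - 2)"
        proof (cases "k = 2")
          case True
          have "v 0 = 0" using odd[of 0] by simp
          then show ?thesis using True by simp
        qed (use u in simp)
        show "v (k - 1 - 1) * H (k - 1 + 1) \<le> v (k - 1) * H (k - 1)"
        proof (cases "u = 0")
          case True
          then have "H k = 0" using Hnn[of "k - 1"] k by (simp add: u_def)
          then show ?thesis using True by (simp add: u_def)
        next
          case False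
          then have "0 < u" using u by simp
          have "u * (v (k - 2) * H k) = v (k - 2) * (u * v k) + v (k - 2) * (u * H (k + 1))"
            using H[of k] by (simp add: algebra_simps)
          also have "\<dots> \<le> v (k - 2) * (u * v k) + v (k - 2) * (v k * H k)"
            using IH v2 by (auto simp: u_def intro: mult_left_mono)
          also have "\<dots> = (v (k - 2) * v k) * (u + H k)" by (simp add: algebra_simps)
          also have "\<dots> \<le> u\<^sup>2 * (u + H k)"
            using v(2)[of "k - 1"] k u Hnn[of k] by (intro mult_right_mono) (auto simp: u_def)
          also have "\<dots> = u * (u * H (k - 1))"
            using H[of "k - 1"] by (simp add: u_def power2_eq_square)
          finally show ?thesis using \<open>0 < u\<close> by (simp add: u_def)
        qed
      qed
    qed (use H0 in auto)
    then show ?thesis using H0[of k] H0[of "k + 1"] that by (cases "k \<le> M") auto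
  qed
  have lcH: "H (k - 1) * H (k + 1) \<le> (H k)\<^sup>2" if "1 \<le> k" for k
  proof -
    have "H (k - 1) * H (k + 1) = H k * H (k + 1) + v (k - 1) * H (k + 1)"
      using H[of "k - 1"] by (simp add: algebra_simps)
    also have "\<dots> \<le> H k * H (k + 1) + v k * H k" using key[OF that] by simp
    also have "\<dots> = H k * (v k + H (k + 1))" by (simp add: algebra_simps)
    finally show ?thesis using H[of k] by (simp add: power2_eq_square)
  qed
  have lcF: "F (j - 1) * F (j + 1) \<le> (F j)\<^sup>2" if "j \<le> 0" for j
    using lcH[of "1 - j"] that by (simp add: H_def mult.commute add.commute)
  show "F (j - 1) * F (j + 1) \<le> (F j)\<^sup>2"
  proof (cases "j \<le> 0")
    case False
    have "F (1 - j - 1) = F (j + 1)" "F (1 - j + 1) = F (j - 1)" "F (1 - j) = F j"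
      using sym[of "j + 1"] sym[of "j - 1"] sym[of j] by (simp_all add: algebra_simps)
    then show ?thesis using lcF[of "1 - j"] False by (simp add: mult.commute)
  qed (rule lcF)
qed

section \<open>Second difference profiles\<close>

text \<open>
  The index \<open>t\<close> encodes the pair \<open>(b mod r, r)\<close>: the values 0, 1, 2, 3 stand for
  \<open>(0, 1)\<close>, \<open>(1, 2)\<close>, \<open>(1, 3)\<close>, \<open>(2, 3)\<close>. With \<open>p\<close> and \<open>q\<close> the multisets of that pair,
  \<open>self_sum t j\<close> counts the differences less than \<open>j\<close> inside \<open>q\<close>, and \<open>cross_base t j\<close> those equal
  to \<open>j\<close> from \<open>p\<close> to \<open>q\<close>. Then \<open>cross t c\<close> counts the latter differences after \<open>c\<close> further steps
  of Euclid's algorithm. The flag of \<open>edge\<close> is the sign in \<open>mb \<plusminus> r\<close>.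
\<close>

definition self_sum :: "nat \<Rightarrow> int \<Rightarrow> int" where
  "self_sum t j =
     (if t = 0 then (if j \<le> 0 then 0 else 1)
      else if t = 1 then (if j < 0 then 0 else if j = 0 then 1 else if j = 1 then 3 else 4)
      else (if j < -1 then 0 else if j = -1 then 1 else if j = 0 then 3 else if j = 1 then 6
            else if j = 2 then 8 else 9))"

definition cross_base :: "nat \<Rightarrow> int \<Rightarrow> int" where
  "cross_base t j =
     (if t = 0 then 0
      else if t = 1 then (if j = 1 \<or> j = 2 then 1 else 0)
      else if t = 2 then (if 1 \<le> j \<and> j \<le> 3 then 1 else 0)
      else (if j = 0 \<or> j = 3 then 1 else if j = 1 \<or> j = 2 then 2 else 0))"

text \<open>One zero is taken out of the differences inside \<open>q\<close>, the same zero that the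
  trace condition removes from the spectrum.\<close>

definition self_excess :: "nat \<Rightarrow> int \<Rightarrow> int" where
  "self_excess t j = self_sum t (j + 1) - self_sum t j - (if j = 0 then 1 else 0)"

definition cross :: "nat \<Rightarrow> int \<Rightarrow> int \<Rightarrow> int" where
  "cross t c j = self_sum t j - self_sum t (j - c) + cross_base t (j - c)"

text \<open>The second difference of \<open>cross t c\<close> minus \<open>self_step t c\<close>,
  written out: the part of the second difference of \<open>G\<close> that travels to
  \<open>m\<close>.\<close>

definition edge_plus :: "nat \<Rightarrow> int \<Rightarrow> int \<Rightarrow> int" where
  "edge_plus t c j = cross t c (j - 1) - cross t c j + cross t c (j + 1) - cross t c (1 - j) + self_excess t j - self_excess t (j - 1)"

definition edge :: "bool \<Rightarrow> nat \<Rightarrow> int \<Rightarrow> int \<Rightarrow> int" where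
  "edge s t c j = (if s then edge_plus t c j else - edge_plus t c (1 - j))"

text \<open>The first difference of the count of differences inside \<open>p\<close>, obtained by
  solving the balance identity for it. Exchanging the blocks makes (the negative of) this
  \<open>p\<close> the multiset that each further Euclid step adds.\<close>

definition self_step :: "nat \<Rightarrow> int \<Rightarrow> int \<Rightarrow> int" where
  "self_step t c k = cross t c (1 - k) - cross t c k - (self_excess t k - self_excess t (k - 1))"

text \<open>Evenness of \<open>self_excess\<close> gives
  \<open>self_step t c (- k) = - self_step t c (k + 1)\<close>, so antisymmetrizing the part that
  stays at 0 leaves this sum. The sign makes it nonnegative for \<open>k >= 1\<close>.\<close>

definition dip :: "nat \<Rightarrow> int \<Rightarrow> int \<Rightarrow> int" where
  "dip t c k = - self_step t c k - self_step t c (k + 1)"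

definition profile :: "bool \<Rightarrow> nat \<Rightarrow> int \<Rightarrow> int \<Rightarrow> int \<Rightarrow> int" where
  "profile s t c m k = edge s t c (k - m) - edge s t c (- k - m) - dip t c k"

text \<open>From 3 on \<open>self_sum\<close> is constant and counts all differences inside
  \<open>q\<close>; the value is the square of r, that is 1, 4 or 9.\<close>

abbreviation self_total :: "nat \<Rightarrow> int" where "self_total t \<equiv> self_sum t 3"

lemma self_sum_low: "j \<le> -2 \<Longrightarrow> self_sum t j = 0"
  by (simp add: self_sum_def)

lemma self_sum_high: "4 \<le> j \<Longrightarrow> self_sum t j = self_total t"
  by (simp add: self_sum_def)

lemma cross_base_outside: "j < 0 \<or> 3 < j \<Longrightarrow> cross_base t j = 0"
  by (auto simp: cross_base_def)

lemma self_excess_outside: "j \<le> -3 \<or> 3 \<le> j \<Longrightarrow> self_excess t j = 0"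
  by (auto simp: self_excess_def self_sum_def)

lemma cross_low: "j \<le> c - 2 \<Longrightarrow> cross t c j = self_sum t j"
  by (simp add: cross_def self_sum_low cross_base_outside)

lemma cross_high: "3 \<le> j \<Longrightarrow> cross t c j = self_total t - self_sum t (j - c) + cross_base t (j - c)"
  by (cases "j = 3") (simp_all add: cross_def self_sum_high)

text \<open>For \<open>c \<ge> 8\<close> the profile arises from the one for \<open>c = 8\<close> by repeating the plateau value at 4.\<close>

definition stretch :: "int \<Rightarrow> int \<Rightarrow> int" where
  "stretch c j = (if j \<le> 4 then j else if c - 4 \<le> j then j - c + 8 else 4)"

text \<open>\<open>self_sum\<close> is constant up to -2 and from 3 on, and
  \<open>cross_base\<close> vanishes outside \<open>[0, 3]\<close>. Hence \<open>cross\<close>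
  varies only near 0 and near \<open>c\<close>. For \<open>c >= 8\<close> these zones are separated
  by the plateau from 4 to \<open>c - 4\<close>, a single point when \<open>c = 8\<close>.\<close>

lemma edge_stretch:
  assumes "8 \<le> c" "0 \<le> j"
  shows "edge s t c j = edge s t 8 (stretch c j)" and "edge s t c (- j) = edge s t 8 (- stretch c j)"
proof -
  consider "j \<le> 4" | "4 < j" "c - 4 \<le> j" | "4 < j" "j < c - 4" using assms by linarith
  then show "edge s t c j = edge s t 8 (stretch c j)"
    by cases (use assms in \<open>simp_all add: edge_def edge_plus_def stretch_def cross_low cross_high self_excess_outside self_sum_low self_sum_high algebra_simps\<close>)
  consider "j \<le> 4" | "4 < j" "c - 4 \<le> j" | "4 < j" "j < c - 4" using assms by linarith
  then show "edge s t c (- j) = edge s t 8 (- stretch c j)"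
    by cases (use assms in \<open>simp_all add: edge_def edge_plus_def stretch_def cross_low cross_high self_excess_outside self_sum_low self_sum_high algebra_simps\<close>)
qed

lemma dip_stretch:
  assumes "8 \<le> c" "1 \<le> k"
  shows "dip t c k = dip t 8 (stretch c k)"
proof -
  consider "k \<le> 4" | "4 < k" "c - 4 \<le> k" | "4 < k" "k < c - 4" using assms by linarith
  then show ?thesis
    by cases (use assms in \<open>simp_all add: dip_def self_step_def stretch_def cross_low cross_high self_excess_outside self_sum_low self_sum_high algebra_simps\<close>)
qed

lemma dip_zero: "1 \<le> c \<Longrightarrow> c + 4 \<le> k \<Longrightarrow> dip t c k = 0"
  by (simp add: dip_def self_step_def cross_def self_sum_low self_sum_high cross_base_outside self_excess_outside)

lemma edge_zero: "1 \<le> c \<Longrightarrow> c + 5 \<le> j \<Longrightarrow> edge s t c j = 0" "1 \<le> c \<Longrightarrow> c + 5 \<le> j \<Longrightarrow> edge s t c (- j) = 0"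
  by (simp_all add: edge_def edge_plus_def cross_def self_sum_low self_sum_high cross_base_outside self_excess_outside)

section \<open>Finite checks and their extension to all parameters\<close>

text \<open>The bound 12 exhausts the supports, which for \<open>c <= 8\<close> end at
  \<open>c + 4\<close>. The clause with \<open>2 * k\<close> serves the range \<open>k <= m\<close>,
  where the reflected edge is taken at \<open>- (k + m)\<close>. The three isolated inequalities
  make the profile nonpositive for (k, m) = (2, 1), (3, 2) and (3, 1); the last pair has
  \<open>k - m = 2\<close>, which for \<open>c = 6\<close> lies outside the range
  \<open>k - m <= c - 5\<close>.\<close>

definition profile_check :: "bool \<Rightarrow> nat \<Rightarrow> int \<Rightarrow> bool" where
  "profile_check s t c \<longleftrightarrow>
     list_all (\<lambda>j. 0 \<le> - edge s t c (- j) \<and> - edge s t c (- j) \<le> self_total t) [0..12] \<and>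
     list_all (\<lambda>j. 0 \<le> edge s t c j \<and> edge s t c j \<le> self_total t) [1..12] \<and>
     list_all (\<lambda>k. 0 \<le> dip t c k) [1..12] \<and>
     list_all (\<lambda>k. list_all (\<lambda>j. - edge s t c (- j) \<le> dip t c k) [2 * k..12]) [1..6] \<and>
     (6 \<le> c \<longrightarrow>
       list_all (\<lambda>i. edge s t c i \<le> edge s t c (i + 1)) [1..c - 5] \<and>
       list_all (\<lambda>k. dip t c (k + 1) \<le> dip t c k) [4..12] \<and>
       edge s t c 1 - edge s t c (- 3) \<le> dip t c 2 \<and>
       edge s t c 1 - edge s t c (- 5) \<le> dip t c 3 \<and>
       (c = 6 \<or> edge s t c 2 - edge s t c (- 4) \<le> dip t c 3) \<and>
       list_all (\<lambda>j. edge s t c (- j) < edge s t c (- j - 1) \<longrightarrow>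
          list_all (\<lambda>k. 2 * k \<le> c - 5 + j \<longrightarrow> self_total t - edge s t c (- j) \<le> dip t c k) [4..j - 1]) [5..12])"

text \<open>The nine topmost arguments reach down to \<open>m + c - 4\<close>. For small
  \<open>c\<close> the window stops at \<open>m + 1\<close>, since up to \<open>m\<close> the
  profile is nonpositive anyway.\<close>

definition window_check :: "bool \<Rightarrow> nat \<Rightarrow> int \<Rightarrow> bool" where
  "window_check s t c \<longleftrightarrow>
     list_all (\<lambda>m. lc_window (map (\<lambda>i. profile s t c m (m + c + 4 - i)) [0..min 8 (c + 3)]) 0 0) [1..8]"

lemma check_base0:
  "list_all (\<lambda>c. profile_check True 0 c \<and> window_check True 0 c) [2..8]"
  "list_all (\<lambda>c. profile_check False 0 c \<and> window_check False 0 c) [2..8]"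
  by code_simp+

lemma check_base1:
  "list_all (\<lambda>c. profile_check True 1 c \<and> window_check True 1 c) [1..8]"
  "list_all (\<lambda>c. profile_check False 1 c \<and> window_check False 1 c) [1..8]"
  by code_simp+

lemma check_base2:
  "list_all (\<lambda>c. profile_check True 2 c \<and> window_check True 2 c) [1..8]"
  "list_all (\<lambda>c. profile_check False 2 c \<and> window_check False 2 c) [1..8]"
  by code_simp+

lemma check_base3:
  "list_all (\<lambda>c. profile_check True 3 c \<and> window_check True 3 c) [1..8]"
  "list_all (\<lambda>c. profile_check False 3 c \<and> window_check False 3 c) [1..8]"
  by code_simp+

lemma dip_check: "list_all (\<lambda>t. list_all (\<lambda>k. self_total t \<le> dip t 8 k) [1..4]) [0,1,2,3]"
  by code_simp

lemma checks:
  assumes "t < 4" "1 \<le> c" "c \<le> 8" "t = 0 \<Longrightarrow> 2 \<le> c"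
  shows "profile_check s t c \<and> window_check s t c"
proof -
  have "c \<in> set [1..8]" "t = 0 \<Longrightarrow> c \<in> set [2..8]" "t = 0 \<or> t = 1 \<or> t = 2 \<or> t = 3" using assms by auto
  moreover have "s = True \<or> s = False" by simp
  ultimately show ?thesis
    using check_base0 check_base1 check_base2 check_base3 unfolding list_all_iff
    by (elim disjE; hypsubst; blast)
qed

lemma self_total_le_dip:
  assumes "t < 4" "8 \<le> c" "1 \<le> k" "k < c - 3"
  shows "self_total t \<le> dip t c k"
proof -
  have "stretch c k \<in> set [1..4]" "t \<in> set [0,1,2,3]" using assms by (auto simp: stretch_def)
  then have "self_total t \<le> dip t 8 (stretch c k)" using dip_check unfolding list_all_iff by blast
  then show ?thesis using dip_stretch[of c k t] assms by simp
qed

context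
  fixes s :: bool and t :: nat and c :: int
  assumes t: "t < 4" and c: "1 \<le> c" "t = 0 \<Longrightarrow> 2 \<le> c"
begin

lemma reduce_nonneg:
  assumes "0 \<le> j"
  obtains c' j' where "1 \<le> c'" "c' \<le> 8" "t = 0 \<Longrightarrow> 2 \<le> c'" "0 \<le> j'" "1 \<le> j \<Longrightarrow> 1 \<le> j'"
    "edge s t c j = edge s t c' j'" "edge s t c (- j) = edge s t c' (- j')" "1 \<le> j \<Longrightarrow> dip t c j = dip t c' j'"
proof (cases "c \<le> 8")
  case True
  then show ?thesis using that[of c j] assms c by simp
next
  case False
  then show ?thesis using that[of 8 "stretch c j"] edge_stretch[of c j s t] dip_stretch[of c j t] assms
    by (simp add: stretch_def)
qed

lemma edge_neg: "0 \<le> j \<Longrightarrow> 0 \<le> - edge s t c (- j) \<and> - edge s t c (- j) \<le> self_total t"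
proof -
  assume "0 \<le> j"
  then obtain c' j' where c': "1 \<le> c'" "c' \<le> 8" "t = 0 \<Longrightarrow> 2 \<le> c'" "0 \<le> j'" "edge s t c (- j) = edge s t c' (- j')"
    using reduce_nonneg by metis
  show ?thesis
  proof (cases "j' \<le> 12")
    case True
    then have "j' \<in> set [0..12]" using c' by simp
    then show ?thesis using checks[of t c' s] t c' unfolding profile_check_def list_all_iff by auto
  next
    case False
    then show ?thesis using c' by (simp add: edge_zero self_sum_def)
  qed
qed

lemma edge_pos: "1 \<le> j \<Longrightarrow> 0 \<le> edge s t c j \<and> edge s t c j \<le> self_total t"
proof -
  assume j: "1 \<le> j"
  then have "0 \<le> j" by simp
  from reduce_nonneg[OF this] j obtain c' j' where c': "1 \<le> c'" "c' \<le> 8" "t = 0 \<Longrightarrow> 2 \<le> c'" "1 \<le> j'" "edge s t c j = edge s t c' j'"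
    by metis
  show ?thesis
  proof (cases "j' \<le> 12")
    case True
    then have "j' \<in> set [1..12]" using c' by simp
    then show ?thesis using checks[of t c' s] t c' unfolding profile_check_def list_all_iff by auto
  next
    case False
    then show ?thesis using c' by (simp add: edge_zero self_sum_def)
  qed
qed

lemma dip_pos: "1 \<le> k \<Longrightarrow> 0 \<le> dip t c k"
proof -
  assume k: "1 \<le> k"
  then have "0 \<le> k" by simp
  from reduce_nonneg[OF this] k obtain c' j' where c': "1 \<le> c'" "c' \<le> 8" "t = 0 \<Longrightarrow> 2 \<le> c'" "1 \<le> j'" "dip t c k = dip t c' j'"
    by metis
  show ?thesis
  proof (cases "j' \<le> 12")
    case True
    then have "j' \<in> set [1..12]" using c' by simp
    then show ?thesis using checks[of t c' s] t c' unfolding profile_check_def list_all_iff by auto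
  next
    case False
    then show ?thesis using c' by (simp add: dip_zero)
  qed
qed

lemma edge_neg_le_dip:
  assumes "1 \<le> k" "2 * k \<le> j"
  shows "- edge s t c (- j) \<le> dip t c k"
proof -
  have small: "- edge s t c' (- j) \<le> dip t c' k" if "1 \<le> c'" "c' \<le> 8" "t = 0 \<Longrightarrow> 2 \<le> c'" "0 \<le> dip t c' k"
    "1 \<le> k" "2 * k \<le> j" for c' k j
  proof (cases "j \<le> 12")
    case True
    then have "k \<in> set [1..6]" "j \<in> set [2 * k..12]" using that by auto
    then show ?thesis using checks[of t c' s] t that unfolding profile_check_def list_all_iff by blast
  next
    case False
    then show ?thesis using that by (simp add: edge_zero)
  qed
  show ?thesis
  proof (cases "c \<le> 8")
    case True
    then show ?thesis using small[of c k j] c dip_pos assms by simp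
  next
    case False
    show ?thesis
    proof (cases "k < c - 3")
      case True
      then show ?thesis using self_total_le_dip[of t c k] edge_neg[of j] False assms t by simp
    next
      case kc: False
      \<comment> \<open>Above the plateau both arguments are lowered by \<open>c - 8\<close>. Twice
        \<open>k\<close> loses twice that amount, so \<open>2 * k <= j\<close> survives.\<close>
      then have "- edge s t 8 (- stretch c j) \<le> dip t 8 (stretch c k)"
        using False assms dip_stretch[of c k t] dip_pos[of k]
        by (intro small) (auto simp: stretch_def)
      then show ?thesis using edge_stretch[of c j s t] dip_stretch[of c k t] assms False by simp
    qed
  qed
qed

text \<open>Here \<open>k - m <= 0\<close>, where the edge is nonpositive, and the reflected edge is
  dominated by the dip because \<open>k + m >= 2 * k\<close>.\<close>

lemma profile_nonpos:
  assumes "1 \<le> k" "k \<le> m"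
  shows "profile s t c m k \<le> 0"
  using edge_neg[of "m - k"] edge_neg_le_dip[of k "k + m"] assms by (simp add: profile_def add.commute)

lemma edge_mono:
  assumes "1 \<le> i" "i \<le> c - 5"
  shows "edge s t c i \<le> edge s t c (i + 1)"
proof -
  have small: "edge s t c' i \<le> edge s t c' (i + 1)" if "6 \<le> c'" "c' \<le> 8" "1 \<le> i" "i \<le> c' - 5" for c' i
    using checks[of t c' s] that t unfolding profile_check_def list_all_iff by simp
  show ?thesis
  proof (cases "c \<le> 8 \<or> i \<le> 3")
    case True
    then show ?thesis
      using small[of c i] small[of 8 i] assms edge_stretch(1)[of c i s t] edge_stretch(1)[of c "i + 1" s t]
      by (cases "c \<le> 8") (simp_all add: stretch_def)
  next
    case False
    then have "stretch c i = 4" "stretch c (i + 1) = 4" using assms by (auto simp: stretch_def)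
    then show ?thesis
      using False assms edge_stretch(1)[of c i s t] edge_stretch(1)[of c "i + 1" s t] by simp
  qed
qed

lemma dip_antimono:
  assumes "4 \<le> k" "6 \<le> c"
  shows "dip t c (k + 1) \<le> dip t c k"
proof -
  have small: "dip t c' (k + 1) \<le> dip t c' k" if "6 \<le> c'" "c' \<le> 8" "4 \<le> k" for c' k
  proof (cases "k \<le> 12")
    case True
    then have "k \<in> set [4..12]" using that by (simp only: set_upto atLeastAtMost_iff)
    moreover have "\<forall>k\<in>set [4..12]. dip t c' (k + 1) \<le> dip t c' k"
      using checks[of t c' s] that t unfolding profile_check_def list_all_iff by auto
    ultimately show ?thesis by blast
  qed (use that in \<open>simp add: dip_zero\<close>)
  show ?thesis
  proof (cases "c \<le> 8")
    case False
    have b: "dip t c k = dip t 8 (stretch c k)" "dip t c (k + 1) = dip t 8 (stretch c (k + 1))"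
      using dip_stretch False assms by simp_all
    show ?thesis
    proof (cases "k \<le> c - 5")
      case True
      then have "stretch c k = 4" "stretch c (k + 1) = 4" using assms by (auto simp: stretch_def)
      then show ?thesis unfolding b by simp
    next
      case kc: False
      then have "stretch c k = k - c + 8" "stretch c (k + 1) = k - c + 8 + 1"
        using assms False by (auto simp: stretch_def)
      then show ?thesis unfolding b using small[of 8 "k - c + 8"] kc by simp
    qed
  qed (use small assms in auto)
qed

text \<open>The dip is known to decrease only from 4 on, so \<open>k <= 3\<close> stays outside the
  monotonicity argument; only three pairs \<open>(k, m)\<close> are left.\<close>

lemma profile_small:
  assumes "1 \<le> m" "m < k" "k \<le> 3" "k - m \<le> c - 5"
  shows "profile s t c m k \<le> 0"
proof -
  have 6: "6 \<le> c" using assms by simp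
  have small: "edge s t c' 1 - edge s t c' (- 3) \<le> dip t c' 2" "edge s t c' 1 - edge s t c' (- 5) \<le> dip t c' 3"
    "c' = 6 \<or> edge s t c' 2 - edge s t c' (- 4) \<le> dip t c' 3" if "6 \<le> c'" "c' \<le> 8" for c'
    using checks[of t c' s] that t unfolding profile_check_def by auto
  have all: "edge s t c 1 - edge s t c (- 3) \<le> dip t c 2" "edge s t c 1 - edge s t c (- 5) \<le> dip t c 3"
    "7 \<le> c \<longrightarrow> edge s t c 2 - edge s t c (- 4) \<le> dip t c 3"
  proof -
    have stretch_simps: "stretch c 1 = 1" "stretch c 2 = 2" "stretch c 3 = 3" "stretch c 4 = 4" "stretch c 5 = 4"
      if "8 < c" using that by (auto simp: stretch_def)
    have st: "edge s t c 1 = edge s t 8 1" "edge s t c 2 = edge s t 8 2" "edge s t c (- 3) = edge s t 8 (- 3)"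
      "edge s t c (- 4) = edge s t 8 (- 4)" "edge s t c (- 5) = edge s t 8 (- 4)"
      "dip t c 2 = dip t 8 2" "dip t c 3 = dip t 8 3" if "8 < c"
      using that edge_stretch(1)[of c 1 s t] edge_stretch(1)[of c 2 s t] edge_stretch(2)[of c 3 s t]
        edge_stretch(2)[of c 4 s t] edge_stretch(2)[of c 5 s t] dip_stretch[of c 2 t] dip_stretch[of c 3 t]
      by (simp_all add: stretch_simps)
    show "edge s t c 1 - edge s t c (- 3) \<le> dip t c 2"
      using small(1)[of c] small(1)[of 8] st 6 by (cases "c \<le> 8") auto
    show "7 \<le> c \<longrightarrow> edge s t c 2 - edge s t c (- 4) \<le> dip t c 3"
      using small(3)[of c] small(3)[of 8] st 6 by (cases "c \<le> 8") auto
    \<comment> \<open>For \<open>c > 8\<close> the arguments -4 and -5 lie on one plateau, so the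
      bound for (3, 2) follows from the one for (3, 1).\<close>
    have "8 < c \<Longrightarrow> edge s t 8 1 \<le> edge s t 8 2" using edge_mono[of 1] st by simp
    then show "edge s t c 1 - edge s t c (- 5) \<le> dip t c 3"
      using small(2)[of c] small(3)[of 8] st 6 by (cases "c \<le> 8") auto
  qed
  have "k = 2 \<and> m = 1 \<or> k = 3 \<and> m = 2 \<or> k = 3 \<and> m = 1" using assms by auto
  then show ?thesis using all assms(4) by (auto simp: profile_def)
qed

text \<open>If the term \<open>- edge s t c (- j)\<close> falls after \<open>j\<close>, this bound
  makes the profile nonpositive at \<open>k = j - m\<close>, as the other edge is at most
  \<open>self_total t\<close>. So the term cannot fall where the profile is positive. For
  \<open>j = k + m\<close> the third premise reads \<open>k <= m + c - 5\<close>, the range below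
  the window.\<close>

lemma drop_bound:
  assumes "4 \<le> k" "k < j" "2 * k \<le> c - 5 + j" "6 \<le> c" "edge s t c (- j) < edge s t c (- j - 1)"
  shows "self_total t - edge s t c (- j) \<le> dip t c k"
proof -
  have small: "self_total t - edge s t c' (- j) \<le> dip t c' k"
    if "4 \<le> k" "k < j" "2 * k \<le> c' - 5 + j" "6 \<le> c'" "c' \<le> 8" "edge s t c' (- j) < edge s t c' (- j - 1)" for c' k j
  proof (cases "j \<le> 12")
    case True
    then have "j \<in> set [5..12]" "k \<in> set [4..j - 1]"
      using that unfolding set_upto atLeastAtMost_iff by linarith+
    moreover have "\<forall>j\<in>set [5..12]. edge s t c' (- j) < edge s t c' (- j - 1) \<longrightarrow>
        (\<forall>k\<in>set [4..j - 1]. 2 * k \<le> c' - 5 + j \<longrightarrow> self_total t - edge s t c' (- j) \<le> dip t c' k)"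
    proof -
      have "profile_check s t c'" using checks[of t c' s] that(4,5) t by simp
      then show ?thesis using that(4) unfolding profile_check_def list_all_iff by blast
    qed
    ultimately show ?thesis using that(3,6) by blast
  next
    case False
    have "- j - 1 = - (j + 1)" by simp
    then show ?thesis using False that edge_zero(2)[of c' j s t] edge_zero(2)[of c' "j + 1" s t] by simp
  qed
  show ?thesis
  proof (cases "c \<le> 8")
    case True
    then show ?thesis using small[of k j c] assms by simp
  next
    case False
    then have c8: "8 \<le> c" by simp
    have st: "edge s t c (- j) = edge s t 8 (- stretch c j)" "edge s t c (- j - 1) = edge s t 8 (- stretch c (j + 1))"
    proof -
      have e: "- j - 1 = - (j + 1)" by simp
      show "edge s t c (- j) = edge s t 8 (- stretch c j)" using edge_stretch(2)[of c j s t] c8 assms by simp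
      show "edge s t c (- j - 1) = edge s t 8 (- stretch c (j + 1))"
        unfolding e using edge_stretch(2)[of c "j + 1" s t] c8 assms by simp
    qed
    have jc: "c - 4 \<le> j"
    proof (rule ccontr)
      assume "\<not> c - 4 \<le> j"
      then have "stretch c j = stretch c (j + 1)" using assms by (simp add: stretch_def)
      then show False using st assms by simp
    qed
    then have j8: "stretch c j = j - c + 8" "stretch c (j + 1) = j - c + 8 + 1" using assms False by (auto simp: stretch_def)
    show ?thesis
    proof (cases "c - 4 \<le> k")
      case True
      then have k8: "stretch c k = k - c + 8" using assms c8 by (simp add: stretch_def)
      \<comment> \<open>Lowering \<open>k\<close> and \<open>j\<close> by \<open>c - 8\<close> turns
        \<open>2 * k <= c - 5 + j\<close> into exactly the same condition for
        \<open>c = 8\<close>.\<close>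
      define k' j' where "k' = k - c + 8" and "j' = j - c + 8"
      have "- (j' + 1) = - j' - 1" by simp
      then have a: "edge s t 8 (- j') < edge s t 8 (- j' - 1)" using assms(5) unfolding st j8 j'_def by metis
      have "self_total t - edge s t 8 (- j') \<le> dip t 8 k'"
        by (rule small) (use True assms False a in \<open>simp_all add: k'_def j'_def\<close>)
      then show ?thesis
        using st(1) dip_stretch[of c k t] c8 assms unfolding j8 k8 k'_def j'_def by simp
    next
      case False
      \<comment> \<open>On its plateau the dip is twice \<open>self_total t\<close>, enough for the
        largest possible values of both edges.\<close>
      then have "dip t c k = dip t 8 4" using assms c8 dip_stretch[of c k t] by (auto simp: stretch_def)
      moreover have "dip t 8 4 = 2 * self_total t"
        by (simp add: dip_def self_step_def cross_low self_excess_outside self_sum_low self_sum_high)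
      ultimately show ?thesis using edge_neg[of j] assms by simp
    qed
  qed
qed

text \<open>Every term moves in the right direction: the edge does not fall up to
  \<open>c - 5\<close>, the dip does not rise from 4 on, and positivity excludes a fall of the
  reflected edge.\<close>

lemma profile_mono:
  assumes "1 \<le> m" "m < k" "k \<le> m + c - 5" "0 < profile s t c m k"
  shows "profile s t c m k \<le> profile s t c m (k + 1)"
proof -
  have c6: "6 \<le> c" using assms by simp
  have k4: "4 \<le> k" using profile_small[of m k] assms by force
  have "\<not> edge s t c (- k - m) < edge s t c (- k - m - 1)"
  proof
    assume "edge s t c (- k - m) < edge s t c (- k - m - 1)"
    then have "self_total t - edge s t c (- (k + m)) \<le> dip t c k"
      using k4 assms c6 by (intro drop_bound) (auto simp: algebra_simps)
    moreover have "edge s t c (k - m) \<le> self_total t" using edge_pos[of "k - m"] assms by simp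
    moreover have "- (k + m) = - k - m" by simp
    ultimately show False using assms(4) by (simp add: profile_def)
  qed
  moreover have "edge s t c (k - m) \<le> edge s t c (k - m + 1)" using edge_mono[of "k - m"] assms by simp
  moreover have "profile s t c m (k + 1) = edge s t c (k - m + 1) - edge s t c (- k - m - 1) - dip t c (k + 1)"
  proof -
    have e: "- (k + 1) - m = - k - m - 1" "k + 1 - m = k - m + 1" by simp_all
    show ?thesis unfolding profile_def e by (rule refl)
  qed
  ultimately show ?thesis using dip_antimono[OF k4 c6] by (simp add: profile_def)
qed

lemma profile_window:
  assumes "1 \<le> m"
  shows "lc_window (map (\<lambda>i. profile s t c m (m + c + 4 - i)) [0..min 8 (c + 3)]) 0 0"
proof -
  define c' where "c' = min c 8"
  define m' where "m' = min m 8"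
  have c': "1 \<le> c'" "c' \<le> 8" "t = 0 \<Longrightarrow> 2 \<le> c'" "m' \<in> set [1..8]" using c assms by (auto simp: c'_def m'_def)
  have "profile s t c m (m + c + 4 - i) = profile s t c' m' (m' + c' + 4 - i)" if "0 \<le> i" "i \<le> 8" "i \<le> c + 3" for i
  proof -
    have 1: "profile s t c m (m + c + 4 - i) = profile s t c m' (m' + c + 4 - i)"
    proof (cases "m \<le> 8")
      case True
      then show ?thesis by (simp add: m'_def)
    next
      case False
      \<comment> \<open>For \<open>m >= 8\<close> the whole window lies beyond the supports of the
        reflected edge and of the dip, so its content no longer depends on \<open>m\<close>.\<close>
      have far: "profile s t c m (m + c + 4 - i) = edge s t c (c + 4 - i)" if "8 \<le> m" for m
      proof -
        have e: "- (m + c + 4 - i) - m = - (2 * m + c + 4 - i)" "m + c + 4 - i - m = c + 4 - i" by simp_all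
        have "edge s t c (- (2 * m + c + 4 - i)) = 0" "dip t c (m + c + 4 - i) = 0"
          using that \<open>i \<le> 8\<close> c by (simp_all only: edge_zero(2) dip_zero)
        then show ?thesis unfolding profile_def e by simp
      qed
      from False far[of m] far[of 8] show ?thesis by (simp add: m'_def)
    qed
    have 2: "profile s t c m (m + c + 4 - i) = profile s t c' m (m + c' + 4 - i)" if "1 \<le> m" for m
    proof (cases "c \<le> 8")
      case True
      then show ?thesis by (simp add: c'_def)
    next
      case False
      have e: "- (m + c + 4 - i) - m = - (2 * m + c + 4 - i)" "m + c + 4 - i - m = c + 4 - i" for c by simp_all
      \<comment> \<open>Since \<open>i <= 8\<close>, the arguments stay above the plateau, where
        \<open>stretch\<close> is a translation.\<close>
      have st: "stretch c (x + c + 4 - i) = x + 8 + 4 - i" if "0 \<le> x" for x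
        using that \<open>i \<le> 8\<close> False by (auto simp: stretch_def)
      have "edge s t c (c + 4 - i) = edge s t 8 (8 + 4 - i)"
        using edge_stretch(1)[of c "c + 4 - i" s t] st[of 0] False \<open>i \<le> 8\<close> by simp
      moreover have "edge s t c (- (2 * m + c + 4 - i)) = edge s t 8 (- (2 * m + 8 + 4 - i))"
        using edge_stretch(2)[of c "2 * m + c + 4 - i" s t] st[of "2 * m"] False \<open>i \<le> 8\<close> that by simp
      moreover have "dip t c (m + c + 4 - i) = dip t 8 (m + 8 + 4 - i)"
        using dip_stretch[of c "m + c + 4 - i" t] st[of m] False \<open>i \<le> 8\<close> that by simp
      moreover have "c' = 8" using False by (simp add: c'_def)
      ultimately show ?thesis unfolding profile_def e by simp
    qed
    show ?thesis using 1 2[of m'] c' by simp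
  qed
  then have "map (\<lambda>i. profile s t c m (m + c + 4 - i)) [0..min 8 (c + 3)] = map (\<lambda>i. profile s t c' m' (m' + c' + 4 - i)) [0..min 8 (c' + 3)]"
    by (intro map_cong arg_cong[of _ _ "upto 0"]) (auto simp: c'_def)
  moreover have "window_check s t c'" using checks[of t c' s] c' t by blast
  ultimately show ?thesis using c'(4) unfolding window_check_def list_all_iff by metis
qed

lemma log_concave_tail_profile:
  assumes m: "1 \<le> m" and v: "v 0 = 0" "\<And>k. m + c + 4 \<le> k \<Longrightarrow> v k = 0"
    and e: "\<And>k. second_diff v k = profile s t c m k"
  shows "log_concave_tail v"
proof (rule convex_concave_imp_log_concave_tail)
  show "lc_window (map (\<lambda>i. second_diff v (m + c + 4 - i)) [0..min 8 (c + 3)]) 0 0"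
    unfolding e by (rule profile_window[OF m])
  \<comment> \<open>Below the window either \<open>k <= m\<close>, where nothing is positive, or
    \<open>k <= m + c - 5\<close>, where \<open>profile_mono\<close> applies.\<close>
  show "second_diff v k \<le> second_diff v (k + 1)"
    if "1 \<le> k" "k < m + c + 4 - min 8 (c + 3)" "0 < second_diff v k" for k
    using that profile_nonpos[of k m] profile_mono[of m k] m unfolding e by (cases "k \<le> m") auto
qed (use m c v in auto)

end

section \<open>Rigid triples and Euclid's algorithm\<close>

lemma mult_scalar:
  assumes "A \<in> carrier_mat m n"
  shows "A * (k \<cdot>\<^sub>m 1\<^sub>m n) = k \<cdot>\<^sub>m (A :: complex mat)"
  using assms mult_smult_distrib[of A m n "1\<^sub>m n" n k] by simp

text \<open>Side conditions on dimensions, unlike carrier sets with free size parameters, can be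
  discharged by rewriting, so products reassociate automatically.\<close>

lemma mult_assoc_dim: "dim_col A = dim_row B \<Longrightarrow> dim_col B = dim_row C \<Longrightarrow> (A * B) * C = A * (B * (C :: complex mat))"
  by (rule assoc_mult_mat[of _ "dim_row A" "dim_col A" _ "dim_col B" _ "dim_col C"]) auto

definition inverse_pair :: "nat \<Rightarrow> complex mat \<Rightarrow> complex mat \<Rightarrow> bool" where
  "inverse_pair n G G' \<longleftrightarrow> G \<in> carrier_mat n n \<and> G' \<in> carrier_mat n n \<and> G * G' = 1\<^sub>m n \<and> G' * G = 1\<^sub>m n"

lemma inverse_pair_mult:
  assumes "inverse_pair n G G'" "inverse_pair n H H'"
  shows "inverse_pair n (G * H) (H' * G')"
proof -
  have c: "dim_row G = n" "dim_col G = n" "dim_row G' = n" "dim_col G' = n"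
    "dim_row H = n" "dim_col H = n" "dim_row H' = n" "dim_col H' = n"
    using assms unfolding inverse_pair_def by auto
  have "G * H * (H' * G') = G * ((H * H') * G')" "H' * G' * (G * H) = H' * ((G' * G) * H)"
    using c by (simp_all add: mult_assoc_dim)
  then show ?thesis using assms unfolding inverse_pair_def by auto
qed

lemma inverse_pair_block:
  assumes "inverse_pair m G G'" "inverse_pair n H H'"
  shows "inverse_pair (m + n) (four_block_mat G (0\<^sub>m m n) (0\<^sub>m n m) H) (four_block_mat G' (0\<^sub>m m n) (0\<^sub>m n m) H')"
  using assms unfolding inverse_pair_def
  by (auto simp: mult_four_block_mat[of _ m m _ n _ n _ _ m _ n])

definition rank_form :: "nat \<Rightarrow> nat \<Rightarrow> nat \<Rightarrow> complex mat" where
  "rank_form b a r = mat b a (\<lambda>(i, j). if i = j \<and> i < r then 1 else 0)"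

lemma rank_form_carrier [simp]: "rank_form b a r \<in> carrier_mat b a"
  by (simp add: rank_form_def)

lemma inverse_pair_swap: "k < n \<Longrightarrow> l < n \<Longrightarrow> inverse_pair n (swaprows_mat n k l) (swaprows_mat n k l)"
  unfolding inverse_pair_def using swaprows_mat_inv by auto

text \<open>Gaussian elimination on both sides: swaps move a nonzero entry to the corner, one block
  elimination on each side clears its row and column, and induction treats the remaining
  block.\<close>

lemma rank_normal_form:
  assumes "C \<in> carrier_mat b a"
  shows "\<exists>H H' G G' r. inverse_pair b H H' \<and> inverse_pair a G G' \<and> r \<le> a \<and> r \<le> b \<and> H * C * G = rank_form b a r"
  using assms
proof (induction b arbitrary: a C)
  case 0
  then have "inverse_pair 0 (1\<^sub>m 0) (1\<^sub>m 0) \<and> inverse_pair a (1\<^sub>m a) (1\<^sub>m a) \<and> 0 \<le> a \<and> (0::nat) \<le> 0 \<and>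
      1\<^sub>m 0 * C * 1\<^sub>m a = rank_form 0 a 0"
    by (auto simp: inverse_pair_def rank_form_def)
  then show ?case by blast
next
  case (Suc b a C)
  show ?case
  proof (cases "C = 0\<^sub>m (Suc b) a")
    case True
    then have "C = rank_form (Suc b) a 0" by (auto simp: rank_form_def)
    then have "inverse_pair (Suc b) (1\<^sub>m (Suc b)) (1\<^sub>m (Suc b)) \<and> inverse_pair a (1\<^sub>m a) (1\<^sub>m a) \<and> 0 \<le> a \<and> 0 \<le> Suc b \<and>
      1\<^sub>m (Suc b) * C * 1\<^sub>m a = rank_form (Suc b) a 0"
      using left_mult_one_mat[of "rank_form (Suc b) a 0" "Suc b" a] right_mult_one_mat[of "rank_form (Suc b) a 0" "Suc b" a]
      by (simp add: inverse_pair_def)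
    then show ?thesis by blast
  next
    case False
    then obtain p q where pq: "p < Suc b" "q < a" "C $$ (p, q) \<noteq> 0"
      using Suc.prems by (metis carrier_matD eq_matI index_zero_mat)
    then obtain a' where a': "a = Suc a'" by (cases a) auto
    define H1 :: "complex mat" where "H1 = swaprows_mat (Suc b) 0 p"
    define G1 :: "complex mat" where "G1 = swaprows_mat a 0 q"
    have H1: "inverse_pair (Suc b) H1 H1" and G1: "inverse_pair a G1 G1"
      unfolding H1_def G1_def using pq inverse_pair_swap by auto
    define X where "X = H1 * C * G1"
    have X: "X \<in> carrier_mat (Suc b) (Suc a')" using H1 G1 Suc.prems a' by (auto simp: X_def inverse_pair_def)
    have HC: "H1 * C = swaprows 0 p C" unfolding H1_def using Suc.prems pq by (intro swaprows_mat[symmetric]) auto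
    have x: "X $$ (0, 0) \<noteq> 0"
    proof -
      have "X $$ (0, 0) = (\<Sum>i = 0..<a. (H1 * C) $$ (0, i) * G1 $$ (i, 0))"
        unfolding X_def using H1 G1 Suc.prems a' by (auto simp: inverse_pair_def scalar_prod_def)
      also have "\<dots> = (\<Sum>i = 0..<a. if i = q then C $$ (p, q) else 0)"
        unfolding HC using Suc.prems pq a' by (intro sum.cong) (auto simp: G1_def)
      also have "\<dots> = C $$ (p, q)" using pq by simp
      finally show ?thesis using pq by simp
    qed
    obtain X1 X2 X3 X4 where sb: "split_block X 1 1 = (X1, X2, X3, X4)" by (metis prod_cases4)
    have Xb: "X1 \<in> carrier_mat 1 1" "X2 \<in> carrier_mat 1 a'" "X3 \<in> carrier_mat b 1" "X4 \<in> carrier_mat b a'"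
      "X = four_block_mat X1 X2 X3 X4"
      using split_block[OF sb, of b a'] X by auto
    define c where "c = X $$ (0, 0)"
    have X1: "X1 = c \<cdot>\<^sub>m 1\<^sub>m 1" using Xb by (intro eq_matI) (auto simp: c_def)
    have c0: "c \<noteq> 0" using x by (simp add: c_def)
    define H2 where "H2 = four_block_mat ((1 / c) \<cdot>\<^sub>m 1\<^sub>m 1) (0\<^sub>m 1 b) ((- 1 / c) \<cdot>\<^sub>m X3) (1\<^sub>m b)"
    define H2' where "H2' = four_block_mat (c \<cdot>\<^sub>m 1\<^sub>m 1) (0\<^sub>m 1 b) X3 (1\<^sub>m b)"
    define G2 where "G2 = four_block_mat (1\<^sub>m 1) ((- 1 / c) \<cdot>\<^sub>m X2) (0\<^sub>m a' 1) (1\<^sub>m a')"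
    define G2' where "G2' = four_block_mat (1\<^sub>m 1) ((1 / c) \<cdot>\<^sub>m X2) (0\<^sub>m a' 1) (1\<^sub>m a')"
    have H2: "inverse_pair (Suc b) H2 H2'"
    proof -
      have s: "(1 / c) \<cdot>\<^sub>m 1\<^sub>m 1 * (c \<cdot>\<^sub>m 1\<^sub>m 1) = 1\<^sub>m 1" "c \<cdot>\<^sub>m 1\<^sub>m 1 * ((1 / c) \<cdot>\<^sub>m 1\<^sub>m 1) = 1\<^sub>m 1"
        "(- 1 / c) \<cdot>\<^sub>m X3 * (c \<cdot>\<^sub>m 1\<^sub>m 1) + X3 = 0\<^sub>m b 1"
        "X3 * ((1 / c) \<cdot>\<^sub>m 1\<^sub>m 1) + (- 1 / c) \<cdot>\<^sub>m X3 = 0\<^sub>m b 1"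
        using Xb c0 by (auto simp: mult_scalar[of _ 1 1] mult_scalar[of _ b 1])
      have "H2 * H2' = four_block_mat (1\<^sub>m 1) (0\<^sub>m 1 b) (0\<^sub>m b 1) (1\<^sub>m b)"
        unfolding H2_def H2'_def using Xb c0
        by (subst mult_four_block_mat[where ?nr1.0 = 1 and ?n1.0 = 1 and ?n2.0 = b and ?nr2.0 = b and ?nc1.0 = 1 and ?nc2.0 = b])
          (use s in auto)
      moreover have "H2' * H2 = four_block_mat (1\<^sub>m 1) (0\<^sub>m 1 b) (0\<^sub>m b 1) (1\<^sub>m b)"
        unfolding H2_def H2'_def using Xb c0
        by (subst mult_four_block_mat[where ?nr1.0 = 1 and ?n1.0 = 1 and ?n2.0 = b and ?nr2.0 = b and ?nc1.0 = 1 and ?nc2.0 = b])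
          (use s in auto)
      ultimately show ?thesis unfolding inverse_pair_def using Xb by (auto simp: H2_def H2'_def)
    qed
    have G2: "inverse_pair (Suc a') G2 G2'"
    proof -
      have s: "(1 / c) \<cdot>\<^sub>m X2 + (- 1 / c) \<cdot>\<^sub>m X2 = 0\<^sub>m 1 a'" "(- 1 / c) \<cdot>\<^sub>m X2 + (1 / c) \<cdot>\<^sub>m X2 = 0\<^sub>m 1 a'"
        using Xb by auto
      have "G2 * G2' = four_block_mat (1\<^sub>m 1) (0\<^sub>m 1 a') (0\<^sub>m a' 1) (1\<^sub>m a')"
        unfolding G2_def G2'_def using Xb
        by (subst mult_four_block_mat[where ?nr1.0 = 1 and ?n1.0 = 1 and ?n2.0 = a' and ?nr2.0 = a' and ?nc1.0 = 1 and ?nc2.0 = a'])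
          (use s in auto)
      moreover have "G2' * G2 = four_block_mat (1\<^sub>m 1) (0\<^sub>m 1 a') (0\<^sub>m a' 1) (1\<^sub>m a')"
        unfolding G2_def G2'_def using Xb
        by (subst mult_four_block_mat[where ?nr1.0 = 1 and ?n1.0 = 1 and ?n2.0 = a' and ?nr2.0 = a' and ?nc1.0 = 1 and ?nc2.0 = a'])
          (use s in auto)
      ultimately show ?thesis unfolding inverse_pair_def using Xb by (auto simp: G2_def G2'_def)
    qed
    define M where "M = X4 + (- 1 / c) \<cdot>\<^sub>m (X3 * X2)"
    have M: "M \<in> carrier_mat b a'" using Xb by (auto simp: M_def)
    have HXG: "H2 * X * G2 = four_block_mat (1\<^sub>m 1) (0\<^sub>m 1 a') (0\<^sub>m b 1) M"
    proof -
      have s: "(1 / c) \<cdot>\<^sub>m 1\<^sub>m 1 * (c \<cdot>\<^sub>m 1\<^sub>m 1) = 1\<^sub>m 1" "(1 / c) \<cdot>\<^sub>m 1\<^sub>m 1 * X2 = (1 / c) \<cdot>\<^sub>m X2"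
        "(- 1 / c) \<cdot>\<^sub>m X3 * (c \<cdot>\<^sub>m 1\<^sub>m 1) + X3 = 0\<^sub>m b 1"
        "(- 1 / c) \<cdot>\<^sub>m X3 * X2 + X4 = X4 + (- 1 / c) \<cdot>\<^sub>m (X3 * X2)"
        using Xb c0 mult_smult_assoc_mat[of "1\<^sub>m 1" 1 1 X2 a' "1 / c"] mult_smult_assoc_mat[of X3 b 1 X2 a' "- 1 / c"]
          comm_add_mat[of "(- 1 / c) \<cdot>\<^sub>m (X3 * X2)" b a' X4]
        by (auto simp: mult_scalar[of _ 1 1] mult_scalar[of _ b 1])
      have "H2 * X = four_block_mat (1\<^sub>m 1) ((1 / c) \<cdot>\<^sub>m X2) (0\<^sub>m b 1) M"
        unfolding Xb(5) H2_def X1 M_def using Xb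
        by (subst mult_four_block_mat[where ?nr1.0 = 1 and ?n1.0 = 1 and ?n2.0 = b and ?nr2.0 = b and ?nc1.0 = 1 and ?nc2.0 = a'])
          (use s in auto)
      then show ?thesis unfolding G2_def using Xb M
        by (simp, subst mult_four_block_mat[where ?nr1.0 = 1 and ?n1.0 = 1 and ?n2.0 = a' and ?nr2.0 = b and ?nc1.0 = 1 and ?nc2.0 = a'])
          auto
    qed
    obtain H H' G G' r where IH: "inverse_pair b H H'" "inverse_pair a' G G'" "r \<le> a'" "r \<le> b" "H * M * G = rank_form b a' r"
      using Suc.IH[OF M] by blast
    have one: "inverse_pair 1 (1\<^sub>m 1) (1\<^sub>m 1)" by (simp add: inverse_pair_def)
    define H3 where "H3 = four_block_mat (1\<^sub>m 1) (0\<^sub>m 1 b) (0\<^sub>m b 1) H"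
    define G3 where "G3 = four_block_mat (1\<^sub>m 1) (0\<^sub>m 1 a') (0\<^sub>m a' 1) G"
    have H3: "inverse_pair (Suc b) H3 (four_block_mat (1\<^sub>m 1) (0\<^sub>m 1 b) (0\<^sub>m b 1) H')"
      and G3: "inverse_pair (Suc a') G3 (four_block_mat (1\<^sub>m 1) (0\<^sub>m 1 a') (0\<^sub>m a' 1) G')"
      using inverse_pair_block[OF one IH(1)] inverse_pair_block[OF one IH(2)] by (simp_all add: H3_def G3_def)
    have "H3 * (H2 * X * G2) = four_block_mat (1\<^sub>m 1) (0\<^sub>m 1 a') (0\<^sub>m b 1) (H * M)"
      unfolding HXG H3_def using IH M
      by (subst mult_four_block_mat[where ?nr1.0 = 1 and ?n1.0 = 1 and ?n2.0 = b and ?nr2.0 = b and ?nc1.0 = 1 and ?nc2.0 = a'])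
        (auto simp: inverse_pair_def)
    then have "H3 * (H2 * X * G2) * G3 = four_block_mat (1\<^sub>m 1) (0\<^sub>m 1 a') (0\<^sub>m b 1) (rank_form b a' r)"
      unfolding G3_def IH(5)[symmetric] using IH M
      by (simp, subst mult_four_block_mat[where ?nr1.0 = 1 and ?n1.0 = 1 and ?n2.0 = a' and ?nr2.0 = b and ?nc1.0 = 1 and ?nc2.0 = a'])
        (auto simp: inverse_pair_def)
    also have "\<dots> = rank_form (Suc b) a (Suc r)"
      unfolding a' rank_form_def by (intro eq_matI) (auto simp: one_mat_def)
    finally have fin: "H3 * (H2 * X * G2) * G3 = rank_form (Suc b) a (Suc r)" .
    have dims: "dim_row H1 = Suc b" "dim_col H1 = Suc b" "dim_row H2 = Suc b" "dim_col H2 = Suc b"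
      "dim_row H3 = Suc b" "dim_col H3 = Suc b" "dim_row G1 = a" "dim_col G1 = a" "dim_row G2 = a" "dim_col G2 = a"
      "dim_row G3 = a" "dim_col G3 = a" "dim_row C = Suc b" "dim_col C = a"
      using H1 H2 H3 G1 G2 G3 Suc.prems a' unfolding inverse_pair_def by auto
    have "H3 * (H2 * H1) * C * (G1 * (G2 * G3)) = H3 * (H2 * X * G2) * G3"
      unfolding X_def using dims by (simp add: mult_assoc_dim)
    with fin inverse_pair_mult[OF H3 inverse_pair_mult[OF H2 H1]] inverse_pair_mult[OF G1 inverse_pair_mult[OF G2[folded a'] G3[folded a']]]
      IH(3,4) a' show ?thesis by (metis Suc_le_mono)
  qed
qed

section \<open>Rigid triples under change of bases and transposition\<close>

lemma mat_dim_distribs: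
  fixes A B C :: "complex mat"
  shows "dim_row A = dim_row B \<Longrightarrow> dim_col A = dim_col B \<Longrightarrow> dim_col A = dim_row C \<Longrightarrow> (A + B) * C = A * C + B * C"
    and "dim_row A = dim_row B \<Longrightarrow> dim_col A = dim_col B \<Longrightarrow> dim_col A = dim_row C \<Longrightarrow> (A - B) * C = A * C - B * C"
    and "dim_row B = dim_row C \<Longrightarrow> dim_col B = dim_col C \<Longrightarrow> dim_col A = dim_row B \<Longrightarrow> A * (B + C) = A * B + A * C"
    and "dim_row B = dim_row C \<Longrightarrow> dim_col B = dim_col C \<Longrightarrow> dim_col A = dim_row B \<Longrightarrow> A * (B - C) = A * B - A * C"
    and "dim_col A = dim_row B \<Longrightarrow> (k \<cdot>\<^sub>m A) * B = k \<cdot>\<^sub>m (A * B)"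
    and "dim_col A = dim_row B \<Longrightarrow> A * (k \<cdot>\<^sub>m B) = k \<cdot>\<^sub>m (A * B)"
  by (rule add_mult_distrib_mat[of _ "dim_row A" "dim_col A" _ _ "dim_col C"] minus_mult_distrib_mat[of _ "dim_row A" "dim_col A" _ _ "dim_col C"]
      mult_add_distrib_mat[of _ "dim_row A" "dim_col A" _ "dim_col B"] mult_minus_distrib_mat[of _ "dim_row A" "dim_col A" _ "dim_col B"]
      mult_smult_assoc_mat[of _ "dim_row A" "dim_col A" _ "dim_col B"] mult_smult_distrib[of _ "dim_row A" "dim_col A" _ "dim_col B"]; force)+

text \<open>The radical of the trace form on all block matrices consists of the scalars only.\<close>

definition rigid :: "nat \<Rightarrow> nat \<Rightarrow> complex mat \<Rightarrow> complex mat \<Rightarrow> complex mat \<Rightarrow> bool" where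
  "rigid a b A C D \<longleftrightarrow> A \<in> carrier_mat a a \<and> C \<in> carrier_mat b a \<and> D \<in> carrier_mat b b \<and>
     (\<forall>X\<in>carrier_mat a a. \<forall>Y\<in>carrier_mat b b. \<forall>Z\<in>carrier_mat a b.
        A * X - X * A = Z * C \<longrightarrow> C * X = Y * C \<longrightarrow> Y * D - D * Y = C * Z \<longrightarrow>
        (\<exists>t. X = t \<cdot>\<^sub>m 1\<^sub>m a \<and> Y = t \<cdot>\<^sub>m 1\<^sub>m b \<and> Z = 0\<^sub>m a b))"

text \<open>The equations say that the block matrix with blocks \<open>P\<close>, \<open>R\<close>,
  0, \<open>Q\<close> is principal for the trace form. No trace is prescribed, so a scalar may be
  added to it.\<close>

definition principal_triple ::
  "nat \<Rightarrow> nat \<Rightarrow> complex mat \<Rightarrow> complex mat \<Rightarrow> complex mat \<Rightarrow> complex mat \<Rightarrow> complex mat \<Rightarrow> complex mat \<Rightarrow> bool" where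
  "principal_triple a b A C D P R Q \<longleftrightarrow> P \<in> carrier_mat a a \<and> R \<in> carrier_mat a b \<and> Q \<in> carrier_mat b b \<and>
     A * P - P * A - R * C = A \<and> C * P - Q * C = C \<and> C * R + (D * Q - Q * D) = D"

lemma inverse_pair_cancel:
  assumes "inverse_pair n G G'"
  shows "dim_row M = n \<Longrightarrow> G * (G' * M) = M" "dim_row M = n \<Longrightarrow> G' * (G * M) = M" "G * G' = 1\<^sub>m n" "G' * G = 1\<^sub>m n"
    "dim_row G = n" "dim_col G = n" "dim_row G' = n" "dim_col G' = n"
  using assms mult_assoc_dim[of G G' M] mult_assoc_dim[of G' G M] unfolding inverse_pair_def by auto

text \<open>A block diagonal change of bases: a radical element \<open>(X, Y, Z)\<close> for the new
  data gives \<open>(G * X * G', H' * Y * H, G * Z * H)\<close> for the old.\<close>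

lemma rigid_conj:
  assumes r: "rigid a b A C D" and G: "inverse_pair a G G'" and H: "inverse_pair b H H'"
  shows "rigid a b (G' * A * G) (H * C * G) (H * D * H')"
  unfolding rigid_def
proof (intro conjI ballI impI)
  have c: "dim_row A = a" "dim_col A = a" "dim_row C = b" "dim_col C = a" "dim_row D = b" "dim_col D = b"
    using r unfolding rigid_def by auto
  note d = c inverse_pair_cancel[OF G] inverse_pair_cancel[OF H] mult_assoc_dim
  show "G' * A * G \<in> carrier_mat a a" "H * C * G \<in> carrier_mat b a" "H * D * H' \<in> carrier_mat b b"
    using d by (auto intro!: carrier_matI)
  fix X Y Z assume X: "X \<in> carrier_mat a a" "Y \<in> carrier_mat b b" "Z \<in> carrier_mat a b"
    and e1: "G' * A * G * X - X * (G' * A * G) = Z * (H * C * G)"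
    and e2: "H * C * G * X = Y * (H * C * G)"
    and e3: "Y * (H * D * H') - H * D * H' * Y = H * C * G * Z"
  have x: "dim_row X = a" "dim_col X = a" "dim_row Y = b" "dim_col Y = b" "dim_row Z = a" "dim_col Z = b" using X by auto
  have "A * (G * X * G') - G * X * G' * A = G * (G' * A * G * X - X * (G' * A * G)) * G'"
    using x by (simp add: d mat_dim_distribs)
  also have "\<dots> = (G * Z * H) * C" unfolding e1 using x by (simp add: d)
  finally have 1: "A * (G * X * G') - G * X * G' * A = (G * Z * H) * C" .
  have "C * (G * X * G') = H' * (H * C * G * X) * G'" using x by (simp add: d)
  also have "\<dots> = (H' * Y * H) * C" unfolding e2 using x by (simp add: d)
  finally have 2: "C * (G * X * G') = (H' * Y * H) * C" .
  have "H' * Y * H * D - D * (H' * Y * H) = H' * (Y * (H * D * H') - H * D * H' * Y) * H"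
    using x by (simp add: d mat_dim_distribs)
  also have "\<dots> = C * (G * Z * H)" unfolding e3 using x by (simp add: d)
  finally have 3: "H' * Y * H * D - D * (H' * Y * H) = C * (G * Z * H)" .
  have "G * X * G' \<in> carrier_mat a a" "H' * Y * H \<in> carrier_mat b b" "G * Z * H \<in> carrier_mat a b"
    using x d by (auto intro!: carrier_matI)
  with 1 2 3 r obtain t where t: "G * X * G' = t \<cdot>\<^sub>m 1\<^sub>m a" "H' * Y * H = t \<cdot>\<^sub>m 1\<^sub>m b" "G * Z * H = 0\<^sub>m a b"
    unfolding rigid_def by blast
  have "X = G' * (G * X * G') * G" "Y = H * (H' * Y * H) * H'" "Z = G' * (G * Z * H) * H'"
    using x by (simp_all add: d)
  then have "X = t \<cdot>\<^sub>m 1\<^sub>m a" "Y = t \<cdot>\<^sub>m 1\<^sub>m b" "Z = 0\<^sub>m a b"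
    unfolding t by (simp_all add: d mat_dim_distribs)
  then show "\<exists>t. X = t \<cdot>\<^sub>m 1\<^sub>m a \<and> Y = t \<cdot>\<^sub>m 1\<^sub>m b \<and> Z = 0\<^sub>m a b" by blast
qed

lemma principal_triple_conj:
  assumes r: "principal_triple a b A C D P R Q" and G: "inverse_pair a G G'" and H: "inverse_pair b H H'"
    and c: "A \<in> carrier_mat a a" "C \<in> carrier_mat b a" "D \<in> carrier_mat b b"
  shows "principal_triple a b (G' * A * G) (H * C * G) (H * D * H') (G' * P * G) (G' * R * H') (H * Q * H')"
proof -
  note d = inverse_pair_cancel[OF G] inverse_pair_cancel[OF H] mult_assoc_dim
  have x: "dim_row A = a" "dim_col A = a" "dim_row C = b" "dim_col C = a" "dim_row D = b" "dim_col D = b"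
    "dim_row P = a" "dim_col P = a" "dim_row Q = b" "dim_col Q = b" "dim_row R = a" "dim_col R = b"
    using r c unfolding principal_triple_def by auto
  have e: "A * P - P * A - R * C = A" "C * P - Q * C = C" "C * R + (D * Q - Q * D) = D"
    using r unfolding principal_triple_def by auto
  have "G' * A * G * (G' * P * G) - G' * P * G * (G' * A * G) - G' * R * H' * (H * C * G) = G' * (A * P - P * A - R * C) * G"
    "H * C * G * (G' * P * G) - H * Q * H' * (H * C * G) = H * (C * P - Q * C) * G"
    "H * C * G * (G' * R * H') + (H * D * H' * (H * Q * H') - H * Q * H' * (H * D * H')) = H * (C * R + (D * Q - Q * D)) * H'"
    using x by (simp_all add: d mat_dim_distribs)
  moreover have "G' * P * G \<in> carrier_mat a a" "G' * R * H' \<in> carrier_mat a b" "H * Q * H' \<in> carrier_mat b b"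
    using x d by (auto intro!: carrier_matI)
  ultimately show ?thesis unfolding principal_triple_def e by blast
qed

lemma transpose_dim:
  fixes A B :: "complex mat"
  shows "dim_col A = dim_row B \<Longrightarrow> (A * B)\<^sup>T = B\<^sup>T * A\<^sup>T"
    and "dim_row A = dim_row B \<Longrightarrow> dim_col A = dim_col B \<Longrightarrow> (A - B)\<^sup>T = A\<^sup>T - B\<^sup>T"
    and "dim_row A = dim_row B \<Longrightarrow> dim_col A = dim_col B \<Longrightarrow> (A + B)\<^sup>T = A\<^sup>T + B\<^sup>T"
  by (rule transpose_mult[of _ "dim_row A" "dim_col A" _ "dim_col B"], auto intro!: eq_matI)

lemma rigid_dual:
  assumes r: "rigid a b A C D"
  shows "rigid b a D\<^sup>T C\<^sup>T A\<^sup>T"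
  unfolding rigid_def
proof (intro conjI ballI impI)
  have c: "dim_row A = a" "dim_col A = a" "dim_row C = b" "dim_col C = a" "dim_row D = b" "dim_col D = b"
    using r unfolding rigid_def by auto
  show "D\<^sup>T \<in> carrier_mat b b" "C\<^sup>T \<in> carrier_mat a b" "A\<^sup>T \<in> carrier_mat a a" using c by auto
  fix X Y Z assume X: "X \<in> carrier_mat b b" "Y \<in> carrier_mat a a" "Z \<in> carrier_mat b a"
    and e: "D\<^sup>T * X - X * D\<^sup>T = Z * C\<^sup>T" "C\<^sup>T * X = Y * C\<^sup>T" "Y * A\<^sup>T - A\<^sup>T * Y = C\<^sup>T * Z"
  have x: "dim_row X = b" "dim_col X = b" "dim_row Y = a" "dim_col Y = a" "dim_row Z = b" "dim_col Z = a" using X by auto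
  have "X\<^sup>T * D - D * X\<^sup>T = C * Z\<^sup>T" "X\<^sup>T * C = C * Y\<^sup>T" "A * Y\<^sup>T - Y\<^sup>T * A = Z\<^sup>T * C"
    using arg_cong[OF e(1), of transpose_mat] arg_cong[OF e(2), of transpose_mat] arg_cong[OF e(3), of transpose_mat] c x
    by (simp_all add: transpose_dim)
  moreover have "Y\<^sup>T \<in> carrier_mat a a" "X\<^sup>T \<in> carrier_mat b b" "Z\<^sup>T \<in> carrier_mat a b" using x by auto
  ultimately obtain t where t: "Y\<^sup>T = t \<cdot>\<^sub>m 1\<^sub>m a" "X\<^sup>T = t \<cdot>\<^sub>m 1\<^sub>m b" "Z\<^sup>T = 0\<^sub>m a b"
    using r unfolding rigid_def by metis
  have tr: "(t \<cdot>\<^sub>m 1\<^sub>m n)\<^sup>T = t \<cdot>\<^sub>m 1\<^sub>m n" for n by (intro eq_matI) auto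
  have "X = t \<cdot>\<^sub>m 1\<^sub>m b" "Y = t \<cdot>\<^sub>m 1\<^sub>m a" "Z = 0\<^sub>m b a"
    using arg_cong[OF t(1), of transpose_mat] arg_cong[OF t(2), of transpose_mat] arg_cong[OF t(3), of transpose_mat]
    by (simp_all add: tr)
  then show "\<exists>t. X = t \<cdot>\<^sub>m 1\<^sub>m b \<and> Y = t \<cdot>\<^sub>m 1\<^sub>m a \<and> Z = 0\<^sub>m b a" by blast
qed

text \<open>Transposition reverses commutators, and the minus signs restore the equations. On
  eigenvalues this is negation together with the exchange of the two blocks.\<close>

lemma principal_triple_dual:
  assumes r: "principal_triple a b A C D P R Q"
    and c: "A \<in> carrier_mat a a" "C \<in> carrier_mat b a" "D \<in> carrier_mat b b"
  shows "principal_triple b a D\<^sup>T C\<^sup>T A\<^sup>T (- Q\<^sup>T) (- R\<^sup>T) (- P\<^sup>T)"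
proof -
  have P: "P \<in> carrier_mat a a" "R \<in> carrier_mat a b" "Q \<in> carrier_mat b b" using r unfolding principal_triple_def by auto
  have x: "dim_row A = a" "dim_col A = a" "dim_row C = b" "dim_col C = a" "dim_row D = b" "dim_col D = b"
    "dim_row P = a" "dim_col P = a" "dim_row Q = b" "dim_col Q = b" "dim_row R = a" "dim_col R = b"
    using P c by auto
  have e: "A * P - P * A - R * C = A" "C * P - Q * C = C" "C * R + (D * Q - Q * D) = D"
    using r unfolding principal_triple_def by auto
  have l: "(- M) - (- N) - (- K) = K + (N - M)" "(- M) - (- N) = N - M" "(- K) + ((- M) - (- N)) = N - M - K"
    if "M \<in> carrier_mat m n" "N \<in> carrier_mat m n" "K \<in> carrier_mat m n" for M N K :: "complex mat" and m n
    using that by (auto intro!: eq_matI)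
  have "D\<^sup>T * (- Q\<^sup>T) - (- Q\<^sup>T) * D\<^sup>T - (- R\<^sup>T) * C\<^sup>T = D\<^sup>T"
    using arg_cong[OF e(3), of transpose_mat] l(1)[of "D\<^sup>T * Q\<^sup>T" b b "Q\<^sup>T * D\<^sup>T" "R\<^sup>T * C\<^sup>T"] x c P
    by (simp add: transpose_dim)
  moreover have "C\<^sup>T * (- Q\<^sup>T) - (- P\<^sup>T) * C\<^sup>T = C\<^sup>T"
    using arg_cong[OF e(2), of transpose_mat] l(2)[of "C\<^sup>T * Q\<^sup>T" a b "P\<^sup>T * C\<^sup>T" "P\<^sup>T * C\<^sup>T"] x c P
    by (simp add: transpose_dim)
  moreover have "C\<^sup>T * (- R\<^sup>T) + (A\<^sup>T * (- P\<^sup>T) - (- P\<^sup>T) * A\<^sup>T) = A\<^sup>T"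
    using arg_cong[OF e(1), of transpose_mat] l(3)[of "A\<^sup>T * P\<^sup>T" a a "P\<^sup>T * A\<^sup>T" "C\<^sup>T * R\<^sup>T"] x c P
    by (simp add: transpose_dim)
  ultimately show ?thesis unfolding principal_triple_def using P by auto
qed

section \<open>The Euclid step on block matrices\<close>

definition hblock :: "nat \<Rightarrow> nat \<Rightarrow> complex mat" where
  "hblock b k = four_block_mat (1\<^sub>m b) (0\<^sub>m b k) (0\<^sub>m 0 b) (0\<^sub>m 0 k)"

text \<open>\<open>hblock\<close> carries two blocks without rows so that the product rule for block
  matrices covers it. Padding by empty blocks brings the other factors into the same shape.\<close>

lemma pad_block: "Y \<in> carrier_mat m n \<Longrightarrow> four_block_mat Y (0\<^sub>m m 0) (0\<^sub>m 0 n) (0\<^sub>m 0 0) = Y"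
  by (intro eq_matI) auto

lemma rank_form_hblock: "rank_form b (b + k) b = hblock b k"
  unfolding hblock_def rank_form_def by (intro eq_matI) auto

lemma four_block_inject:
  assumes "A1 \<in> carrier_mat m1 n1" "B1 \<in> carrier_mat m1 n2" "C1 \<in> carrier_mat m2 n1" "D1 \<in> carrier_mat m2 n2"
    "A2 \<in> carrier_mat m1 n1" "B2 \<in> carrier_mat m1 n2" "C2 \<in> carrier_mat m2 n1" "D2 \<in> carrier_mat m2 n2"
  shows "four_block_mat A1 B1 C1 D1 = four_block_mat A2 B2 C2 D2 \<longleftrightarrow> A1 = A2 \<and> B1 = B2 \<and> C1 = C2 \<and> D1 = D2"
proof
  assume e: "four_block_mat A1 B1 C1 D1 = four_block_mat A2 B2 C2 D2"
  then have i: "four_block_mat A1 B1 C1 D1 $$ (i, j) = four_block_mat A2 B2 C2 D2 $$ (i, j)" for i j by simp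
  have "A1 $$ (i, j) = A2 $$ (i, j)" if "i < m1" "j < n1" for i j using i[of i j] that assms by auto
  moreover have "B1 $$ (i, j) = B2 $$ (i, j)" if "i < m1" "j < n2" for i j using i[of i "n1 + j"] that assms by auto
  moreover have "C1 $$ (i, j) = C2 $$ (i, j)" if "i < m2" "j < n1" for i j using i[of "m1 + i" j] that assms by auto
  moreover have "D1 $$ (i, j) = D2 $$ (i, j)" if "i < m2" "j < n2" for i j using i[of "m1 + i" "n1 + j"] that assms by auto
  ultimately show "A1 = A2 \<and> B1 = B2 \<and> C1 = C2 \<and> D1 = D2" using assms by (auto intro!: eq_matI)
qed simp

lemma minus_four_block:
  assumes "A1 \<in> carrier_mat m1 n1" "B1 \<in> carrier_mat m1 n2" "C1 \<in> carrier_mat m2 n1" "D1 \<in> carrier_mat m2 n2"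
    "A2 \<in> carrier_mat m1 n1" "B2 \<in> carrier_mat m1 n2" "C2 \<in> carrier_mat m2 n1" "D2 \<in> carrier_mat m2 n2"
  shows "four_block_mat A1 B1 C1 D1 - four_block_mat A2 B2 C2 D2 = four_block_mat (A1 - A2) (B1 - B2) (C1 - C2) (D1 - D2)"
  using assms by (intro eq_matI) auto

lemma split_blocks:
  assumes "A \<in> carrier_mat (m1 + m2) (n1 + n2)"
  obtains A1 A2 A3 A4 where "A1 \<in> carrier_mat m1 n1" "A2 \<in> carrier_mat m1 n2" "A3 \<in> carrier_mat m2 n1"
    "A4 \<in> carrier_mat m2 n2" "A = four_block_mat A1 A2 A3 A4"
proof -
  obtain A1 A2 A3 A4 where "split_block A m1 n1 = (A1, A2, A3, A4)" by (metis prod_cases4)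
  from split_block[OF this, of m2 n2] assms that show ?thesis by auto
qed

lemma hblock_mult:
  assumes "X1 \<in> carrier_mat b n1" "X2 \<in> carrier_mat b n2" "X3 \<in> carrier_mat k n1" "X4 \<in> carrier_mat k n2"
  shows "hblock b k * four_block_mat X1 X2 X3 X4 = four_block_mat X1 X2 (0\<^sub>m 0 n1) (0\<^sub>m 0 n2)"
  unfolding hblock_def using assms
  by (subst mult_four_block_mat[where ?nr1.0 = b and ?n1.0 = b and ?n2.0 = k and ?nr2.0 = 0 and ?nc1.0 = n1 and ?nc2.0 = n2]) auto

lemma mult_hblock:
  assumes "Z1 \<in> carrier_mat m1 b" "Z2 \<in> carrier_mat m2 b"
  shows "four_block_mat Z1 (0\<^sub>m m1 0) Z2 (0\<^sub>m m2 0) * hblock b k = four_block_mat Z1 (0\<^sub>m m1 k) Z2 (0\<^sub>m m2 k)"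
  unfolding hblock_def using assms
  by (subst mult_four_block_mat[where ?nr1.0 = m1 and ?n1.0 = b and ?n2.0 = 0 and ?nr2.0 = m2 and ?nc1.0 = b and ?nc2.0 = k]) auto

lemma square_mult_hblock: "Y \<in> carrier_mat m b \<Longrightarrow> Y * hblock b k = four_block_mat Y (0\<^sub>m m k) (0\<^sub>m 0 b) (0\<^sub>m 0 k)"
  using mult_hblock[of Y m b "0\<^sub>m 0 b" 0 k] by (simp add: pad_block)

lemma hblock_carrier [simp]: "hblock b k \<in> carrier_mat b (b + k)"
  by (auto simp: hblock_def intro!: carrier_matI)

locale block_data =
  fixes b k :: nat and A1 A2 A3 A4 D :: "complex mat"
  assumes A: "A1 \<in> carrier_mat b b" "A2 \<in> carrier_mat b k" "A3 \<in> carrier_mat k b" "A4 \<in> carrier_mat k k"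
    and D: "D \<in> carrier_mat b b"
begin

abbreviation "A \<equiv> four_block_mat A1 A2 A3 A4"

lemma commutator_blocks:
  assumes "X1 \<in> carrier_mat b b" "X3 \<in> carrier_mat k b" "X4 \<in> carrier_mat k k"
  shows "A * four_block_mat X1 (0\<^sub>m b k) X3 X4 - four_block_mat X1 (0\<^sub>m b k) X3 X4 * A =
    four_block_mat (A1 * X1 + A2 * X3 - X1 * A1) (A2 * X4 - X1 * A2)
      (A3 * X1 + A4 * X3 - (X3 * A1 + X4 * A3)) (A4 * X4 - (X3 * A2 + X4 * A4))"
  using assms A
  by (simp add: mult_four_block_mat[where ?nr1.0 = b and ?n1.0 = b and ?n2.0 = k and ?nr2.0 = k and ?nc1.0 = b and ?nc2.0 = k]
      minus_four_block[of _ b b _ k _ k])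

lemma half_column:
  assumes "Z1 \<in> carrier_mat b b" "Z2 \<in> carrier_mat k b"
  shows "hblock b k * four_block_mat Z1 (0\<^sub>m b 0) Z2 (0\<^sub>m k 0) = Z1"
  using assms by (subst hblock_mult[where ?n1.0 = b and ?n2.0 = 0]) (auto simp: pad_block)

end

context block_data begin

text \<open>For \<open>C = [1 0]\<close> the equation \<open>C * X = Y * C\<close> forces the first
  block row of \<open>X\<close> to be \<open>[Y 0]\<close>. As \<open>Z * C\<close> fills only the
  left block column, the left column of the first equation determines \<open>Z\<close>. Its right
  column yields two equations for \<open>(X4, Y, X3)\<close>, and inserting \<open>Z\<close> into
  the last equation yields the third, in which \<open>A1\<close> and \<open>D\<close> enter only as
  \<open>A1 + D\<close>.\<close>

lemma rigid_block_iff: "rigid (b + k) b A (hblock b k) D \<longleftrightarrow> rigid k b A4 A2 (A1 + D)"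
proof
  assume r: "rigid (b + k) b A (hblock b k) D"
  show "rigid k b A4 A2 (A1 + D)"
    unfolding rigid_def
  proof (intro conjI ballI impI)
    fix X Y Z assume X: "X \<in> carrier_mat k k" and Y: "Y \<in> carrier_mat b b" and Z: "Z \<in> carrier_mat k b"
      and e: "A4 * X - X * A4 = Z * A2" "A2 * X = Y * A2" "Y * (A1 + D) - (A1 + D) * Y = A2 * Z"
    define W where "W = four_block_mat Y (0\<^sub>m b k) Z X"
    \<comment> \<open>\<open>Z1\<close> is dictated by the last equation for \<open>D\<close>,
      \<open>Z2\<close> by the lower left block of the first one.\<close>
    define Z1 where "Z1 = Y * D - D * Y"
    define Z2 where "Z2 = A3 * Y + A4 * Z - (Z * A1 + X * A3)"
    define U where "U = four_block_mat Z1 (0\<^sub>m b 0) Z2 (0\<^sub>m k 0)"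
    have c: "Z1 \<in> carrier_mat b b" "Z2 \<in> carrier_mat k b" "W \<in> carrier_mat (b + k) (b + k)" "U \<in> carrier_mat (b + k) b"
      using X Y Z A D by (auto simp: Z1_def Z2_def W_def U_def intro!: carrier_matI)
    have "Y * (A1 + D) - (A1 + D) * Y = (Y * A1 + Y * D) - (A1 * Y + D * Y)"
      using A D Y by (subst mat_dim_distribs, auto)+
    then have z1: "A1 * Y + A2 * Z - Y * A1 = Z1"
      unfolding e(3)[symmetric] Z1_def using A D Y by (auto intro!: eq_matI)
    have z4: "A4 * X - (Z * A2 + X * A4) = 0\<^sub>m k k"
      unfolding e(1)[symmetric] using A X by (auto intro!: eq_matI)
    have "A2 * X - Y * A2 = 0\<^sub>m b k" unfolding e(2) using A Y by auto
    then have "A * W - W * A = four_block_mat Z1 (0\<^sub>m b k) Z2 (0\<^sub>m k k)"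
      unfolding W_def commutator_blocks[OF Y Z X] z1 z4 Z2_def by simp
    also have "\<dots> = U * hblock b k" unfolding U_def using c by (simp add: mult_hblock)
    finally have 1: "A * W - W * A = U * hblock b k" .
    have 2: "hblock b k * W = Y * hblock b k"
      unfolding W_def using X Y Z by (simp add: hblock_mult[where ?n1.0 = b and ?n2.0 = k] square_mult_hblock)
    have 3: "Y * D - D * Y = hblock b k * U" unfolding U_def using c by (simp add: half_column Z1_def)
    obtain t where t: "W = t \<cdot>\<^sub>m 1\<^sub>m (b + k)" "Y = t \<cdot>\<^sub>m 1\<^sub>m b"
      using r c Y 1 2 3 unfolding rigid_def by blast
    have "W = four_block_mat (t \<cdot>\<^sub>m 1\<^sub>m b) (0\<^sub>m b k) (0\<^sub>m k b) (t \<cdot>\<^sub>m 1\<^sub>m k)"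
      unfolding t by (intro eq_matI) auto
    then have "X = t \<cdot>\<^sub>m 1\<^sub>m k" "Z = 0\<^sub>m k b"
      unfolding W_def using X Y Z by (subst (asm) four_block_inject[of _ b b _ k _ k], auto)+
    then show "\<exists>t. X = t \<cdot>\<^sub>m 1\<^sub>m k \<and> Y = t \<cdot>\<^sub>m 1\<^sub>m b \<and> Z = 0\<^sub>m k b" using t by blast
  qed (use A D in auto)
next
  assume r: "rigid k b A4 A2 (A1 + D)"
  show "rigid (b + k) b A (hblock b k) D"
    unfolding rigid_def
  proof (intro conjI ballI impI)
    fix X Y Z assume X: "X \<in> carrier_mat (b + k) (b + k)" and Y: "Y \<in> carrier_mat b b" and Z: "Z \<in> carrier_mat (b + k) b"
      and e: "A * X - X * A = Z * hblock b k" "hblock b k * X = Y * hblock b k" "Y * D - D * Y = hblock b k * Z"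
    obtain X1 X2 X3 X4 where Xb: "X1 \<in> carrier_mat b b" "X2 \<in> carrier_mat b k" "X3 \<in> carrier_mat k b" "X4 \<in> carrier_mat k k"
      "X = four_block_mat X1 X2 X3 X4" using split_blocks[OF X] .
    obtain Z1 Z1' Z2 Z2' where Zb: "Z1 \<in> carrier_mat b b" "Z1' \<in> carrier_mat b 0" "Z2 \<in> carrier_mat k b" "Z2' \<in> carrier_mat k 0"
      "Z = four_block_mat Z1 Z1' Z2 Z2'" using split_blocks[of Z b k b 0, unfolded add_0_right, OF Z] .
    have z0: "Z1' = 0\<^sub>m b 0" "Z2' = 0\<^sub>m k 0" using Zb by (auto intro!: eq_matI)
    have "X1 = Y \<and> X2 = 0\<^sub>m b k"
      using e(2) Xb Y unfolding Xb(5) by (simp add: hblock_mult[where ?n1.0 = b and ?n2.0 = k] square_mult_hblock four_block_inject[of _ b b _ k _ 0])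
    then have X': "X = four_block_mat Y (0\<^sub>m b k) X3 X4" using Xb by simp
    have eq: "four_block_mat (A1 * Y + A2 * X3 - Y * A1) (A2 * X4 - Y * A2)
      (A3 * Y + A4 * X3 - (X3 * A1 + X4 * A3)) (A4 * X4 - (X3 * A2 + X4 * A4)) = four_block_mat Z1 (0\<^sub>m b k) Z2 (0\<^sub>m k k)"
      using e(1) unfolding X' commutator_blocks[OF Y Xb(3,4)] Zb(5) z0 using Zb by (simp add: mult_hblock)
    have "A1 * Y + A2 * X3 - Y * A1 = Z1 \<and> A2 * X4 - Y * A2 = 0\<^sub>m b k \<and>
      A3 * Y + A4 * X3 - (X3 * A1 + X4 * A3) = Z2 \<and> A4 * X4 - (X3 * A2 + X4 * A4) = 0\<^sub>m k k"
      by (rule iffD1[OF four_block_inject[of _ b b _ k _ k] eq]) (use A Y Xb Zb in auto)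
    then have b: "A1 * Y + A2 * X3 - Y * A1 = Z1" "A2 * X4 - Y * A2 = 0\<^sub>m b k"
      "A3 * Y + A4 * X3 - (X3 * A1 + X4 * A3) = Z2" "A4 * X4 - (X3 * A2 + X4 * A4) = 0\<^sub>m k k"
      by auto
    have z1: "Y * D - D * Y = Z1" using e(3) Zb unfolding Zb(5) z0 by (simp add: half_column)
    have "A4 * X4 - X4 * A4 = X3 * A2"
    proof (rule eq_matI)
      fix i j assume "i < dim_row (X3 * A2)" "j < dim_col (X3 * A2)"
      then show "(A4 * X4 - X4 * A4) $$ (i, j) = (X3 * A2) $$ (i, j)"
        using arg_cong[OF b(4), of "\<lambda>M. M $$ (i, j)"] A Xb by (simp del: index_mult_mat(1) add: algebra_simps)
    qed (use A Xb in auto)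
    moreover have "A2 * X4 = Y * A2"
    proof (rule eq_matI)
      fix i j assume "i < dim_row (Y * A2)" "j < dim_col (Y * A2)"
      then show "(A2 * X4) $$ (i, j) = (Y * A2) $$ (i, j)"
        using arg_cong[OF b(2), of "\<lambda>M. M $$ (i, j)"] A Xb Y by (simp del: index_mult_mat(1))
    qed (use A Xb Y in auto)
    moreover have "Y * (A1 + D) - (A1 + D) * Y = A2 * X3"
    proof (rule eq_matI)
      fix i j assume ij: "i < dim_row (A2 * X3)" "j < dim_col (A2 * X3)"
      have "Y * (A1 + D) - (A1 + D) * Y = (Y * A1 + Y * D) - (A1 * Y + D * Y)"
        using A D Y by (subst mat_dim_distribs, auto)+
      then show "(Y * (A1 + D) - (A1 + D) * Y) $$ (i, j) = (A2 * X3) $$ (i, j)"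
        using ij arg_cong[OF b(1), of "\<lambda>M. M $$ (i, j)"] arg_cong[OF z1, of "\<lambda>M. M $$ (i, j)"] A Xb Y D
        by (simp del: index_mult_mat(1) add: algebra_simps)
    qed (use A Xb Y D in auto)
    ultimately obtain t where t: "X4 = t \<cdot>\<^sub>m 1\<^sub>m k" "Y = t \<cdot>\<^sub>m 1\<^sub>m b" "X3 = 0\<^sub>m k b"
      using r Xb Y unfolding rigid_def by blast
    have s: "M * (t \<cdot>\<^sub>m 1\<^sub>m n) = t \<cdot>\<^sub>m M" "(t \<cdot>\<^sub>m 1\<^sub>m m) * M = t \<cdot>\<^sub>m M" if "M \<in> carrier_mat m n" for M m n
      using that mat_dim_distribs(5)[of "1\<^sub>m m" M t] by (auto simp: mult_scalar)
    have "Z1 = 0\<^sub>m b b" unfolding z1[symmetric] t using D s[of D b b] by auto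
    moreover have "Z2 = 0\<^sub>m k b" unfolding b(3)[symmetric] t using A s[of A3 k b] by (auto intro!: eq_matI)
    ultimately have "Z = 0\<^sub>m (b + k) b" unfolding Zb(5) z0 by (intro eq_matI) auto
    moreover have "X = t \<cdot>\<^sub>m 1\<^sub>m (b + k)" unfolding X' t by (intro eq_matI) auto
    ultimately show "\<exists>t. X = t \<cdot>\<^sub>m 1\<^sub>m (b + k) \<and> Y = t \<cdot>\<^sub>m 1\<^sub>m b \<and> Z = 0\<^sub>m (b + k) b" using t by blast
  qed (use A D in auto)
qed

end

lemma rigidD:
  assumes "rigid a b A C D" "X \<in> carrier_mat a a" "Y \<in> carrier_mat b b" "Z \<in> carrier_mat a b"
    "A * X - X * A = Z * C" "C * X = Y * C" "Y * D - D * Y = C * Z"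
  shows "\<exists>t. X = t \<cdot>\<^sub>m 1\<^sub>m a \<and> Y = t \<cdot>\<^sub>m 1\<^sub>m b \<and> Z = 0\<^sub>m a b"
  using assms unfolding rigid_def by blast

text \<open>If the rank were smaller than \<open>b\<close>, the normal form would have a zero last
  row and a zero last column. The unit matrix \<open>Z\<close> at that corner would then be
  annihilated from both sides and lie in the radical.\<close>

lemma rigid_full_rank:
  assumes r: "rigid a b A C D" and ba: "b \<le> a"
  obtains H H' G G' where "inverse_pair b H H'" "inverse_pair a G G'" "H * C * G = rank_form b a b"
proof -
  have "C \<in> carrier_mat b a" using r unfolding rigid_def by blast
  from rank_normal_form[OF this] obtain H H' G G' s where
    n: "inverse_pair b H H'" "inverse_pair a G G'" "s \<le> a" "s \<le> b" "H * C * G = rank_form b a s" by blast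
  have "s = b"
  proof (rule ccontr)
    assume "s \<noteq> b"
    then have s: "s < b" using n by simp
    define Z :: "complex mat" where "Z = mat a b (\<lambda>(i, j). if i = a - 1 \<and> j = b - 1 then 1 else 0)"
    have Z: "Z \<in> carrier_mat a b" by (simp add: Z_def)
    have c: "rank_form b a s \<in> carrier_mat b a" by simp
    have rig: "rigid a b (G' * A * G) (rank_form b a s) (H * D * H')" using rigid_conj[OF r n(2,1)] n(5) by simp
    then have AD: "G' * A * G \<in> carrier_mat a a" "H * D * H' \<in> carrier_mat b b" unfolding rigid_def by blast+
    have z1: "Z * rank_form b a s = 0\<^sub>m a a"
      using s by (intro eq_matI) (auto simp: Z_def rank_form_def scalar_prod_def intro!: sum.neutral)
    have z2: "rank_form b a s * Z = 0\<^sub>m b b"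
      using s ba by (intro eq_matI) (auto simp: Z_def rank_form_def scalar_prod_def intro!: sum.neutral)
    have zm: "M * 0\<^sub>m n n - 0\<^sub>m n n * M = 0\<^sub>m n n" "0\<^sub>m n n * M - M * 0\<^sub>m n n = 0\<^sub>m n n"
      if "M \<in> carrier_mat n n" for M :: "complex mat" and n
      using that by auto
    have "\<exists>t::complex. 0\<^sub>m a a = t \<cdot>\<^sub>m 1\<^sub>m a \<and> 0\<^sub>m b b = t \<cdot>\<^sub>m 1\<^sub>m b \<and> Z = 0\<^sub>m a b"
    proof (rule rigidD[OF rig])
      show "G' * A * G * 0\<^sub>m a a - 0\<^sub>m a a * (G' * A * G) = Z * rank_form b a s" unfolding z1 by (rule zm(1)[OF AD(1)])
      show "0\<^sub>m b b * (H * D * H') - H * D * H' * 0\<^sub>m b b = rank_form b a s * Z" unfolding z2 by (rule zm(2)[OF AD(2)])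
      show "rank_form b a s * 0\<^sub>m a a = 0\<^sub>m b b * rank_form b a s"
        unfolding left_mult_zero_mat[OF c] right_mult_zero_mat[OF c] by (rule refl)
    qed (use Z in auto)
    then have "Z = 0\<^sub>m a b" by blast
    moreover have "Z $$ (a - 1, b - 1) = 1" using s ba by (simp add: Z_def)
    ultimately show False using s ba by simp
  qed
  then show ?thesis using n that by blast
qed

text \<open>The entrywise content of the last block equation, over plain numbers so that entries of
  matrix products stay unexpanded.\<close>

lemma block_arith1:
  fixes x y z r a p q d u w :: complex
  assumes "x + y - z - r = a" "r + (p - q) = d" "u - w = p - q"
  shows "y + (x + u - (z + w)) = a + d"
  unfolding assms(1,2)[symmetric] assms(3)[symmetric] by simp

lemma block_arith2:
  fixes x y z a d u w s :: complex
  assumes "y + (x + u - (z + w)) = a + d" "s = x + y - z - a + (u - w)"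
  shows "s = d"
proof -
  have "d = y + (x + u - (z + w)) - a" using assms(1) by simp
  then show ?thesis unfolding assms(2) by simp
qed

context block_data begin

text \<open>For \<open>C = [1 0]\<close> the middle equation makes the first block row of
  \<open>P\<close> equal to \<open>[Q + 1, 0]\<close>. Hence the eigenvalues of \<open>P\<close> are
  those of \<open>Q + 1\<close> and of \<open>P4\<close>; this is the origin of both the sum and the
  shift by 1 in \<open>principal_spec.add\<close>.\<close>

lemma principal_triple_block:
  assumes p: "principal_triple (b + k) b A (hblock b k) D P R Q"
  obtains P3 P4 where "P3 \<in> carrier_mat k b" "P4 \<in> carrier_mat k k" "P = four_block_mat (Q + 1\<^sub>m b) (0\<^sub>m b k) P3 P4"
    "principal_triple k b A4 A2 (A1 + D) P4 P3 (Q + 1\<^sub>m b)"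
proof -
  have P: "P \<in> carrier_mat (b + k) (b + k)" and R: "R \<in> carrier_mat (b + k) b" and Q: "Q \<in> carrier_mat b b"
    and e: "A * P - P * A - R * hblock b k = A" "hblock b k * P - Q * hblock b k = hblock b k" "hblock b k * R + (D * Q - Q * D) = D"
    using p unfolding principal_triple_def by auto
  define Y where "Y = Q + 1\<^sub>m b"
  have Y: "Y \<in> carrier_mat b b" using Q by (simp add: Y_def)
  obtain P1 P2 P3 P4 where Pb: "P1 \<in> carrier_mat b b" "P2 \<in> carrier_mat b k" "P3 \<in> carrier_mat k b" "P4 \<in> carrier_mat k k"
    "P = four_block_mat P1 P2 P3 P4" using split_blocks[OF P] .
  obtain R1 R1' R2 R2' where Rb: "R1 \<in> carrier_mat b b" "R1' \<in> carrier_mat b 0" "R2 \<in> carrier_mat k b" "R2' \<in> carrier_mat k 0"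
    "R = four_block_mat R1 R1' R2 R2'" using split_blocks[of R b k b 0, unfolded add_0_right, OF R] .
  have r0: "R1' = 0\<^sub>m b 0" "R2' = 0\<^sub>m k 0" using Rb by (auto intro!: eq_matI)
  have eq: "four_block_mat (P1 - Q) (P2 - 0\<^sub>m b k) (0\<^sub>m 0 b - 0\<^sub>m 0 b) (0\<^sub>m 0 k - 0\<^sub>m 0 k) = four_block_mat (1\<^sub>m b) (0\<^sub>m b k) (0\<^sub>m 0 b) (0\<^sub>m 0 k)"
    using e(2) Pb Q unfolding Pb(5) hblock_mult[OF Pb(1-4)] square_mult_hblock[OF Q]
    by (simp add: hblock_def minus_four_block[of _ b b _ k _ 0])
  have "P1 - Q = 1\<^sub>m b \<and> P2 - 0\<^sub>m b k = 0\<^sub>m b k \<and> (0\<^sub>m 0 b - 0\<^sub>m 0 b :: complex mat) = 0\<^sub>m 0 b \<and> (0\<^sub>m 0 k - 0\<^sub>m 0 k :: complex mat) = 0\<^sub>m 0 k"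
    by (rule iffD1[OF four_block_inject[of _ b b _ k _ 0] eq]) (use Pb Q in auto)
  then have q: "P1 - Q = 1\<^sub>m b" "P2 - 0\<^sub>m b k = 0\<^sub>m b k" by auto
  have P1: "P1 = Y"
  proof (rule eq_matI)
    fix i j assume "i < dim_row Y" "j < dim_col Y"
    then show "P1 $$ (i, j) = Y $$ (i, j)" using arg_cong[OF q(1), of "\<lambda>M. M $$ (i, j)"] Pb Q by (simp add: Y_def algebra_simps)
  qed (use Pb Y in auto)
  have P2: "P2 = 0\<^sub>m b k"
  proof (rule eq_matI)
    fix i j assume "i < dim_row (0\<^sub>m b k)" "j < dim_col (0\<^sub>m b k)"
    then show "P2 $$ (i, j) = 0\<^sub>m b k $$ (i, j)" using arg_cong[OF q(2), of "\<lambda>M. M $$ (i, j)"] Pb by simp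
  qed (use Pb in auto)
  have P': "P = four_block_mat Y (0\<^sub>m b k) P3 P4" using Pb P1 P2 by simp
  have "A * P - P * A - R * hblock b k = four_block_mat (A1 * Y + A2 * P3 - Y * A1 - R1) (A2 * P4 - Y * A2 - 0\<^sub>m b k)
      (A3 * Y + A4 * P3 - (P3 * A1 + P4 * A3) - R2) (A4 * P4 - (P3 * A2 + P4 * A4) - 0\<^sub>m k k)"
    unfolding P' commutator_blocks[OF Y Pb(3,4)] Rb(5) r0 mult_hblock[OF Rb(1,3)]
    using A Y Pb Rb by (intro minus_four_block[of _ b b _ k _ k]) auto
  then have eq: "four_block_mat (A1 * Y + A2 * P3 - Y * A1 - R1) (A2 * P4 - Y * A2 - 0\<^sub>m b k)
      (A3 * Y + A4 * P3 - (P3 * A1 + P4 * A3) - R2) (A4 * P4 - (P3 * A2 + P4 * A4) - 0\<^sub>m k k) = A"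
    using e(1) by simp
  have "A1 * Y + A2 * P3 - Y * A1 - R1 = A1 \<and> A2 * P4 - Y * A2 - 0\<^sub>m b k = A2 \<and>
      A3 * Y + A4 * P3 - (P3 * A1 + P4 * A3) - R2 = A3 \<and> A4 * P4 - (P3 * A2 + P4 * A4) - 0\<^sub>m k k = A4"
    by (rule iffD1[OF four_block_inject[of _ b b _ k _ k] eq]) (use A Y Pb Rb in auto)
  then have b: "A1 * Y + A2 * P3 - Y * A1 - R1 = A1" "A2 * P4 - Y * A2 - 0\<^sub>m b k = A2" "A4 * P4 - (P3 * A2 + P4 * A4) - 0\<^sub>m k k = A4"
    by auto
  have r1: "R1 + (D * Q - Q * D) = D" using e(3) Rb unfolding Rb(5) r0 by (simp add: half_column)
  have "D * Y - Y * D = D * Q + D * 1\<^sub>m b - (Q * D + 1\<^sub>m b * D)"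
    unfolding Y_def using D Q by (subst mat_dim_distribs, auto)+
  then have dq: "D * Y - Y * D = D * Q - Q * D" using D Q by (auto intro!: eq_matI)
  have 1: "A4 * P4 - P4 * A4 - P3 * A2 = A4"
  proof (rule eq_matI)
    fix i j assume "i < dim_row A4" "j < dim_col A4"
    then show "(A4 * P4 - P4 * A4 - P3 * A2) $$ (i, j) = A4 $$ (i, j)"
      using arg_cong[OF b(3), of "\<lambda>M. M $$ (i, j)"] A Pb by (simp del: index_mult_mat(1) add: algebra_simps)
  qed (use A Pb in auto)
  have 2: "A2 * P4 - Y * A2 = A2"
  proof (rule eq_matI)
    fix i j assume "i < dim_row A2" "j < dim_col A2"
    then show "(A2 * P4 - Y * A2) $$ (i, j) = A2 $$ (i, j)"
      using arg_cong[OF b(2), of "\<lambda>M. M $$ (i, j)"] A Pb Y by (simp del: index_mult_mat(1))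
  qed (use A Pb Y in auto)
  have 3: "A2 * P3 + ((A1 + D) * Y - Y * (A1 + D)) = A1 + D"
  proof (rule eq_matI)
    fix i j assume ij: "i < dim_row (A1 + D)" "j < dim_col (A1 + D)"
    have "(A1 + D) * Y - Y * (A1 + D) = (A1 * Y + D * Y) - (Y * A1 + Y * D)"
      using A D Y by (subst mat_dim_distribs, auto)+
    then have g: "(A2 * P3 + ((A1 + D) * Y - Y * (A1 + D))) $$ (i, j) = (A2 * P3) $$ (i, j) +
        ((A1 * Y) $$ (i, j) + (D * Y) $$ (i, j) - ((Y * A1) $$ (i, j) + (Y * D) $$ (i, j)))"
      "(A1 + D) $$ (i, j) = A1 $$ (i, j) + D $$ (i, j)"
      using ij A Pb Y D by (simp_all del: index_mult_mat(1))
    have "(A1 * Y) $$ (i, j) + (A2 * P3) $$ (i, j) - (Y * A1) $$ (i, j) - R1 $$ (i, j) = A1 $$ (i, j)"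
      "R1 $$ (i, j) + ((D * Q) $$ (i, j) - (Q * D) $$ (i, j)) = D $$ (i, j)"
      "(D * Y) $$ (i, j) - (Y * D) $$ (i, j) = (D * Q) $$ (i, j) - (Q * D) $$ (i, j)"
      using ij arg_cong[OF b(1), of "\<lambda>M. M $$ (i, j)"] arg_cong[OF r1, of "\<lambda>M. M $$ (i, j)"]
        arg_cong[OF dq, of "\<lambda>M. M $$ (i, j)"] A Pb Y D Q Rb
      by (simp_all del: index_mult_mat(1))
    then show "(A2 * P3 + ((A1 + D) * Y - Y * (A1 + D))) $$ (i, j) = (A1 + D) $$ (i, j)"
      unfolding g by (rule block_arith1)
  qed (use A Pb Y D in auto)
  have "principal_triple k b A4 A2 (A1 + D) P4 P3 Y" unfolding principal_triple_def using 1 2 3 Pb Y by blast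
  then show ?thesis using that[of P3 P4] Pb P' unfolding Y_def by blast
qed

text \<open>\<open>R\<close> is read off from the left block column of the first equation; the last
  equation then reduces to the one assumed for \<open>A1 + D\<close>.\<close>

lemma principal_triple_extend:
  assumes p: "principal_triple k b A4 A2 (A1 + D) P4 P3 Y"
  obtains R where "principal_triple (b + k) b A (hblock b k) D (four_block_mat Y (0\<^sub>m b k) P3 P4) R (Y - 1\<^sub>m b)"
proof -
  have P: "P4 \<in> carrier_mat k k" "P3 \<in> carrier_mat k b" "Y \<in> carrier_mat b b"
    and e: "A4 * P4 - P4 * A4 - P3 * A2 = A4" "A2 * P4 - Y * A2 = A2" "A2 * P3 + ((A1 + D) * Y - Y * (A1 + D)) = A1 + D"
    using p unfolding principal_triple_def by auto
  define Q where "Q = Y - 1\<^sub>m b"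
  define W where "W = four_block_mat Y (0\<^sub>m b k) P3 P4"
  define R1 where "R1 = A1 * Y + A2 * P3 - Y * A1 - A1"
  define R2 where "R2 = A3 * Y + A4 * P3 - (P3 * A1 + P4 * A3) - A3"
  define R where "R = four_block_mat R1 (0\<^sub>m b 0) R2 (0\<^sub>m k 0)"
  have c: "Q \<in> carrier_mat b b" "W \<in> carrier_mat (b + k) (b + k)" "R1 \<in> carrier_mat b b" "R2 \<in> carrier_mat k b"
    "R \<in> carrier_mat (b + k) b"
    using P A by (auto simp: Q_def W_def R1_def R2_def R_def intro!: carrier_matI)
  have "A * W - W * A - R * hblock b k = four_block_mat (A1 * Y + A2 * P3 - Y * A1 - R1) (A2 * P4 - Y * A2 - 0\<^sub>m b k)
      (A3 * Y + A4 * P3 - (P3 * A1 + P4 * A3) - R2) (A4 * P4 - (P3 * A2 + P4 * A4) - 0\<^sub>m k k)"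
    unfolding W_def commutator_blocks[OF P(3,2,1)] R_def mult_hblock[OF c(3,4)]
    using A P c by (intro minus_four_block[of _ b b _ k _ k]) auto
  also have "\<dots> = A"
  proof -
    have "A1 * Y + A2 * P3 - Y * A1 - R1 = A1" "A3 * Y + A4 * P3 - (P3 * A1 + P4 * A3) - R2 = A3"
      "A2 * P4 - Y * A2 - 0\<^sub>m b k = A2"
      unfolding R1_def R2_def e(2) using A P by (auto intro!: eq_matI simp del: index_mult_mat(1))
    moreover have "A4 * P4 - (P3 * A2 + P4 * A4) - 0\<^sub>m k k = A4 * P4 - P4 * A4 - P3 * A2"
      using A P by (auto intro!: eq_matI simp del: index_mult_mat(1))
    ultimately show ?thesis using e(1) by simp
  qed
  finally have 1: "A * W - W * A - R * hblock b k = A" .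
  have 2: "hblock b k * W - Q * hblock b k = hblock b k"
  proof -
    have "Y - Q = 1\<^sub>m b" unfolding Q_def using P by (auto intro!: eq_matI)
    moreover have "hblock b k * W - Q * hblock b k = four_block_mat (Y - Q) (0\<^sub>m b k - 0\<^sub>m b k) (0\<^sub>m 0 b - 0\<^sub>m 0 b) (0\<^sub>m 0 k - 0\<^sub>m 0 k)"
      unfolding W_def hblock_mult[OF P(3) zero_carrier_mat P(2,1)] square_mult_hblock[OF c(1)]
      using P c by (intro minus_four_block[of _ b b _ k _ 0]) auto
    moreover have "(0\<^sub>m m n - 0\<^sub>m m n :: complex mat) = 0\<^sub>m m n" for m n by (intro eq_matI) auto
    ultimately show ?thesis by (simp only: hblock_def)
  qed
  have "D * Q - Q * D = D * Y - D * 1\<^sub>m b - (Y * D - 1\<^sub>m b * D)"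
    unfolding Q_def using D P by (subst mat_dim_distribs, auto)+
  then have dq: "D * Q - Q * D = D * Y - Y * D" using D P by (auto intro!: eq_matI simp del: index_mult_mat(1))
  have 3: "hblock b k * R + (D * Q - Q * D) = D"
    unfolding R_def half_column[OF c(3,4)] dq
  proof (rule eq_matI)
    fix i j assume ij: "i < dim_row D" "j < dim_col D"
    have "(A1 + D) * Y - Y * (A1 + D) = (A1 * Y + D * Y) - (Y * A1 + Y * D)"
      using A D P by (subst mat_dim_distribs, auto)+
    then have "(A2 * P3) $$ (i, j) +
        ((A1 * Y) $$ (i, j) + (D * Y) $$ (i, j) - ((Y * A1) $$ (i, j) + (Y * D) $$ (i, j))) = A1 $$ (i, j) + D $$ (i, j)"
      using ij arg_cong[OF e(3), of "\<lambda>M. M $$ (i, j)"] A P D by (simp del: index_mult_mat(1))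
    moreover have "(R1 + (D * Y - Y * D)) $$ (i, j) = (A1 * Y) $$ (i, j) + (A2 * P3) $$ (i, j) - (Y * A1) $$ (i, j) - A1 $$ (i, j) +
        ((D * Y) $$ (i, j) - (Y * D) $$ (i, j))"
      using ij A P D unfolding R1_def by (simp del: index_mult_mat(1))
    ultimately show "(R1 + (D * Y - Y * D)) $$ (i, j) = D $$ (i, j)" by (rule block_arith2)
  qed (use D P c in auto)
  have "principal_triple (b + k) b A (hblock b k) D W R Q" unfolding principal_triple_def using 1 2 3 c by blast
  then show ?thesis using that unfolding W_def Q_def by blast
qed

end

section \<open>Eigenvalue multisets\<close>

definition eig :: "complex mat \<Rightarrow> complex multiset" where "eig M = proots (char_poly M)"

lemma proots_linear_factors: "proots (\<Prod>a\<leftarrow>as. [:- a, 1:]) = mset (as :: complex list)"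
proof (induction as)
  case (Cons a as)
  have "(\<Prod>a\<leftarrow>as. [:- a, 1:]) \<noteq> (0 :: complex poly)" by (auto simp: prod_list_zero_iff)
  then have "proots ([:- a, 1:] * (\<Prod>a\<leftarrow>as. [:- a, 1:])) = proots [:- a, 1:] + proots (\<Prod>a\<leftarrow>as. [:- a, 1:])"
    by (intro proots_mult) auto
  then show ?case using Cons by (simp del: mult_pCons_left)
qed simp

lemma eig_upper_triangular: "T \<in> carrier_mat n n \<Longrightarrow> upper_triangular T \<Longrightarrow> eig T = mset (diag_mat T)"
  unfolding eig_def by (simp add: char_poly_upper_triangular proots_linear_factors)

lemma eig_similar: "similar_mat M N \<Longrightarrow> eig M = eig N"
  unfolding eig_def by (simp add: char_poly_similar)

lemma eig_conj:
  assumes "inverse_pair n G G'" "M \<in> carrier_mat n n"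
  shows "eig (G' * M * G) = eig M" "eig (G * M * G') = eig M"
proof -
  have "similar_mat_wit (G' * M * G) M G' G" "similar_mat_wit (G * M * G') M G G'"
    using assms unfolding inverse_pair_def similar_mat_wit_def Let_def by (auto simp: carrier_matD)
  then have "similar_mat (G' * M * G) M" "similar_mat (G * M * G') M" unfolding similar_mat_def by blast+
  then show "eig (G' * M * G) = eig M" "eig (G * M * G') = eig M" by (auto intro: eig_similar)
qed

lemma schur_exists:
  assumes "M \<in> carrier_mat n n"
  obtains T G G' where "inverse_pair n G G'" "T \<in> carrier_mat n n" "upper_triangular T" "(M :: complex mat) = G * T * G'"
proof -
  obtain as where "char_poly M = (\<Prod>a\<leftarrow>as. [:- a, 1:])" using char_poly_factorized[OF assms] by blast
  from schur_decomposition_exists[OF assms this] obtain T where T: "T \<in> carrier_mat n n" "upper_triangular T" "similar_mat M T" by blast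
  then obtain G G' where "similar_mat_wit M T G G'" unfolding similar_mat_def by blast
  then have "inverse_pair n G G'" "M = G * T * G'"
    using assms unfolding similar_mat_wit_def inverse_pair_def Let_def by auto
  with T that show ?thesis by blast
qed

lemma eig_transpose: "M \<in> carrier_mat n n \<Longrightarrow> eig M\<^sup>T = eig M"
  unfolding eig_def by simp

lemma eig_affine:
  assumes M: "M \<in> carrier_mat n n"
  shows "eig (u \<cdot>\<^sub>m M + v \<cdot>\<^sub>m 1\<^sub>m n) = image_mset (\<lambda>x. u * x + v) (eig M)"
proof -
  obtain T G G' where s: "inverse_pair n G G'" "T \<in> carrier_mat n n" "upper_triangular T" "M = G * T * G'"
    using schur_exists[OF M] .
  define S where "S = u \<cdot>\<^sub>m T + v \<cdot>\<^sub>m 1\<^sub>m n"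
  have S: "S \<in> carrier_mat n n" using s by (simp add: S_def)
  note d = inverse_pair_cancel[OF s(1)] mult_assoc_dim
  have "u \<cdot>\<^sub>m M + v \<cdot>\<^sub>m 1\<^sub>m n = G * S * G'"
    unfolding S_def s(4) using s(2) by (simp add: d mat_dim_distribs)
  then have "eig (u \<cdot>\<^sub>m M + v \<cdot>\<^sub>m 1\<^sub>m n) = eig S" using eig_conj[OF s(1) S] by simp
  also have "\<dots> = mset (diag_mat S)"
    using s(3) S s(2) by (intro eig_upper_triangular) (auto simp: S_def upper_triangular_def)
  also have "diag_mat S = map (\<lambda>x. u * x + v) (diag_mat T)"
    using s(2) by (auto simp: diag_mat_def S_def)
  also have "mset \<dots> = image_mset (\<lambda>x. u * x + v) (eig M)"
    using eig_conj[OF s(1,2)] s(4) eig_upper_triangular[OF s(2,3)] by simp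
  finally show ?thesis .
qed

lemma eig_add_one: "M \<in> carrier_mat n n \<Longrightarrow> eig (M + 1\<^sub>m n) = image_mset (\<lambda>x. x + 1) (eig M)"
proof -
  assume M: "M \<in> carrier_mat n n"
  have "M + 1\<^sub>m n = 1 \<cdot>\<^sub>m M + 1 \<cdot>\<^sub>m 1\<^sub>m n" using M by (auto intro!: eq_matI)
  then show ?thesis using eig_affine[OF M, of 1 1] by simp
qed

lemma eig_uminus_transpose: "M \<in> carrier_mat n n \<Longrightarrow> eig (- M\<^sup>T) = image_mset uminus (eig M)"
proof -
  assume M: "M \<in> carrier_mat n n"
  have "- M\<^sup>T = (-1) \<cdot>\<^sub>m M\<^sup>T + 0 \<cdot>\<^sub>m 1\<^sub>m n" using M by (auto intro!: eq_matI)
  then show ?thesis using eig_affine[of "M\<^sup>T" n "-1" 0] M by (simp add: eig_transpose)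
qed

lemma eig_lower_block:
  assumes "B \<in> carrier_mat m m" "C \<in> carrier_mat n m" "D \<in> carrier_mat n n"
  shows "eig (four_block_mat B (0\<^sub>m m n) C D) = eig B + eig D"
proof -
  have fac: "\<exists>es. char_poly M = (\<Prod>a\<leftarrow>es. [:- a, 1:])" if M: "M \<in> carrier_mat k k" for M :: "complex mat" and k
  proof -
    obtain es where "char_poly M = (\<Prod>a\<leftarrow>es. [:- a, 1:])" using char_poly_factorized[OF M] by auto
    then show ?thesis by (rule exI)
  qed
  have "char_poly (four_block_mat B (0\<^sub>m m n) C D) = char_poly B * char_poly D"
    by (rule char_poly_0_block'[OF refl fac[OF assms(1)] fac[OF assms(3)] assms])
  moreover have "char_poly B \<noteq> 0" "char_poly D \<noteq> 0"
    using degree_monic_char_poly[OF assms(1)] degree_monic_char_poly[OF assms(3)] by auto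
  ultimately show ?thesis unfolding eig_def by (simp add: proots_mult)
qed

section \<open>Eigenvalues of the principal element along Euclid's algorithm\<close>

text \<open>Euclid's algorithm run backwards from the degenerate pair (0, 1). The multisets are
  normalized: the eigenvalues of an actual triple differ from them by one complex shift common to
  both blocks.\<close>

inductive principal_spec :: "nat \<Rightarrow> nat \<Rightarrow> int multiset \<Rightarrow> int multiset \<Rightarrow> bool" where
  base: "principal_spec 0 1 {#} {#0#}"
| add: "principal_spec a b p q \<Longrightarrow> principal_spec (a + b) b (p + q) (image_mset (\<lambda>i. i - 1) q)"
| dual: "principal_spec a b p q \<Longrightarrow> principal_spec b a (image_mset uminus q) (image_mset uminus p)"

abbreviation shifted :: "complex \<Rightarrow> int multiset \<Rightarrow> complex multiset" where
  "shifted t p \<equiv> image_mset (\<lambda>k. t + of_int k) p"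

lemma rigid_carrier: "rigid a b A C D \<Longrightarrow> A \<in> carrier_mat a a \<and> C \<in> carrier_mat b a \<and> D \<in> carrier_mat b b"
  by (simp add: rigid_def)

lemma principal_triple_carrier:
  "principal_triple a b A C D P R Q \<Longrightarrow> P \<in> carrier_mat a a \<and> R \<in> carrier_mat a b \<and> Q \<in> carrier_mat b b"
  by (simp add: principal_triple_def)

lemma principal_spec_exists:
  "principal_spec a b p q \<Longrightarrow> \<exists>A C D P R Q. rigid a b A C D \<and> principal_triple a b A C D P R Q"
proof (induction rule: principal_spec.induct)
  case base
  have "rigid 0 1 (0\<^sub>m 0 0) (0\<^sub>m 1 0) (0\<^sub>m 1 1)"
    unfolding rigid_def
  proof (intro conjI ballI impI)
    fix X Y Z :: "complex mat" assume "X \<in> carrier_mat 0 0" "Y \<in> carrier_mat 1 1" "Z \<in> carrier_mat 0 1"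
    then show "\<exists>t. X = t \<cdot>\<^sub>m 1\<^sub>m 0 \<and> Y = t \<cdot>\<^sub>m 1\<^sub>m 1 \<and> Z = 0\<^sub>m 0 1"
      by (intro exI[of _ "Y $$ (0, 0)"]) (auto intro!: eq_matI)
  qed auto
  moreover have "principal_triple 0 1 (0\<^sub>m 0 0) (0\<^sub>m 1 0) (0\<^sub>m 1 1) (0\<^sub>m 0 0) (0\<^sub>m 0 1) (0\<^sub>m 1 1)"
    unfolding principal_triple_def by (auto intro!: eq_matI)
  ultimately show ?case by blast
next
  case (add a b p q)
  then obtain A C D P R Q where r: "rigid a b A C D" and p: "principal_triple a b A C D P R Q" by blast
  have c: "A \<in> carrier_mat a a" "C \<in> carrier_mat b a" "D \<in> carrier_mat b b" using rigid_carrier[OF r] by auto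
  \<comment> \<open>The old lower right block is placed into \<open>A1\<close> and the new one is 0,
    so that their sum is the old \<open>D\<close> again.\<close>
  interpret block_data b a D C "0\<^sub>m a b" A "0\<^sub>m b b" using c by unfold_locales auto
  have D: "D + 0\<^sub>m b b = D" using c by simp
  have "rigid (b + a) b local.A (hblock b a) (0\<^sub>m b b)" using r unfolding rigid_block_iff D .
  then have 1: "rigid (a + b) b local.A (hblock b a) (0\<^sub>m b b)" by (simp only: add.commute)
  have "principal_triple a b A C (D + 0\<^sub>m b b) P R Q" unfolding D by (rule p)
  from principal_triple_extend[OF this]
  obtain R' where "principal_triple (b + a) b local.A (hblock b a) (0\<^sub>m b b) (four_block_mat Q (0\<^sub>m b a) R P) R' (Q - 1\<^sub>m b)" .
  then have 2: "principal_triple (a + b) b local.A (hblock b a) (0\<^sub>m b b) (four_block_mat Q (0\<^sub>m b a) R P) R' (Q - 1\<^sub>m b)"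
    by (simp only: add.commute)
  from 1 2 show ?case by (intro exI conjI)
next
  case (dual a b p q)
  then obtain A C D P R Q where r: "rigid a b A C D" and p: "principal_triple a b A C D P R Q" by blast
  show ?case using rigid_dual[OF r] principal_triple_dual[OF p] rigid_carrier[OF r] by blast
qed

text \<open>Rigidity gives \<open>C\<close> full rank, so it can be normalized to
  \<open>[1 0]\<close>, and the block reduction then follows the rule \<open>add\<close>. The shift
  \<open>t\<close> comes from the single entry of the 1 x 1 matrix at the bottom of the recursion
  and changes sign under \<open>dual\<close>.\<close>

lemma principal_spec_unique:
  "principal_spec a b p q \<Longrightarrow> rigid a b A C D \<Longrightarrow> principal_triple a b A C D P R Q \<Longrightarrow>
    \<exists>t. eig P = shifted t p \<and> eig Q = shifted t q"
proof (induction arbitrary: A C D P R Q rule: principal_spec.induct)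
  case base
  have "P \<in> carrier_mat 0 0" "Q \<in> carrier_mat 1 1" using principal_triple_carrier[OF base(2)] by auto
  then have "eig P = mset (diag_mat P)" "eig Q = mset (diag_mat Q)"
    by (auto intro!: eig_upper_triangular simp: upper_triangular_def)
  then show ?case using \<open>P \<in> _\<close> \<open>Q \<in> _\<close> by (intro exI[of _ "Q $$ (0, 0)"]) (auto simp: diag_mat_def)
next
  case (add a b p q)
  obtain H H' G G' where n: "inverse_pair b H H'" "inverse_pair (a + b) G G'" "H * C * G = rank_form b (a + b) b"
    using rigid_full_rank[OF add.prems(1) le_add2] .
  note c = rigid_carrier[OF add.prems(1)] principal_triple_carrier[OF add.prems(2)]
  have C: "H * C * G = hblock b a" using n(3) rank_form_hblock[of b a] by (simp add: add.commute)
  define N where "N = G' * A * G"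
  have "N \<in> carrier_mat (b + a) (b + a)" using n(2) c unfolding N_def inverse_pair_def by (auto simp: add.commute intro!: carrier_matI)
  from split_blocks[OF this] obtain A1 A2 A3 A4 where Ab: "A1 \<in> carrier_mat b b" "A2 \<in> carrier_mat b a" "A3 \<in> carrier_mat a b"
    "A4 \<in> carrier_mat a a" "N = four_block_mat A1 A2 A3 A4" .
  have Dc: "H * D * H' \<in> carrier_mat b b" using n(1) c unfolding inverse_pair_def by (auto intro!: carrier_matI)
  interpret block_data b a A1 A2 A3 A4 "H * D * H'" using Ab Dc by unfold_locales
  have "rigid (b + a) b local.A (hblock b a) (H * D * H')"
    using rigid_conj[OF add.prems(1) n(2,1)] Ab(5) unfolding C N_def by (simp add: add.commute)
  then have r: "rigid a b A4 A2 (A1 + H * D * H')" unfolding rigid_block_iff .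
  have "principal_triple (b + a) b local.A (hblock b a) (H * D * H') (G' * P * G) (G' * R * H') (H * Q * H')"
    using principal_triple_conj[OF add.prems(2) n(2,1)] Ab(5) c unfolding C N_def by (simp add: add.commute)
  then obtain P3 P4 where P: "P3 \<in> carrier_mat a b" "P4 \<in> carrier_mat a a" "G' * P * G = four_block_mat (H * Q * H' + 1\<^sub>m b) (0\<^sub>m b a) P3 P4"
    "principal_triple a b A4 A2 (A1 + H * D * H') P4 P3 (H * Q * H' + 1\<^sub>m b)"
    using principal_triple_block by blast
  from add.IH[OF r P(4)] obtain t where t: "eig P4 = shifted t p" "eig (H * Q * H' + 1\<^sub>m b) = shifted t q" by blast
  have Q: "H * Q * H' \<in> carrier_mat b b" using n(1) c unfolding inverse_pair_def by (auto intro!: carrier_matI)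
  have "eig P = eig (G' * P * G)" using eig_conj(1)[OF n(2)] c by simp
  also have "\<dots> = shifted t (p + q)" unfolding P(3) using eig_lower_block[OF _ P(1,2)] Q t by (simp add: add.commute)
  finally have "eig P = shifted t (p + q)" .
  moreover have "eig Q = shifted t (image_mset (\<lambda>i. i - 1) q)"
  proof -
    have "image_mset (\<lambda>x. x + 1) (eig Q) = shifted t q" using eig_add_one[OF Q] t eig_conj(2)[OF n(1)] c by simp
    then have "image_mset (\<lambda>x. x - 1) (image_mset (\<lambda>x. x + 1) (eig Q)) = image_mset (\<lambda>x. x - 1) (shifted t q)" by simp
    then show ?thesis by (simp add: multiset.map_comp o_def algebra_simps)
  qed
  ultimately show ?case by blast
next
  case (dual a b p q)
  note c = rigid_carrier[OF dual.prems(1)] principal_triple_carrier[OF dual.prems(2)]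
  obtain t where "eig (- Q\<^sup>T) = shifted t p" "eig (- P\<^sup>T) = shifted t q"
    using dual.IH[OF rigid_dual[OF dual.prems(1)] principal_triple_dual[OF dual.prems(2)]] c by blast
  then have "image_mset uminus (eig Q) = shifted t p" "image_mset uminus (eig P) = shifted t q"
    using eig_uminus_transpose c by metis+
  then have "image_mset uminus (image_mset uminus (eig Q)) = image_mset uminus (shifted t p)"
    "image_mset uminus (image_mset uminus (eig P)) = image_mset uminus (shifted t q)" by simp_all
  then show ?case by (intro exI[of _ "- t"]) (simp add: multiset.map_comp o_def minus_diff_commute)
qed

section \<open>The spectrum of the adjoint action\<close>

lemma mat_trace_carrier: "A \<in> carrier_mat n n \<Longrightarrow> mat_trace A = (\<Sum>i<n. A $$ (i, i))"
  by (simp add: mat_trace_def)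

lemma mat_mult_entry: "A \<in> carrier_mat m k \<Longrightarrow> B \<in> carrier_mat k n \<Longrightarrow> i < m \<Longrightarrow> j < n \<Longrightarrow>
    (A * B) $$ (i, j) = (\<Sum>l<k. A $$ (i, l) * B $$ (l, j))"
  by (simp add: scalar_prod_def atLeast0LessThan)

lemma mat_trace_comm:
  assumes "A \<in> carrier_mat m n" "B \<in> carrier_mat n m"
  shows "mat_trace (A * B) = mat_trace (B * A)"
proof -
  have "mat_trace (A * B) = (\<Sum>i<m. \<Sum>l<n. A $$ (i, l) * B $$ (l, i))"
    using assms by (simp add: mat_trace_def scalar_prod_def atLeast0LessThan)
  also have "\<dots> = (\<Sum>l<n. \<Sum>i<m. B $$ (l, i) * A $$ (i, l))"
    by (subst sum.swap) (simp add: mult.commute)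
  also have "\<dots> = mat_trace (B * A)"
    using assms by (simp add: mat_trace_def scalar_prod_def atLeast0LessThan)
  finally show ?thesis .
qed

lemma mat_trace_linear:
  assumes "A \<in> carrier_mat n n" "B \<in> carrier_mat n n"
  shows "mat_trace (A + B) = mat_trace A + mat_trace B" "mat_trace (A - B) = mat_trace A - mat_trace B"
    "mat_trace (k \<cdot>\<^sub>m A) = k * mat_trace A"
  using assms by (simp_all add: mat_trace_def sum.distrib sum_subtractf sum_distrib_left)

lemma mat_lincomb_carrier [simp]: "mat_lincomb n bs c \<in> carrier_mat n n"
  by (simp add: mat_lincomb_def)

lemma mat_lincomb_compose:
  assumes U: "U \<in> carrier_mat (length bs) (length cs)" and c: "c \<in> carrier_vec (length cs)"
    and "\<And>j. j < length cs \<Longrightarrow> cs ! j = mat_lincomb n bs (col U j)"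
  shows "mat_lincomb n cs c = mat_lincomb n bs (U *\<^sub>v c)"
proof (rule eq_matI)
  fix i j assume "i < dim_row (mat_lincomb n bs (U *\<^sub>v c))" "j < dim_col (mat_lincomb n bs (U *\<^sub>v c))"
  then have ij: "i < n" "j < n" by (auto simp: mat_lincomb_def)
  have "mat_lincomb n cs c $$ (i, j) = (\<Sum>q<length cs. c $ q * (\<Sum>k<length bs. U $$ (k, q) * (bs ! k) $$ (i, j)))"
    using ij assms by (simp add: mat_lincomb_def)
  also have "\<dots> = (\<Sum>k<length bs. \<Sum>q<length cs. U $$ (k, q) * c $ q * (bs ! k) $$ (i, j))"
    unfolding sum_distrib_left by (subst sum.swap) (simp add: algebra_simps)
  also have "\<dots> = mat_lincomb n bs (U *\<^sub>v c) $$ (i, j)"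
    using ij U c by (simp add: mat_lincomb_def scalar_prod_def atLeast0LessThan sum_distrib_right)
  finally show "mat_lincomb n cs c $$ (i, j) = mat_lincomb n bs (U *\<^sub>v c) $$ (i, j)" .
qed (auto simp: mat_lincomb_def)

lemma mult_mat_lincomb:
  assumes "G \<in> carrier_mat n n" "G' \<in> carrier_mat n n" "\<And>k. k < length bs \<Longrightarrow> bs ! k \<in> carrier_mat n n"
  shows "G * mat_lincomb n bs c = mat_lincomb n (map (\<lambda>x. G * x) bs) c"
    and "mat_lincomb n bs c * G' = mat_lincomb n (map (\<lambda>x. x * G') bs) c"
proof -
  show "G * mat_lincomb n bs c = mat_lincomb n (map (\<lambda>x. G * x) bs) c"
  proof (rule eq_matI)
    fix i j assume "i < dim_row (mat_lincomb n (map (\<lambda>x. G * x) bs) c)" "j < dim_col (mat_lincomb n (map (\<lambda>x. G * x) bs) c)"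
    then have ij: "i < n" "j < n" by (auto simp: mat_lincomb_def)
    have "(G * mat_lincomb n bs c) $$ (i, j) = (\<Sum>l<n. G $$ (i, l) * (\<Sum>k<length bs. c $ k * (bs ! k) $$ (l, j)))"
      using ij by (subst mat_mult_entry[OF assms(1)]) (auto simp: mat_lincomb_def)
    also have "\<dots> = (\<Sum>k<length bs. c $ k * (\<Sum>l<n. G $$ (i, l) * (bs ! k) $$ (l, j)))"
      unfolding sum_distrib_left by (subst sum.swap) (simp add: algebra_simps)
    also have "\<dots> = (\<Sum>k<length bs. c $ k * (G * bs ! k) $$ (i, j))"
      using ij assms(1,3) by (intro sum.cong refl arg_cong2[of _ _ _ _ "(*)"]) (simp add: mat_mult_entry[OF assms(1) assms(3)])
    finally show "(G * mat_lincomb n bs c) $$ (i, j) = mat_lincomb n (map (\<lambda>x. G * x) bs) c $$ (i, j)"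
      using ij by (simp add: mat_lincomb_def)
  qed (use assms in \<open>auto simp: mat_lincomb_def\<close>)
  show "mat_lincomb n bs c * G' = mat_lincomb n (map (\<lambda>x. x * G') bs) c"
  proof (rule eq_matI)
    fix i j assume "i < dim_row (mat_lincomb n (map (\<lambda>x. x * G') bs) c)" "j < dim_col (mat_lincomb n (map (\<lambda>x. x * G') bs) c)"
    then have ij: "i < n" "j < n" by (auto simp: mat_lincomb_def)
    have "(mat_lincomb n bs c * G') $$ (i, j) = (\<Sum>l<n. (\<Sum>k<length bs. c $ k * (bs ! k) $$ (i, l)) * G' $$ (l, j))"
      using ij by (subst mat_mult_entry[OF _ assms(2)]) (auto simp: mat_lincomb_def)
    also have "\<dots> = (\<Sum>k<length bs. c $ k * (\<Sum>l<n. (bs ! k) $$ (i, l) * G' $$ (l, j)))"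
      unfolding sum_distrib_left sum_distrib_right by (subst sum.swap) (simp add: algebra_simps)
    also have "\<dots> = (\<Sum>k<length bs. c $ k * (bs ! k * G') $$ (i, j))"
      using ij assms(2,3) by (intro sum.cong refl arg_cong2[of _ _ _ _ "(*)"]) (simp add: mat_mult_entry[OF assms(3) assms(2)])
    finally show "(mat_lincomb n bs c * G') $$ (i, j) = mat_lincomb n (map (\<lambda>x. x * G') bs) c $$ (i, j)"
      using ij by (simp add: mat_lincomb_def)
  qed (use assms in \<open>auto simp: mat_lincomb_def\<close>)
qed

lemma commutator_mat_lincomb:
  assumes h: "h \<in> carrier_mat n n" and bs: "\<And>k. k < length bs \<Longrightarrow> bs ! k \<in> carrier_mat n n"
  shows "commutator h (mat_lincomb n bs c) = mat_lincomb n (map (commutator h) bs) c"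
proof -
  have "h * mat_lincomb n bs c = mat_lincomb n (map (\<lambda>x. h * x) bs) c"
    "mat_lincomb n bs c * h = mat_lincomb n (map (\<lambda>x. x * h) bs) c"
    using mult_mat_lincomb[OF h h, of bs c] bs by blast+
  then have "commutator h (mat_lincomb n bs c) = mat_lincomb n (map (\<lambda>x. h * x) bs) c - mat_lincomb n (map (\<lambda>x. x * h) bs) c"
    by (simp add: commutator_def)
  also have "\<dots> = mat_lincomb n (map (commutator h) bs) c"
  proof (rule eq_matI)
    fix i j assume "i < dim_row (mat_lincomb n (map (commutator h) bs) c)" "j < dim_col (mat_lincomb n (map (commutator h) bs) c)"
    then have ij: "i < n" "j < n" by (auto simp: mat_lincomb_def)
    have "commutator h (bs ! k) $$ (i, j) = (h * bs ! k) $$ (i, j) - (bs ! k * h) $$ (i, j)" if "k < length bs" for k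
      using ij h bs[OF that] by (simp add: commutator_def del: index_mult_mat(1))
    then show "(mat_lincomb n (map (\<lambda>x. h * x) bs) c - mat_lincomb n (map (\<lambda>x. x * h) bs) c) $$ (i, j) =
        mat_lincomb n (map (commutator h) bs) c $$ (i, j)"
      using ij by (simp add: mat_lincomb_def sum_subtractf[symmetric] right_diff_distrib del: index_mult_mat(1))
  qed (auto simp: mat_lincomb_def)
  finally show ?thesis .
qed

lemma mat_lincomb_unit: "k < length bs \<Longrightarrow> bs ! k \<in> carrier_mat n n \<Longrightarrow> mat_lincomb n bs (unit_vec (length bs) k) = bs ! k"
  by (intro eq_matI) (auto simp: mat_lincomb_def unit_vec_def if_distrib[of "\<lambda>x. x * _"] cong: if_cong)

lemma ordered_basis_inject:
  assumes "ordered_basis n V bs" "mat_lincomb n bs c = mat_lincomb n bs d" "mat_lincomb n bs c \<in> V"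
    "c \<in> carrier_vec (length bs)" "d \<in> carrier_vec (length bs)"
  shows "c = d"
  using assms unfolding ordered_basis_def by metis

text \<open>The matrices expanding each basis in the other are mutually inverse and intertwine
  \<open>A\<close> and \<open>B\<close>, which are therefore similar.\<close>

lemma change_of_basis:
  assumes V: "V \<subseteq> carrier_mat n n" and b1: "ordered_basis n V bs" and b2: "ordered_basis n V cs"
    and h: "h \<in> carrier_mat n n" and inv: "\<And>x. x \<in> V \<Longrightarrow> commutator h x \<in> V"
    and A: "matrix_of_operator n bs (commutator h) A" and B: "matrix_of_operator n cs (commutator h) B"
  shows "char_poly A = char_poly B"
proof -
  let ?N = "length bs" let ?M = "length cs"
  have expand: "\<exists>U. U \<in> carrier_mat (length bs) (length cs) \<and> (\<forall>j<length cs. cs ! j = mat_lincomb n bs (col U j))"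
    if "ordered_basis n V bs" "ordered_basis n V cs" for bs cs
  proof -
    have "\<forall>j<length cs. \<exists>c. c \<in> carrier_vec (length bs) \<and> cs ! j = mat_lincomb n bs c"
      using that unfolding ordered_basis_def by (meson nth_mem subsetD)
    then obtain f where f: "\<And>j. j < length cs \<Longrightarrow> f j \<in> carrier_vec (length bs) \<and> cs ! j = mat_lincomb n bs (f j)" by metis
    have "col (mat_of_cols (length bs) (map f [0..<length cs])) j = f j" if "j < length cs" for j
      using f[OF that] that by (simp add: col_mat_of_cols)
    with f show ?thesis by (intro exI[of _ "mat_of_cols (length bs) (map f [0..<length cs])"]) (auto intro: carrier_matI)
  qed
  obtain U where U: "U \<in> carrier_mat ?N ?M" "\<And>j. j < ?M \<Longrightarrow> cs ! j = mat_lincomb n bs (col U j)"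
    using expand[OF b1 b2] by blast
  obtain W where W: "W \<in> carrier_mat ?M ?N" "\<And>j. j < ?N \<Longrightarrow> bs ! j = mat_lincomb n cs (col W j)"
    using expand[OF b2 b1] by blast
  have bsV: "\<And>k. k < ?N \<Longrightarrow> bs ! k \<in> V" and csV: "\<And>k. k < ?M \<Longrightarrow> cs ! k \<in> V"
    using b1 b2 unfolding ordered_basis_def by auto
  have one: "U * W = 1\<^sub>m (length bs)"
    if b: "ordered_basis n V bs" "\<And>k. k < length bs \<Longrightarrow> bs ! k \<in> V" and U: "U \<in> carrier_mat (length bs) (length cs)" "\<And>j. j < length cs \<Longrightarrow> cs ! j = mat_lincomb n bs (col U j)"
      and W: "W \<in> carrier_mat (length cs) (length bs)" "\<And>j. j < length bs \<Longrightarrow> bs ! j = mat_lincomb n cs (col W j)" for U W bs cs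
  proof (rule mat_col_eqI)
    fix j assume "j < dim_col (1\<^sub>m (length bs) :: complex mat)"
    then have j: "j < length bs" by simp
    have cW: "col W j \<in> carrier_vec (length cs)" using W j by (metis carrier_matD(1) col_carrier_vec)
    have UW: "col (U * W) j = U *\<^sub>v col W j" by (rule col_mult2[OF U(1) W(1) j])
    have "mat_lincomb n bs (unit_vec (length bs) j) = bs ! j" using mat_lincomb_unit[OF j] b j V by blast
    also have "\<dots> = mat_lincomb n bs (U *\<^sub>v col W j)"
      using W(2)[OF j] mat_lincomb_compose[OF U(1) cW U(2)] by simp
    finally have e: "mat_lincomb n bs (unit_vec (length bs) j) = mat_lincomb n bs (U *\<^sub>v col W j)" .
    have "mat_lincomb n bs (unit_vec (length bs) j) \<in> V" using mat_lincomb_unit[OF j] b(2)[OF j] V by (metis subsetD)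
    then have "unit_vec (length bs) j = U *\<^sub>v col W j"
      using e cW by (intro ordered_basis_inject[OF b(1)]) (auto intro!: mult_mat_vec_carrier[OF U(1)])
    then show "col (U * W) j = col (1\<^sub>m (length bs)) j" using UW j by simp
  qed (use U W in auto)
  have UW: "U * W = 1\<^sub>m ?N" by (rule one[OF b1 bsV U W])
  have WU: "W * U = 1\<^sub>m ?M" by (rule one[OF b2 csV W U])
  \<comment> \<open>Comparing the traces of the two identity products shows that both bases have the
    same length.\<close>
  have "of_nat ?N = mat_trace (U * W)" unfolding UW by (simp add: mat_trace_def)
  also have "\<dots> = of_nat ?M" unfolding mat_trace_comm[OF U(1) W(1)] WU by (simp add: mat_trace_def)
  finally have NM: "?M = ?N" by simp
  have Ac: "A \<in> carrier_mat ?N ?N" and Ae: "\<And>j. j < ?N \<Longrightarrow> commutator h (bs ! j) = mat_lincomb n bs (col A j)"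
    and Bc: "B \<in> carrier_mat ?M ?M" and Be: "\<And>j. j < ?M \<Longrightarrow> commutator h (cs ! j) = mat_lincomb n cs (col B j)"
    using A B unfolding matrix_of_operator_def by auto
  have "U * B = A * U"
  proof (rule mat_col_eqI)
    fix j assume "j < dim_col (A * U)"
    then have j: "j < ?M" using U by simp
    have cB: "col B j \<in> carrier_vec ?M" and cU: "col U j \<in> carrier_vec ?N" using Bc U j by (metis carrier_matD(1) col_carrier_vec)+
    have "mat_lincomb n bs (U *\<^sub>v col B j) = mat_lincomb n cs (col B j)"
      using mat_lincomb_compose[OF U(1) cB U(2)] by simp
    also have "\<dots> = commutator h (mat_lincomb n bs (col U j))" using Be[OF j] U(2)[OF j] by simp
    also have "\<dots> = mat_lincomb n (map (commutator h) bs) (col U j)"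
      using bsV V by (intro commutator_mat_lincomb[OF h]) blast
    also have "\<dots> = mat_lincomb n bs (A *\<^sub>v col U j)"
      using Ac cU Ae by (intro mat_lincomb_compose) auto
    finally have e: "mat_lincomb n bs (U *\<^sub>v col B j) = mat_lincomb n bs (A *\<^sub>v col U j)" .
    have "mat_lincomb n bs (U *\<^sub>v col B j) = commutator h (cs ! j)"
      using mat_lincomb_compose[OF U(1) cB U(2)] Be[OF j] by simp
    then have "mat_lincomb n bs (U *\<^sub>v col B j) \<in> V" using inv[OF csV[OF j]] by simp
    then have "U *\<^sub>v col B j = A *\<^sub>v col U j"
      using e cB cU by (intro ordered_basis_inject[OF b1]) (auto intro!: mult_mat_vec_carrier[OF U(1)] mult_mat_vec_carrier[OF Ac])
    then show "col (U * B) j = col (A * U) j" unfolding col_mult2[OF U(1) Bc j] col_mult2[OF Ac U(1) j] .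
  qed (use U Bc Ac in auto)
  then have "A = U * B * W"
    using UW U W Ac Bc by (simp add: mult_assoc_dim)
  then have "similar_mat_wit A B U W"
    unfolding similar_mat_wit_def Let_def using UW WU NM U W Ac Bc by auto
  then show ?thesis by (intro char_poly_similar) (auto simp: similar_mat_def)
qed

section \<open>The adjoint action on block upper triangular matrices\<close>

definition mdiff :: "'a::ab_group_add multiset \<Rightarrow> 'a multiset \<Rightarrow> 'a multiset" where
  "mdiff p q = (\<Sum>i\<in>#p. image_mset (\<lambda>j. i - j) q)"

lemma mdiff_simps [simp]:
  "mdiff {#} q = {#}" "mdiff (add_mset i p) q = image_mset (\<lambda>j. i - j) q + mdiff p q"
  "mdiff (p + p') q = mdiff p q + mdiff p' q" "mdiff p {#} = {#}"
  by (simp_all add: mdiff_def)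

text \<open>The parabolic without its trace condition: it is closed under products, contains the
  scalars and has a basis of elementary matrices.\<close>

definition block_upper :: "nat \<Rightarrow> nat \<Rightarrow> complex mat set" where
  "block_upper a b = {x \<in> carrier_mat (a + b) (a + b). \<forall>i<a + b. \<forall>j<a. a \<le> i \<longrightarrow> x $$ (i, j) = 0}"

lemma block_upper_carrier: "x \<in> block_upper a b \<Longrightarrow> x \<in> carrier_mat (a + b) (a + b)"
  by (simp add: block_upper_def)

lemma four_block_in_block_upper:
  "X \<in> carrier_mat a a \<Longrightarrow> Z \<in> carrier_mat a b \<Longrightarrow> Y \<in> carrier_mat b b \<Longrightarrow>
    four_block_mat X Z (0\<^sub>m b a) Y \<in> block_upper a b"
  by (auto simp: block_upper_def)

lemma block_upper_blocks:
  assumes "x \<in> block_upper a b"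
  obtains X Z Y where "X \<in> carrier_mat a a" "Z \<in> carrier_mat a b" "Y \<in> carrier_mat b b"
    "x = four_block_mat X Z (0\<^sub>m b a) Y"
proof -
  obtain X Z W Y where c: "X \<in> carrier_mat a a" "Z \<in> carrier_mat a b" "W \<in> carrier_mat b a" "Y \<in> carrier_mat b b"
    and x: "x = four_block_mat X Z W Y" using split_blocks[OF block_upper_carrier[OF assms]] .
  have "W = 0\<^sub>m b a"
  proof (rule eq_matI)
    fix i j assume "i < dim_row (0\<^sub>m b a)" "j < dim_col (0\<^sub>m b a)"
    then have ij: "i < b" "j < a" by auto
    have "x $$ (a + i, j) = 0" using assms ij unfolding block_upper_def by auto
    then show "W $$ (i, j) = 0\<^sub>m b a $$ (i, j)" unfolding x using c ij by simp
  qed (use c in auto)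
  with c x that show ?thesis by blast
qed

lemma sum_lessThan_add: "(\<Sum>i<a + b. f i) = (\<Sum>i<a. f i) + (\<Sum>i<b. f (a + i :: nat) :: complex)"
  by (induction b) (simp_all add: add.assoc)

lemma mat_trace_four_block:
  assumes "X \<in> carrier_mat a a" "Z \<in> carrier_mat a b" "W \<in> carrier_mat b a" "Y \<in> carrier_mat b b"
  shows "mat_trace (four_block_mat X Z W Y) = mat_trace X + mat_trace Y"
proof -
  have "mat_trace (four_block_mat X Z W Y) = (\<Sum>i<a + b. four_block_mat X Z W Y $$ (i, i))"
    using assms by (simp add: mat_trace_def)
  also have "\<dots> = (\<Sum>i<a. four_block_mat X Z W Y $$ (i, i)) + (\<Sum>i<b. four_block_mat X Z W Y $$ (a + i, a + i))"
    by (rule sum_lessThan_add)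
  also have "\<dots> = mat_trace X + mat_trace Y"
    using assms by (simp add: mat_trace_def)
  finally show ?thesis .
qed

lemma parabolic_iff: "x \<in> parabolic a b \<longleftrightarrow> x \<in> block_upper a b \<and> mat_trace x = 0"
proof
  assume "x \<in> parabolic a b"
  then show "x \<in> block_upper a b \<and> mat_trace x = 0"
    unfolding parabolic_def by (auto simp: mat_trace_four_block four_block_in_block_upper)
next
  assume x: "x \<in> block_upper a b \<and> mat_trace x = 0"
  then obtain X Z Y where "X \<in> carrier_mat a a" "Z \<in> carrier_mat a b" "Y \<in> carrier_mat b b"
    "x = four_block_mat X Z (0\<^sub>m b a) Y" using block_upper_blocks by blast
  with x show "x \<in> parabolic a b" unfolding parabolic_def by (auto simp: mat_trace_four_block)
qed

lemma block_upper_mult: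
  assumes x: "x \<in> block_upper a b" and y: "y \<in> block_upper a b"
  shows "x * y \<in> block_upper a b"
proof -
  have c: "x \<in> carrier_mat (a + b) (a + b)" "y \<in> carrier_mat (a + b) (a + b)" using assms block_upper_carrier by auto
  have "(x * y) $$ (i, j) = 0" if "i < a + b" "j < a" "a \<le> i" for i j
  proof -
    have "(x * y) $$ (i, j) = (\<Sum>l<a + b. x $$ (i, l) * y $$ (l, j))" using that by (intro mat_mult_entry[OF c]) auto
    also have "\<dots> = 0" using x y that by (intro sum.neutral) (auto simp: block_upper_def not_less[symmetric])
    finally show ?thesis .
  qed
  then show ?thesis using c by (auto simp: block_upper_def)
qed

lemma block_upper_linear:
  assumes "x \<in> block_upper a b" "y \<in> block_upper a b"
  shows "x + y \<in> block_upper a b" "x - y \<in> block_upper a b" "k \<cdot>\<^sub>m x \<in> block_upper a b"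
  using assms by (auto simp: block_upper_def)

lemma one_in_block_upper: "1\<^sub>m (a + b) \<in> block_upper a b"
  by (auto simp: block_upper_def)

lemma commutator_in_block_upper:
  "x \<in> block_upper a b \<Longrightarrow> y \<in> block_upper a b \<Longrightarrow> commutator x y \<in> block_upper a b"
  unfolding commutator_def by (intro block_upper_linear block_upper_mult)

lemma commutator_in_parabolic:
  assumes "x \<in> block_upper a b" "y \<in> block_upper a b"
  shows "commutator x y \<in> parabolic a b"
proof -
  have c: "x \<in> carrier_mat (a + b) (a + b)" "y \<in> carrier_mat (a + b) (a + b)" using assms block_upper_carrier by auto
  then have "mat_trace (commutator x y) = 0"
    unfolding commutator_def by (subst mat_trace_linear[of _ "a + b"]) (auto simp: mat_trace_comm[OF c])
  then show ?thesis using commutator_in_block_upper[OF assms] by (simp add: parabolic_iff)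
qed

definition elem_mat :: "nat \<Rightarrow> nat \<times> nat \<Rightarrow> complex mat" where
  "elem_mat n p = mat n n (\<lambda>q. if q = p then 1 else 0)"

lemma elem_mat_lincomb:
  assumes "distinct L" "i < n" "j < n"
  shows "k < length L \<Longrightarrow> L ! k = (i, j) \<Longrightarrow> mat_lincomb n (map (elem_mat n) L) c $$ (i, j) = c $ k"
    and "(i, j) \<notin> set L \<Longrightarrow> mat_lincomb n (map (elem_mat n) L) c $$ (i, j) = 0"
proof -
  have e: "mat_lincomb n (map (elem_mat n) L) c $$ (i, j) = (\<Sum>k<length L. if L ! k = (i, j) then c $ k else 0)"
    using assms by (auto simp: mat_lincomb_def elem_mat_def intro!: sum.cong)
  show "mat_lincomb n (map (elem_mat n) L) c $$ (i, j) = c $ k" if k: "k < length L" "L ! k = (i, j)"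
  proof -
    have "(\<Sum>l<length L. if L ! l = (i, j) then c $ l else 0) = (\<Sum>l<length L. if l = k then c $ l else 0)"
      using assms(1) k by (intro sum.cong refl if_cong) (metis lessThan_iff nth_eq_iff_index_eq)
    then show ?thesis unfolding e using k by simp
  qed
  show "mat_lincomb n (map (elem_mat n) L) c $$ (i, j) = 0" if "(i, j) \<notin> set L"
    unfolding e using that by (intro sum.neutral) (auto simp: in_set_conv_nth)
qed

definition positions :: "nat \<Rightarrow> nat \<Rightarrow> (nat \<times> nat) list" where
  "positions a b = List.product [0..<a] [0..<a] @ List.product [a..<a + b] [a..<a + b] @ List.product [0..<a] [a..<a + b]"

lemma set_positions: "set (positions a b) = {(i, j). i < a + b \<and> j < a + b \<and> \<not> (a \<le> i \<and> j < a)}"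
  by (auto simp: positions_def)

lemma distinct_positions: "distinct (positions a b)"
  by (auto simp: positions_def distinct_product)

lemma mset_product_diff:
  "image_mset (\<lambda>(i, j). d i - d j) (mset (List.product xs ys)) = mdiff (mset (map d xs)) (mset (map d ys))"
  by (induction xs) (simp_all add: multiset.map_comp o_def)

text \<open>The order of the positions is left open because triangularity of the adjoint action
  requires a particular one.\<close>

lemma conj_elem_basis:
  assumes L: "distinct L" "set L = set (positions a b)"
    and S: "inverse_pair (a + b) S S'" "S \<in> block_upper a b" "S' \<in> block_upper a b"
  shows "ordered_basis (a + b) (block_upper a b) (map (\<lambda>p. S * elem_mat (a + b) p * S') L)" (is "ordered_basis ?n ?V ?bs")
proof -
  note d = inverse_pair_cancel[OF S(1)] mult_assoc_dim
  have Sc: "S \<in> carrier_mat ?n ?n" "S' \<in> carrier_mat ?n ?n" using S(1) by (auto simp: inverse_pair_def)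
  have E: "elem_mat ?n p \<in> ?V" if "p \<in> set L" for p
    using that unfolding L(2) set_positions by (auto simp: block_upper_def elem_mat_def)
  have Ec: "elem_mat ?n p \<in> carrier_mat ?n ?n" for p by (simp add: elem_mat_def)
  have comb: "mat_lincomb ?n ?bs c = S * mat_lincomb ?n (map (elem_mat ?n) L) c * S'" for c
  proof -
    have "S * mat_lincomb ?n (map (elem_mat ?n) L) c = mat_lincomb ?n (map (\<lambda>p. S * elem_mat ?n p) L) c"
      using mult_mat_lincomb(1)[OF Sc, of "map (elem_mat ?n) L"] Ec by (simp add: o_def)
    also have "\<dots> * S' = mat_lincomb ?n ?bs c"
      using mult_mat_lincomb(2)[OF Sc, of "map (\<lambda>p. S * elem_mat ?n p) L"] Ec Sc by (simp add: o_def)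
    finally show ?thesis by simp
  qed
  show ?thesis unfolding ordered_basis_def
  proof (intro conjI ballI)
    show "set ?bs \<subseteq> ?V" using E S by (auto intro!: block_upper_mult)
    fix x assume x: "x \<in> ?V"
    define y where "y = S' * x * S"
    have y: "y \<in> ?V" using x S by (auto simp: y_def intro!: block_upper_mult)
    have yc: "y \<in> carrier_mat ?n ?n" and xc: "x \<in> carrier_mat ?n ?n" using x y block_upper_carrier by auto
    have xy: "x = S * y * S'" unfolding y_def using xc by (simp add: d)
    define c where "c = vec (length L) (\<lambda>k. y $$ (L ! k))"
    have "mat_lincomb ?n (map (elem_mat ?n) L) c = y"
    proof (rule eq_matI)
      fix i j assume "i < dim_row y" "j < dim_col y"
      then have ij: "i < ?n" "j < ?n" using yc by auto
      show "mat_lincomb ?n (map (elem_mat ?n) L) c $$ (i, j) = y $$ (i, j)"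
      proof (cases "(i, j) \<in> set L")
        case True
        then obtain k where "k < length L" "L ! k = (i, j)" by (auto simp: in_set_conv_nth)
        then show ?thesis using elem_mat_lincomb(1)[OF L(1) ij] by (simp add: c_def)
      next
        case False
        then have "a \<le> i" "j < a" using ij unfolding L(2) set_positions by auto
        then show ?thesis using elem_mat_lincomb(2)[OF L(1) ij False] y ij by (simp add: block_upper_def)
      qed
    qed (use yc in \<open>auto simp: mat_lincomb_def\<close>)
    then have "x = mat_lincomb ?n ?bs c" unfolding comb using xy by simp
    then have c: "c \<in> carrier_vec (length ?bs) \<and> x = mat_lincomb ?n ?bs c" by (simp add: c_def)
    have "c' = c" if c': "c' \<in> carrier_vec (length ?bs) \<and> x = mat_lincomb ?n ?bs c'" for c'
    proof -
    have "y = S' * (S * mat_lincomb ?n (map (elem_mat ?n) L) c' * S') * S" unfolding y_def using c' comb by simp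
    also have "\<dots> = mat_lincomb ?n (map (elem_mat ?n) L) c'"
      by (simp add: d carrier_matD[OF mat_lincomb_carrier])
    finally have yl: "y = mat_lincomb ?n (map (elem_mat ?n) L) c'" .
    show ?thesis
    proof (rule eq_vecI)
      fix k assume "k < dim_vec c"
      then have k: "k < length L" by (simp add: c_def)
      obtain i j where ij: "L ! k = (i, j)" by force
      then have "(i, j) \<in> set L" using k by (metis nth_mem)
      then have "i < ?n" "j < ?n" unfolding L(2) set_positions by auto
      then show "c' $ k = c $ k" using elem_mat_lincomb(1)[OF L(1) _ _ k ij, of ?n c'] k ij yl by (simp add: c_def)
    qed (use c' in \<open>simp add: c_def\<close>)
    qed
    with c show "\<exists>!c. c \<in> carrier_vec (length ?bs) \<and> x = mat_lincomb ?n ?bs c" by blast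
  qed
qed

lemma commutator_elem_mat:
  assumes "T \<in> carrier_mat n n" "p < n" "q < n" "k < n" "l < n"
  shows "commutator T (elem_mat n (p, q)) $$ (k, l) = (if l = q then T $$ (k, p) else 0) - (if k = p then T $$ (q, l) else 0)"
proof -
  have E: "elem_mat n (p, q) \<in> carrier_mat n n" by (simp add: elem_mat_def)
  have "(T * elem_mat n (p, q)) $$ (k, l) = (\<Sum>m<n. T $$ (k, m) * (if m = p \<and> l = q then 1 else 0))"
    using assms by (subst mat_mult_entry[OF assms(1) E]) (auto simp: elem_mat_def intro!: sum.cong)
  also have "\<dots> = (\<Sum>m<n. if m = p then (if l = q then T $$ (k, p) else 0) else 0)" by (intro sum.cong) auto
  also have "\<dots> = (if l = q then T $$ (k, p) else 0)" using assms by simp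
  finally have 1: "(T * elem_mat n (p, q)) $$ (k, l) = (if l = q then T $$ (k, p) else 0)" .
  have "(elem_mat n (p, q) * T) $$ (k, l) = (\<Sum>m<n. (if k = p \<and> m = q then 1 else 0) * T $$ (m, l))"
    using assms by (subst mat_mult_entry[OF E assms(1)]) (auto simp: elem_mat_def intro!: sum.cong)
  also have "\<dots> = (\<Sum>m<n. if m = q then (if k = p then T $$ (q, l) else 0) else 0)" by (intro sum.cong) auto
  also have "\<dots> = (if k = p then T $$ (q, l) else 0)" using assms by simp
  finally have 2: "(elem_mat n (p, q) * T) $$ (k, l) = (if k = p then T $$ (q, l) else 0)" .
  show ?thesis unfolding commutator_def using 1 2 assms E by (simp del: index_mult_mat(1))
qed

text \<open>Schur triangularization of both diagonal blocks makes \<open>h\<close> upper triangular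
  by a conjugation inside the algebra. In suitably ordered elementary matrices \<open>ad T\<close>
  is triangular with diagonal entries \<open>T $$ (i, i) - T $$ (j, j)\<close>, and the three groups
  of positions give the three multisets of differences.\<close>

lemma block_upper_char_poly:
  assumes P: "P \<in> carrier_mat a a" and R: "R \<in> carrier_mat a b" and Q: "Q \<in> carrier_mat b b"
    and h: "h = four_block_mat P R (0\<^sub>m b a) Q"
    and cs: "ordered_basis (a + b) (block_upper a b) cs" "matrix_of_operator (a + b) cs (commutator h) B"
  shows "eig B = mdiff (eig P) (eig P) + mdiff (eig Q) (eig Q) + mdiff (eig P) (eig Q)"
proof -
  let ?n = "a + b" let ?V = "block_upper a b"
  obtain T1 S1 S1' where T1: "inverse_pair a S1 S1'" "T1 \<in> carrier_mat a a" "upper_triangular T1" "P = S1 * T1 * S1'"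
    using schur_exists[OF P] .
  obtain T2 S2 S2' where T2: "inverse_pair b S2 S2'" "T2 \<in> carrier_mat b b" "upper_triangular T2" "Q = S2 * T2 * S2'"
    using schur_exists[OF Q] .
  define S where "S = four_block_mat S1 (0\<^sub>m a b) (0\<^sub>m b a) S2"
  define S' where "S' = four_block_mat S1' (0\<^sub>m a b) (0\<^sub>m b a) S2'"
  define T where "T = four_block_mat T1 (S1' * R * S2) (0\<^sub>m b a) T2"
  have Sc: "S1 \<in> carrier_mat a a" "S1' \<in> carrier_mat a a" "S2 \<in> carrier_mat b b" "S2' \<in> carrier_mat b b"
    using T1(1) T2(1) by (auto simp: inverse_pair_def)
  have S: "inverse_pair ?n S S'" unfolding S_def S'_def by (rule inverse_pair_block[OF T1(1) T2(1)])
  have SV: "S \<in> ?V" "S' \<in> ?V" unfolding S_def S'_def using Sc by (auto intro!: four_block_in_block_upper)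
  have SRS: "S1' * R * S2 \<in> carrier_mat a b" using Sc R by (auto intro!: carrier_matI)
  have T: "T \<in> carrier_mat ?n ?n" unfolding T_def using T1 T2 SRS by auto
  note d = inverse_pair_cancel[OF S] mult_assoc_dim
  have hST: "h = S * T * S'"
  proof -
    note d1 = inverse_pair_cancel[OF T1(1)] inverse_pair_cancel[OF T2(1)] mult_assoc_dim
    have "S * T = four_block_mat (S1 * T1) (S1 * (S1' * R * S2)) (0\<^sub>m b a) (S2 * T2)"
      unfolding S_def T_def using Sc T1(2) T2(2) SRS
      by (subst mult_four_block_mat[where ?nr1.0 = a and ?n1.0 = a and ?n2.0 = b and ?nr2.0 = b and ?nc1.0 = a and ?nc2.0 = b]) auto
    also have "S1 * (S1' * R * S2) = R * S2" using R by (simp add: d1)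
    also have "four_block_mat (S1 * T1) (R * S2) (0\<^sub>m b a) (S2 * T2) * S' = four_block_mat (S1 * T1 * S1') (R * S2 * S2') (0\<^sub>m b a) (S2 * T2 * S2')"
      unfolding S'_def using Sc T1(2) T2(2) R
      by (subst mult_four_block_mat[where ?nr1.0 = a and ?n1.0 = a and ?n2.0 = b and ?nr2.0 = b and ?nc1.0 = a and ?nc2.0 = b]) auto
    also have "R * S2 * S2' = R" using R by (simp add: d1)
    finally show ?thesis using h T1(4) T2(4) by simp
  qed
  have hV: "h \<in> ?V" unfolding h using P R Q by (rule four_block_in_block_upper)
  have Tut: "T $$ (i, j) = 0" if ji: "j < i" "i < ?n" for i j
  proof -
    consider "i < a" "j < a" | "a \<le> i" "j < a" | "a \<le> i" "a \<le> j" using ji by linarith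
    then show ?thesis
      using ji T1(2,3) T2(2,3) SRS by cases (auto simp: T_def upper_triangular_def)
  qed
  \<comment> \<open>The key orders by \<open>i - j\<close> without leaving the natural numbers. Left
    multiplication by an upper triangular matrix does not raise \<open>i\<close>, right
    multiplication does not lower \<open>j\<close>, so \<open>ad T\<close> never raises the
    key.\<close>
  define L where "L = sort_key (\<lambda>(i, j). i + (?n - j)) (positions a b)"
  have L: "distinct L" "set L = set (positions a b)" "mset L = mset (positions a b)"
    using distinct_positions by (simp_all add: L_def)
  let ?cs = "map (\<lambda>p. S * elem_mat ?n p * S') L"
  define M where "M = mat (length L) (length L) (\<lambda>(p, q). commutator T (elem_mat ?n (L ! q)) $$ (L ! p))"
  have b2: "ordered_basis ?n ?V ?cs" by (rule conj_elem_basis[OF L(1,2) S SV])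
  have TV: "T \<in> ?V" unfolding T_def using T1 T2 SRS by (intro four_block_in_block_upper)
  have M: "matrix_of_operator ?n ?cs (commutator h) M"
    unfolding matrix_of_operator_def
  proof (intro conjI allI impI)
    show "M \<in> carrier_mat (length ?cs) (length ?cs)" by (simp add: M_def)
    fix q assume "q < length ?cs"
    then have q: "q < length L" by simp
    let ?E = "elem_mat ?n (L ! q)"
    have Ec: "?E \<in> carrier_mat ?n ?n" by (simp add: elem_mat_def)
    have "L ! q \<in> set (positions a b)" using q L(2) nth_mem by metis
    then have EV: "?E \<in> ?V" unfolding set_positions by (auto simp: block_upper_def elem_mat_def)
    have CV: "commutator T ?E \<in> ?V" using TV EV by (rule commutator_in_block_upper)
    have "commutator h (?cs ! q) = S * commutator T ?E * S'"
      unfolding commutator_def hST using q T Ec by (simp add: d mat_dim_distribs)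
    also have "commutator T ?E = mat_lincomb ?n (map (elem_mat ?n) L) (col M q)"
    proof (rule eq_matI)
      fix i j assume "i < dim_row (mat_lincomb ?n (map (elem_mat ?n) L) (col M q))" "j < dim_col (mat_lincomb ?n (map (elem_mat ?n) L) (col M q))"
      then have ij: "i < ?n" "j < ?n" by (auto simp: mat_lincomb_def)
      show "commutator T ?E $$ (i, j) = mat_lincomb ?n (map (elem_mat ?n) L) (col M q) $$ (i, j)"
      proof (cases "(i, j) \<in> set L")
        case True
        then obtain k where "k < length L" "L ! k = (i, j)" by (auto simp: in_set_conv_nth)
        then show ?thesis using elem_mat_lincomb(1)[OF L(1) ij] q by (simp add: M_def)
      next
        case False
        then have "a \<le> i" "j < a" using ij unfolding L(2) set_positions by auto
        then show ?thesis using elem_mat_lincomb(2)[OF L(1) ij False] CV ij by (simp add: block_upper_def)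
      qed
    qed (use CV block_upper_carrier in \<open>auto simp: mat_lincomb_def\<close>)
    also have "S * mat_lincomb ?n (map (elem_mat ?n) L) (col M q) * S' = mat_lincomb ?n ?cs (col M q)"
    proof -
      have Sc: "S \<in> carrier_mat ?n ?n" "S' \<in> carrier_mat ?n ?n" using S by (auto simp: inverse_pair_def)
      have "S * mat_lincomb ?n (map (elem_mat ?n) L) (col M q) = mat_lincomb ?n (map (\<lambda>p. S * elem_mat ?n p) L) (col M q)"
        using mult_mat_lincomb(1)[OF Sc, of "map (elem_mat ?n) L"] by (simp add: o_def elem_mat_def)
      also have "\<dots> * S' = mat_lincomb ?n ?cs (col M q)"
        using mult_mat_lincomb(2)[OF Sc, of "map (\<lambda>p. S * elem_mat ?n p) L"] Sc by (simp add: o_def elem_mat_def)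
      finally show ?thesis by simp
    qed
    finally show "commutator h (?cs ! q) = mat_lincomb ?n ?cs (col M q)" .
  qed
  have "char_poly B = char_poly M"
    by (rule change_of_basis[OF _ cs(1) b2 _ _ cs(2) M])
      (use hV block_upper_carrier commutator_in_block_upper in auto)
  then have "eig B = eig M" by (simp add: eig_def)
  also have "\<dots> = mset (diag_mat M)"
  proof (rule eig_upper_triangular)
    show "M \<in> carrier_mat (length L) (length L)" by (simp add: M_def)
    show "upper_triangular M"
      unfolding upper_triangular_def
    proof (intro allI impI)
      fix p q assume "p < dim_row M" "q < p"
      then have pq: "p < length L" "q < length L" "q < p" by (auto simp: M_def)
      obtain i j where ij: "L ! q = (i, j)" by force
      obtain k l where kl: "L ! p = (k, l)" by force
      have "(i, j) \<in> set (positions a b)" "(k, l) \<in> set (positions a b)" using pq ij kl L(2) nth_mem by metis+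
      then have b: "i < ?n" "j < ?n" "k < ?n" "l < ?n" unfolding set_positions by auto
      have "sorted (map (\<lambda>(i, j). i + (?n - j)) L)" unfolding L_def by (rule sorted_sort_key)
      then have key: "i + (?n - j) \<le> k + (?n - l)"
        using pq sorted_nth_mono[of "map (\<lambda>(i, j). i + (?n - j)) L" q p] ij kl by simp
      have ne: "(i, j) \<noteq> (k, l)" using L(1) pq ij kl by (metis nat_neq_iff nth_eq_iff_index_eq)
      have "M $$ (p, q) = (if l = j then T $$ (k, i) else 0) - (if k = i then T $$ (j, l) else 0)"
        using pq b commutator_elem_mat[OF T b] by (simp add: M_def ij kl)
      also have "\<dots> = 0"
      proof (cases "l = j")
        case True
        then have "i < k" using key ne by auto
        then show ?thesis using True Tut b by simp
      next
        case False
        have "l < j" if "k = i" using that key False b by auto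
        then show ?thesis using False Tut b by auto
      qed
      finally show "M $$ (p, q) = 0" .
    qed
  qed
  also have "diag_mat M = map (\<lambda>(i, j). T $$ (i, i) - T $$ (j, j)) L"
  proof (rule nth_equalityI)
    fix q assume "q < length (diag_mat M)"
    then have q: "q < length L" by (simp add: diag_mat_def M_def)
    obtain i j where ij: "L ! q = (i, j)" by force
    have "(i, j) \<in> set (positions a b)" using q ij L(2) nth_mem by metis
    then have b: "i < ?n" "j < ?n" unfolding set_positions by auto
    show "diag_mat M ! q = map (\<lambda>(i, j). T $$ (i, i) - T $$ (j, j)) L ! q"
      using q b commutator_elem_mat[OF T b b] by (simp add: M_def diag_mat_def ij)
  qed (simp add: diag_mat_def M_def)
  also have "mset \<dots> = image_mset (\<lambda>(i, j). T $$ (i, i) - T $$ (j, j)) (mset (positions a b))"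
    using L(3) by simp
  also have "\<dots> = mdiff (eig P) (eig P) + mdiff (eig Q) (eig Q) + mdiff (eig P) (eig Q)"
  proof -
    have "eig P = mset (diag_mat T1)" "eig Q = mset (diag_mat T2)"
      using eig_conj(2)[OF T1(1,2)] eig_conj(2)[OF T2(1,2)] eig_upper_triangular[OF T1(2,3)] eig_upper_triangular[OF T2(2,3)]
        T1(4) T2(4) by simp_all
    moreover have "diag_mat T1 = map (\<lambda>i. T $$ (i, i)) [0..<a]"
      using T1(2) T2(2) by (auto simp: diag_mat_def T_def)
    moreover have "diag_mat T2 = map (\<lambda>i. T $$ (i, i)) [a..<a + b]"
      using T1(2) T2(2) by (intro nth_equalityI) (auto simp: diag_mat_def T_def)
    ultimately show ?thesis unfolding positions_def by (simp add: mset_product_diff)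
  qed
  finally show ?thesis .
qed

lemma mat_lincomb_snoc:
  assumes "\<And>k. k < length bs \<Longrightarrow> bs ! k \<in> carrier_mat n n" "y \<in> carrier_mat n n"
  shows "mat_lincomb n (bs @ [y]) c = mat_lincomb n bs c + c $ length bs \<cdot>\<^sub>m y"
  using assms by (intro eq_matI) (auto simp: mat_lincomb_def nth_append intro!: sum.cong)

lemma mat_lincomb_cong: "(\<And>k. k < length bs \<Longrightarrow> c $ k = d $ k) \<Longrightarrow> mat_lincomb n bs c = mat_lincomb n bs d"
  by (simp add: mat_lincomb_def)

lemma mat_lincomb_in_parabolic:
  assumes "set bs \<subseteq> parabolic a b"
  shows "mat_lincomb (a + b) bs c \<in> parabolic a b"
proof -
  have b: "bs ! k \<in> block_upper a b" "mat_trace (bs ! k) = 0" if "k < length bs" for k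
    using assms that nth_mem unfolding parabolic_iff[symmetric] by (metis parabolic_iff subsetD)+
  have "mat_trace (mat_lincomb (a + b) bs c) = (\<Sum>i<a + b. \<Sum>k<length bs. c $ k * (bs ! k) $$ (i, i))"
    by (simp add: mat_trace_def mat_lincomb_def)
  also have "\<dots> = (\<Sum>k<length bs. c $ k * (\<Sum>i<a + b. (bs ! k) $$ (i, i)))"
    by (subst sum.swap) (simp add: sum_distrib_left)
  also have "\<dots> = (\<Sum>k<length bs. c $ k * mat_trace (bs ! k))"
  proof (intro sum.cong refl)
    fix k assume "k \<in> {..<length bs}"
    then have "bs ! k \<in> carrier_mat (a + b) (a + b)" using b(1) block_upper_carrier by blast
    then show "c $ k * (\<Sum>i<a + b. (bs ! k) $$ (i, i)) = c $ k * mat_trace (bs ! k)"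
      by (simp only: mat_trace_carrier)
  qed
  also have "\<dots> = 0" using b by simp
  finally have "mat_trace (mat_lincomb (a + b) bs c) = 0" .
  moreover have "mat_lincomb (a + b) bs c \<in> block_upper a b"
    using b by (auto simp: block_upper_def mat_lincomb_def intro!: sum.neutral)
  ultimately show ?thesis by (simp add: parabolic_iff)
qed

text \<open>
  The identity commutes with everything, so enlarging the trace zero subalgebra by it adds exactly one
  zero to the spectrum of \<open>ad h\<close>.
\<close>

lemma basis_add_one:
  assumes b: "ordered_basis (a + b) (parabolic a b) bs" and n: "0 < a + b"
  shows "ordered_basis (a + b) (block_upper a b) (bs @ [1\<^sub>m (a + b)])"
  unfolding ordered_basis_def
proof (intro conjI ballI)
  let ?n = "a + b" let ?N = "length bs"
  have bs: "set bs \<subseteq> parabolic a b" using b by (simp add: ordered_basis_def)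
  then have bc: "\<And>k. k < ?N \<Longrightarrow> bs ! k \<in> carrier_mat ?n ?n"
    using block_upper_carrier parabolic_iff nth_mem by (metis subsetD)
  show "set (bs @ [1\<^sub>m ?n]) \<subseteq> block_upper a b" using bs by (auto simp: parabolic_iff one_in_block_upper)
  have tr1: "mat_trace (1\<^sub>m ?n) = of_nat ?n" by (simp add: mat_trace_def)
  have snoc: "mat_lincomb ?n (bs @ [1\<^sub>m ?n]) c = mat_lincomb ?n bs c + c $ ?N \<cdot>\<^sub>m 1\<^sub>m ?n" for c
    by (rule mat_lincomb_snoc) (use bc in auto)
  fix x assume x: "x \<in> block_upper a b"
  then have xc: "x \<in> carrier_mat ?n ?n" by (rule block_upper_carrier)
  define t where "t = mat_trace x / of_nat ?n"
  have nz: "(of_nat ?n :: complex) \<noteq> 0" unfolding of_nat_eq_0_iff using n by simp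
  have "x - t \<cdot>\<^sub>m 1\<^sub>m ?n \<in> parabolic a b"
    using x xc nz unfolding parabolic_iff
    by (auto simp: mat_trace_linear[OF xc] mat_trace_linear(3)[OF one_carrier_mat one_carrier_mat] tr1 t_def simp del: of_nat_add
        intro!: block_upper_linear one_in_block_upper)
  then obtain c where c: "c \<in> carrier_vec ?N" "x - t \<cdot>\<^sub>m 1\<^sub>m ?n = mat_lincomb ?n bs c"
    using b unfolding ordered_basis_def by blast
  define d where "d = vec (Suc ?N) (\<lambda>k. if k < ?N then c $ k else t)"
  have "mat_lincomb ?n (bs @ [1\<^sub>m ?n]) d = mat_lincomb ?n bs c + t \<cdot>\<^sub>m 1\<^sub>m ?n"
    unfolding snoc
  proof -
    have "mat_lincomb ?n bs d = mat_lincomb ?n bs c" by (rule mat_lincomb_cong) (simp add: d_def)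
    then show "mat_lincomb ?n bs d + d $ ?N \<cdot>\<^sub>m 1\<^sub>m ?n = mat_lincomb ?n bs c + t \<cdot>\<^sub>m 1\<^sub>m ?n" by (simp add: d_def)
  qed
  also have "\<dots> = x" unfolding c(2)[symmetric] using xc by (intro eq_matI) auto
  finally have d: "d \<in> carrier_vec (length (bs @ [1\<^sub>m ?n])) \<and> x = mat_lincomb ?n (bs @ [1\<^sub>m ?n]) d" by (simp add: d_def)
  have "d' = d" if d': "d' \<in> carrier_vec (length (bs @ [1\<^sub>m ?n])) \<and> x = mat_lincomb ?n (bs @ [1\<^sub>m ?n]) d'" for d'
  proof -
    have e: "x = mat_lincomb ?n bs d' + d' $ ?N \<cdot>\<^sub>m 1\<^sub>m ?n" using d' snoc by simp
    have "mat_trace (mat_lincomb ?n bs d') = 0" using mat_lincomb_in_parabolic[OF bs] by (simp add: parabolic_iff)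
    then have "mat_trace x = d' $ ?N * of_nat ?n"
      unfolding e by (subst mat_trace_linear(1)[of _ ?n]) (auto simp: mat_trace_linear(3)[OF one_carrier_mat one_carrier_mat] tr1)
    then have t: "d' $ ?N = t" using nz by (simp add: t_def)
    define c' where "c' = vec ?N (\<lambda>k. d' $ k)"
    have "mat_lincomb ?n bs c' = mat_lincomb ?n bs d'" by (rule mat_lincomb_cong) (simp add: c'_def)
    then have "x = mat_lincomb ?n bs c' + t \<cdot>\<^sub>m 1\<^sub>m ?n" using e t by simp
    then have "x - t \<cdot>\<^sub>m 1\<^sub>m ?n = mat_lincomb ?n bs c'" by (auto intro!: eq_matI simp: mat_lincomb_def)
    then have "c' = c" using c b mat_lincomb_in_parabolic[OF bs]
      by (intro ordered_basis_inject[OF b]) (auto simp: c'_def)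
    then show "d' = d" using d' t by (intro eq_vecI) (auto simp: d_def c'_def less_Suc_eq)
  qed
  with d show "\<exists>!c. c \<in> carrier_vec (length (bs @ [1\<^sub>m ?n])) \<and> x = mat_lincomb ?n (bs @ [1\<^sub>m ?n]) c" by blast
qed

lemma ad_spectrum:
  assumes P: "P \<in> carrier_mat a a" and R: "R \<in> carrier_mat a b" and Q: "Q \<in> carrier_mat b b"
    and h: "h = four_block_mat P R (0\<^sub>m b a) Q" and n: "0 < a + b"
    and bs: "ordered_basis (a + b) (parabolic a b) bs" and A: "matrix_of_operator (a + b) bs (commutator h) A"
  shows "eig A + {#0#} = mdiff (eig P) (eig P) + mdiff (eig Q) (eig Q) + mdiff (eig P) (eig Q)"
proof -
  let ?n = "a + b" let ?N = "length bs"
  have bc: "\<And>k. k < ?N \<Longrightarrow> bs ! k \<in> carrier_mat ?n ?n"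
    using bs block_upper_carrier parabolic_iff nth_mem unfolding ordered_basis_def by (metis subsetD)
  have snoc: "mat_lincomb ?n (bs @ [1\<^sub>m ?n]) c = mat_lincomb ?n bs c + c $ ?N \<cdot>\<^sub>m 1\<^sub>m ?n" for c
    by (rule mat_lincomb_snoc) (use bc in auto)
  have Ac: "A \<in> carrier_mat ?N ?N" and Ae: "\<And>j. j < ?N \<Longrightarrow> commutator h (bs ! j) = mat_lincomb ?n bs (col A j)"
    using A unfolding matrix_of_operator_def by auto
  have hc: "h \<in> carrier_mat ?n ?n" unfolding h using P Q by auto
  define B where "B = four_block_mat A (0\<^sub>m ?N 1) (0\<^sub>m 1 ?N) (0\<^sub>m 1 1)"
  have Bc: "B \<in> carrier_mat (Suc ?N) (Suc ?N)" unfolding B_def using Ac by auto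
  have "matrix_of_operator ?n (bs @ [1\<^sub>m ?n]) (commutator h) B"
    unfolding matrix_of_operator_def
  proof (intro conjI allI impI)
    show "B \<in> carrier_mat (length (bs @ [1\<^sub>m ?n])) (length (bs @ [1\<^sub>m ?n]))" using Bc by simp
    fix j assume "j < length (bs @ [1\<^sub>m ?n])"
    then consider "j < ?N" | "j = ?N" by fastforce
    then show "commutator h ((bs @ [1\<^sub>m ?n]) ! j) = mat_lincomb ?n (bs @ [1\<^sub>m ?n]) (col B j)"
    proof cases
      case 1
      have "mat_lincomb ?n bs (col B j) = mat_lincomb ?n bs (col A j)"
        using 1 Ac Bc by (intro mat_lincomb_cong) (auto simp: B_def)
      moreover have "col B j $ ?N = 0" using 1 Ac Bc by (simp add: B_def)
      moreover have "M + 0 \<cdot>\<^sub>m 1\<^sub>m ?n = M" if "M \<in> carrier_mat ?n ?n" for M :: "complex mat" using that by (intro eq_matI) auto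
      ultimately show ?thesis unfolding snoc using 1 Ae by (simp add: nth_append)
    next
      case 2
      have "mat_lincomb ?n bs (col B j) = 0\<^sub>m ?n ?n"
        using 2 Ac Bc by (intro eq_matI) (auto simp: B_def mat_lincomb_def intro!: sum.neutral)
      moreover have "col B j $ ?N = 0" using 2 Ac Bc by (simp add: B_def)
      moreover have "commutator h (1\<^sub>m ?n) = 0\<^sub>m ?n ?n" using hc by (simp add: commutator_def)
      moreover have "0\<^sub>m ?n ?n + 0 \<cdot>\<^sub>m 1\<^sub>m ?n = (0\<^sub>m ?n ?n :: complex mat)" by (intro eq_matI) auto
      ultimately show ?thesis unfolding snoc using 2 by (simp add: nth_append)
    qed
  qed
  from block_upper_char_poly[OF P R Q h basis_add_one[OF bs n] this]
  have "eig B = mdiff (eig P) (eig P) + mdiff (eig Q) (eig Q) + mdiff (eig P) (eig Q)" .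
  moreover have "eig B = eig A + eig (0\<^sub>m 1 1)" unfolding B_def using Ac by (intro eig_lower_block) auto
  moreover have "eig (0\<^sub>m 1 1) = {#0#}"
    by (subst eig_upper_triangular[of _ 1]) (auto simp: upper_triangular_def diag_mat_def)
  ultimately show ?thesis by simp
qed

section \<open>Functionals as trace forms\<close>

lemma functional_lincomb:
  assumes f: "linear_functional_on (parabolic a b) \<phi>" and bs: "set bs \<subseteq> parabolic a b"
  shows "\<phi> (mat_lincomb (a + b) bs c) = (\<Sum>k<length bs. c $ k * \<phi> (bs ! k))"
  using bs
proof (induction bs rule: rev_induct)
  case Nil
  have z: "mat_lincomb (a + b) [] c \<in> parabolic a b" using mat_lincomb_in_parabolic[of "[]"] by simp
  have "0 \<cdot>\<^sub>m mat_lincomb (a + b) [] c = mat_lincomb (a + b) [] c" by (intro eq_matI) (auto simp: mat_lincomb_def)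
  then have "\<phi> (mat_lincomb (a + b) [] c) = 0" using f z unfolding linear_functional_on_def by (metis mult_zero_left)
  then show ?case by simp
next
  case (snoc y bs)
  have y: "y \<in> parabolic a b" and bs: "set bs \<subseteq> parabolic a b" using snoc.prems by auto
  have c: "\<And>k. k < length bs \<Longrightarrow> bs ! k \<in> carrier_mat (a + b) (a + b)" "y \<in> carrier_mat (a + b) (a + b)"
    using y bs block_upper_carrier parabolic_iff nth_mem by (metis subsetD)+
  have "c $ length bs \<cdot>\<^sub>m y \<in> parabolic a b"
    using y c by (auto simp: parabolic_iff mat_trace_linear(3)[OF c(2) c(2)] intro: block_upper_linear)
  then have "\<phi> (mat_lincomb (a + b) (bs @ [y]) c) = \<phi> (mat_lincomb (a + b) bs c) + c $ length bs * \<phi> y"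
    using f y mat_lincomb_in_parabolic[OF bs, of c] mat_lincomb_snoc[of bs "a + b" y c] c unfolding linear_functional_on_def by simp
  also have "\<dots> = (\<Sum>k<length (bs @ [y]). c $ k * \<phi> ((bs @ [y]) ! k))"
    using snoc.IH[OF bs] by (simp add: nth_append)
  finally show ?case .
qed

lemma parabolic_minus_scalar:
  assumes "x \<in> block_upper a b" "0 < a + b"
  obtains s where "x - s \<cdot>\<^sub>m 1\<^sub>m (a + b) \<in> parabolic a b"
proof
  have xc: "x \<in> carrier_mat (a + b) (a + b)" using assms(1) by (rule block_upper_carrier)
  have nz: "(of_nat (a + b) :: complex) \<noteq> 0" unfolding of_nat_eq_0_iff using assms(2) by simp
  let ?s = "mat_trace x / of_nat (a + b)"
  have "mat_trace (x - ?s \<cdot>\<^sub>m 1\<^sub>m (a + b)) = mat_trace x - ?s * of_nat (a + b)"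
    using xc by (subst mat_trace_linear(2)[of _ "a + b"]) (auto simp: mat_trace_linear(3)[OF one_carrier_mat one_carrier_mat] mat_trace_def)
  also have "\<dots> = 0" using nz by simp
  finally show "x - ?s \<cdot>\<^sub>m 1\<^sub>m (a + b) \<in> parabolic a b"
    using assms(1) by (auto simp: parabolic_iff intro!: block_upper_linear one_in_block_upper)
qed

text \<open>Off the diagonal the elementary matrices test single entries. On the diagonal only
  differences of them have trace zero, which makes all diagonal entries of \<open>M\<close> equal;
  the vanishing trace of \<open>M\<close> then kills the common value.\<close>

lemma trace_vanish:
  assumes M: "M \<in> carrier_mat (a + b) (a + b)" and tr: "mat_trace M = 0" and n: "0 < a + b"
    and v: "\<And>y. y \<in> parabolic a b \<Longrightarrow> mat_trace (M * y) = 0"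
    and ij: "i < a + b" "j < a + b" "\<not> (a \<le> i \<and> j < a)"
  shows "M $$ (j, i) = 0"
proof -
  let ?n = "a + b"
  have Ec: "elem_mat ?n p \<in> carrier_mat ?n ?n" for p by (simp add: elem_mat_def)
  have EV: "elem_mat ?n (k, l) \<in> block_upper a b" if "\<not> (a \<le> k \<and> l < a)" for k l
    using that by (auto simp: block_upper_def elem_mat_def)
  have trE: "mat_trace (elem_mat ?n (k, l)) = (if k = l then 1 else 0)" if "k < ?n" "l < ?n" for k l
  proof -
    have "mat_trace (elem_mat ?n (k, l)) = (\<Sum>m<?n. if m = k then (if k = l then 1 else 0) else 0)"
      unfolding mat_trace_carrier[OF Ec] by (intro sum.cong refl) (auto simp: elem_mat_def)
    then show ?thesis using that by simp
  qed
  have trME: "mat_trace (M * elem_mat ?n (k, l)) = M $$ (l, k)" if "k < ?n" "l < ?n" for k l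
  proof -
    have "mat_trace (M * elem_mat ?n (k, l)) = (\<Sum>m<?n. \<Sum>q<?n. M $$ (m, q) * elem_mat ?n (k, l) $$ (q, m))"
      using M Ec by (subst mat_trace_carrier[of _ ?n]) (auto intro!: sum.cong mat_mult_entry)
    also have "\<dots> = (\<Sum>m<?n. \<Sum>q<?n. if q = k then (if m = l then M $$ (l, k) else 0) else 0)"
      by (intro sum.cong refl) (auto simp: elem_mat_def)
    also have "\<dots> = M $$ (l, k)" using that by simp
    finally show ?thesis .
  qed
  show ?thesis
  proof (cases "i = j")
    case False
    then have "elem_mat ?n (i, j) \<in> parabolic a b" using ij EV trE by (simp add: parabolic_iff)
    from v[OF this] show ?thesis using trME ij by simp
  next
    case True
    have d: "M $$ (k, k) = M $$ (0, 0)" if "k < ?n" for k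
    proof -
      have "elem_mat ?n (k, k) - elem_mat ?n (0, 0) \<in> parabolic a b"
        using EV[of k k] EV[of 0 0] n that trE
        by (auto simp: parabolic_iff mat_trace_linear(2)[OF Ec Ec] intro!: block_upper_linear)
      from v[OF this] have "mat_trace (M * elem_mat ?n (k, k) - M * elem_mat ?n (0, 0)) = 0"
        using M Ec by (simp add: mult_minus_distrib_mat[of _ ?n ?n _ ?n])
      then have "mat_trace (M * elem_mat ?n (k, k)) - mat_trace (M * elem_mat ?n (0, 0)) = 0"
        using M Ec by (subst (asm) mat_trace_linear(2)[of _ ?n]) auto
      then show ?thesis using trME that n by simp
    qed
    have "0 = (\<Sum>k<?n. M $$ (k, k))" using tr M by (simp add: mat_trace_carrier)
    also have "\<dots> = (\<Sum>k<?n. M $$ (0, 0))" using d by (intro sum.cong) auto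
    also have "\<dots> = of_nat ?n * M $$ (0, 0)" by simp
    finally have "M $$ (0, 0) = 0" using n by (metis mult_eq_0_iff of_nat_eq_0_iff not_gr_zero)
    then show ?thesis using d[of i] ij True by simp
  qed
qed

text \<open>With position (0, 0) left out of the basis, the coordinate of a matrix at any other
  position is simply its entry there; the corner entry is recovered from trace zero.\<close>

definition trace_basis_elem :: "nat \<Rightarrow> nat \<times> nat \<Rightarrow> complex mat" where
  "trace_basis_elem n p = (if fst p = snd p then elem_mat n p - elem_mat n (0, 0) else elem_mat n p)"

lemma parabolic_basis:
  assumes n: "0 < a + b"
  defines "L \<equiv> filter (\<lambda>p. p \<noteq> (0, 0)) (positions a b)"
  defines "bs \<equiv> map (trace_basis_elem (a + b)) L"
  shows "ordered_basis (a + b) (parabolic a b) bs"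
    and "x \<in> parabolic a b \<Longrightarrow> x = mat_lincomb (a + b) bs (vec (length L) (\<lambda>k. x $$ (L ! k)))"
proof -
  let ?n = "a + b"
  have L: "distinct L" "set L = {(i, j). i < ?n \<and> j < ?n \<and> \<not> (a \<le> i \<and> j < a) \<and> (i, j) \<noteq> (0, 0)}"
    using distinct_positions by (auto simp: L_def set_positions)
  have len: "length bs = length L" by (simp add: bs_def)
  have Ec: "elem_mat ?n p \<in> carrier_mat ?n ?n" for p by (simp add: elem_mat_def)
  have trE: "mat_trace (elem_mat ?n (k, l)) = (if k = l then 1 else 0)" if "k < ?n" "l < ?n" for k l
  proof -
    have "mat_trace (elem_mat ?n (k, l)) = (\<Sum>m<?n. if m = k then (if k = l then 1 else 0) else 0)"
      unfolding mat_trace_carrier[OF Ec] by (intro sum.cong refl) (auto simp: elem_mat_def)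
    then show ?thesis using that by simp
  qed
  have in_g: "trace_basis_elem ?n p \<in> parabolic a b" if "p \<in> set L" for p
  proof -
    obtain i j where p: "p = (i, j)" by force
    have ij: "i < ?n" "j < ?n" "\<not> (a \<le> i \<and> j < a)" using that p L(2) by auto
    then have "elem_mat ?n p \<in> block_upper a b" "elem_mat ?n (0, 0) \<in> block_upper a b"
      using p by (auto simp: block_upper_def elem_mat_def)
    then show ?thesis using ij p n trE
      by (auto simp: trace_basis_elem_def parabolic_iff mat_trace_linear(2)[OF Ec Ec] intro!: block_upper_linear)
  qed
  then have bs: "set bs \<subseteq> parabolic a b" by (auto simp: bs_def)
  have entry: "mat_lincomb ?n bs c $$ (i, j) = mat_lincomb ?n (map (elem_mat ?n) L) c $$ (i, j)"
    if "i < ?n" "j < ?n" "(i, j) \<noteq> (0, 0)" for c i j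
  proof -
    have "trace_basis_elem ?n p $$ (i, j) = elem_mat ?n p $$ (i, j)" for p
      using that by (auto simp: trace_basis_elem_def elem_mat_def)
    then show ?thesis using that by (simp add: mat_lincomb_def bs_def)
  qed
  have rep: "x = mat_lincomb ?n bs (vec (length L) (\<lambda>k. x $$ (L ! k)))" if x: "x \<in> parabolic a b" for x
  proof -
    define c where "c = vec (length L) (\<lambda>k. x $$ (L ! k))"
    define y where "y = mat_lincomb ?n bs c"
    have xc: "x \<in> carrier_mat ?n ?n" "x \<in> block_upper a b" using x block_upper_carrier by (auto simp: parabolic_iff)
    have y: "y \<in> parabolic a b" unfolding y_def by (rule mat_lincomb_in_parabolic[OF bs])
    then have yc: "y \<in> carrier_mat ?n ?n" "y \<in> block_upper a b" using block_upper_carrier by (auto simp: parabolic_iff)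
    have off: "x $$ (i, j) = y $$ (i, j)" if ij: "i < ?n" "j < ?n" "(i, j) \<noteq> (0, 0)" for i j
    proof (cases "(i, j) \<in> set L")
      case True
      then obtain k where "k < length L" "L ! k = (i, j)" by (auto simp: in_set_conv_nth)
      then show ?thesis unfolding y_def entry[OF ij] using elem_mat_lincomb(1)[OF L(1) ij(1,2)] by (simp add: c_def)
    next
      case False
      then have "a \<le> i" "j < a" using ij L(2) by auto
      then show ?thesis using xc(2) yc(2) ij by (simp add: block_upper_def)
    qed
    have z: "(\<Sum>k<?n. x $$ (k, k)) = (\<Sum>k<?n. y $$ (k, k))"
      using x y xc yc by (simp add: parabolic_iff mat_trace_carrier)
    have split: "(\<Sum>k<?n. f k) = f 0 + (\<Sum>k\<in>{..<?n} - {0}. f k)" for f :: "nat \<Rightarrow> complex"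
      using n by (intro sum.remove) auto
    have "x $$ (0, 0) + (\<Sum>k\<in>{..<?n} - {0}. x $$ (k, k)) = y $$ (0, 0) + (\<Sum>k\<in>{..<?n} - {0}. y $$ (k, k))"
      using z unfolding split[of "\<lambda>k. x $$ (k, k)"] split[of "\<lambda>k. y $$ (k, k)"] .
    moreover have "(\<Sum>k\<in>{..<?n} - {0}. x $$ (k, k)) = (\<Sum>k\<in>{..<?n} - {0}. y $$ (k, k))"
      using off by (intro sum.cong) auto
    ultimately have "x $$ (0, 0) = y $$ (0, 0)" by simp
    have "x = y"
    proof (rule eq_matI)
      fix i j assume "i < dim_row y" "j < dim_col y"
      then have "i < ?n" "j < ?n" using yc by auto
      then show "x $$ (i, j) = y $$ (i, j)"
        using off[of i j] \<open>x $$ (0, 0) = y $$ (0, 0)\<close> by (cases "(i, j) = (0, 0)") auto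
    qed (use xc yc in auto)
    then show ?thesis by (simp add: y_def c_def)
  qed
  show "x \<in> parabolic a b \<Longrightarrow> x = mat_lincomb ?n bs (vec (length L) (\<lambda>k. x $$ (L ! k)))" by (rule rep)
  show "ordered_basis ?n (parabolic a b) bs"
    unfolding ordered_basis_def
  proof (intro conjI ballI bs)
    fix x assume x: "x \<in> parabolic a b"
    define c where "c = vec (length L) (\<lambda>k. x $$ (L ! k))"
    have c: "c \<in> carrier_vec (length bs) \<and> x = mat_lincomb ?n bs c" using rep[OF x] by (simp add: c_def len)
    have "d = c" if d: "d \<in> carrier_vec (length bs) \<and> x = mat_lincomb ?n bs d" for d
    proof (rule eq_vecI)
      fix k assume "k < dim_vec c"
      then have k: "k < length L" by (simp add: c_def)
      obtain i j where ij: "L ! k = (i, j)" by force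
      then have "(i, j) \<in> set L" using k by (metis nth_mem)
      then have b: "i < ?n" "j < ?n" "(i, j) \<noteq> (0, 0)" unfolding L(2) by auto
      have "x $$ (i, j) = d $ k" using d entry[OF b, of d] elem_mat_lincomb(1)[OF L(1) b(1,2) k ij] by simp
      then show "d $ k = c $ k" using k ij by (simp add: c_def)
    qed (use d len in \<open>simp add: c_def\<close>)
    with c show "\<exists>!c. c \<in> carrier_vec (length bs) \<and> x = mat_lincomb ?n bs c" by blast
  qed
qed

text \<open>The trace of \<open>F * x\<close> pairs entry (j, i) of \<open>F\<close> with entry (i,
  j) of \<open>x\<close>. The upper right block of \<open>F\<close> meets only zeros of
  \<open>x\<close> and can be chosen to be 0.\<close>

lemma functional_representation:
  assumes f: "linear_functional_on (parabolic a b) \<phi>" and n: "0 < a + b"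
  obtains A C D where "A \<in> carrier_mat a a" "C \<in> carrier_mat b a" "D \<in> carrier_mat b b"
    "mat_trace (four_block_mat A (0\<^sub>m a b) C D) = 0"
    "\<And>x. x \<in> parabolic a b \<Longrightarrow> \<phi> x = mat_trace (four_block_mat A (0\<^sub>m a b) C D * x)"
proof -
  let ?n = "a + b"
  define L where "L = filter (\<lambda>p. p \<noteq> (0, 0)) (positions a b)"
  let ?B = "trace_basis_elem ?n"
  have L: "distinct L" "set L = {(i, j). i < ?n \<and> j < ?n \<and> \<not> (a \<le> i \<and> j < a) \<and> (i, j) \<noteq> (0, 0)}"
    using distinct_positions by (auto simp: L_def set_positions)
  define F0 where "F0 = mat ?n ?n (\<lambda>(j, i). if (i, j) \<in> set L then \<phi> (?B (i, j)) else 0)"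
  have F0: "F0 \<in> carrier_mat ?n ?n" by (simp add: F0_def)
  have nz: "(of_nat ?n :: complex) \<noteq> 0" unfolding of_nat_eq_0_iff using n by simp
  \<comment> \<open>Scalars pair to zero with matrices of trace zero, so subtracting one normalizes
    the trace of \<open>F\<close> without changing the functional.\<close>
  define s where "s = mat_trace F0 / of_nat ?n"
  define F where "F = F0 - s \<cdot>\<^sub>m 1\<^sub>m ?n"
  have F: "F \<in> carrier_mat (a + b) (a + b)" using F0 by (auto simp: F_def)
  have "mat_trace F = mat_trace F0 - s * of_nat ?n"
    unfolding F_def using F0 by (subst mat_trace_linear(2)[of _ ?n]) (auto simp: mat_trace_linear(3)[OF one_carrier_mat one_carrier_mat] mat_trace_def)
  then have trF: "mat_trace F = 0" using nz by (simp add: s_def)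
  have rep: "\<phi> x = mat_trace (F * x)" if x: "x \<in> parabolic a b" for x
  proof -
    have xc: "x \<in> carrier_mat ?n ?n" using x block_upper_carrier by (auto simp: parabolic_iff)
    have "\<phi> x = \<phi> (mat_lincomb ?n (map ?B L) (vec (length L) (\<lambda>k. x $$ (L ! k))))"
      using parabolic_basis(2)[OF n x] by (simp add: L_def)
    also have "\<dots> = (\<Sum>k<length L. x $$ (L ! k) * \<phi> (?B (L ! k)))"
      using functional_lincomb[OF f, of "map ?B L"] parabolic_basis(1)[OF n] unfolding ordered_basis_def by (simp add: L_def)
    also have "\<dots> = (\<Sum>p\<in>set L. x $$ p * \<phi> (?B p))"
      using sum.reindex_bij_betw[OF bij_betw_nth[OF L(1) refl refl], of "\<lambda>p. x $$ p * \<phi> (?B p)"] by (simp add: lessThan_atLeast0)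
    also have "\<dots> = (\<Sum>p\<in>{..<?n} \<times> {..<?n}. F0 $$ (snd p, fst p) * x $$ p)"
    proof (rule sum.mono_neutral_cong_left)
      show "\<forall>p\<in>{..<?n} \<times> {..<?n} - set L. F0 $$ (snd p, fst p) * x $$ p = 0" by (auto simp: F0_def)
      fix p assume p: "p \<in> set L"
      obtain i j where "p = (i, j)" by force
      then show "x $$ p * \<phi> (?B p) = F0 $$ (snd p, fst p) * x $$ p" using p L(2) by (auto simp: F0_def)
    qed (use L(2) in auto)
    also have "\<dots> = (\<Sum>j<?n. \<Sum>i<?n. F0 $$ (j, i) * x $$ (i, j))"
      by (subst sum.swap) (simp add: sum.cartesian_product case_prod_unfold)
    also have "\<dots> = mat_trace (F0 * x)"
      using F0 xc mat_mult_entry[OF F0 xc] by (subst mat_trace_carrier[of _ ?n]) (simp_all del: index_mult_mat(1))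
    also have "\<dots> = mat_trace (F * x)"
    proof -
      have "F * x = F0 * x - s \<cdot>\<^sub>m x" unfolding F_def using F0 xc by (simp add: mat_dim_distribs)
      moreover have "mat_trace (F0 * x - s \<cdot>\<^sub>m x) = mat_trace (F0 * x) - s * mat_trace x"
        using F0 xc by (subst mat_trace_linear(2)[of _ ?n]) (auto simp: mat_trace_linear(3)[OF xc xc])
      ultimately show ?thesis using x by (simp add: parabolic_iff)
    qed
    finally show ?thesis .
  qed
  obtain A B C D where b: "A \<in> carrier_mat a a" "B \<in> carrier_mat a b" "C \<in> carrier_mat b a" "D \<in> carrier_mat b b"
    "F = four_block_mat A B C D" using split_blocks[OF F] .
  have "B = 0\<^sub>m a b"
  proof (rule eq_matI)
    fix i j assume "i < dim_row (0\<^sub>m a b)" "j < dim_col (0\<^sub>m a b)"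
    then have ij: "i < a" "j < b" by auto
    have "F $$ (i, a + j) = 0" using ij L(2) by (simp add: F_def F0_def)
    then show "B $$ (i, j) = 0\<^sub>m a b $$ (i, j)" unfolding b(5) using b ij by simp
  qed (use b in auto)
  then have Fb: "F = four_block_mat A (0\<^sub>m a b) C D" using b(5) by simp
  show ?thesis by (rule that[OF b(1,3,4)]) (use trF rep in \<open>simp_all flip: Fb\<close>)
qed

section \<open>Nondegeneracy and the principal element in block form\<close>

lemma minus_eq_zero_mat:
  assumes "M \<in> carrier_mat m n" "N \<in> carrier_mat m n"
  shows "M - N = 0\<^sub>m m n \<longleftrightarrow> M = (N :: complex mat)"
proof
  assume e: "M - N = 0\<^sub>m m n"
  show "M = N"
  proof (rule eq_matI)
    fix i j assume "i < dim_row N" "j < dim_col N"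
    then show "M $$ (i, j) = N $$ (i, j)" using arg_cong[OF e, of "\<lambda>M. M $$ (i, j)"] assms by simp
  qed (use assms in auto)
qed (use assms in \<open>auto intro!: eq_matI\<close>)

lemma commutator_expand:
  fixes F x y :: "complex mat"
  assumes "F \<in> carrier_mat n n" "x \<in> carrier_mat n n" "y \<in> carrier_mat n n"
  shows "F * (x * y - y * x) = F * x * y - F * y * x" "F * x * y - x * (F * y) = (F * x - x * F) * y"
proof -
  have d: "dim_row F = n" "dim_col F = n" "dim_row x = n" "dim_col x = n" "dim_row y = n" "dim_col y = n" using assms by auto
  show "F * (x * y - y * x) = F * x * y - F * y * x" by (simp add: d mat_dim_distribs mult_assoc_dim)
  show "F * x * y - x * (F * y) = (F * x - x * F) * y" by (simp add: d mat_dim_distribs mult_assoc_dim)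
qed

lemma commutator_minus_scalar:
  assumes "x \<in> carrier_mat n n" "y \<in> carrier_mat n n"
  shows "commutator (x - s \<cdot>\<^sub>m 1\<^sub>m n) y = commutator x y"
proof -
  have d: "dim_row x = n" "dim_col x = n" "dim_row y = n" "dim_col y = n" using assms by auto
  have "(x - s \<cdot>\<^sub>m 1\<^sub>m n) * y = x * y - s \<cdot>\<^sub>m y" using assms by (simp add: d mat_dim_distribs)
  moreover have "y * (x - s \<cdot>\<^sub>m 1\<^sub>m n) = y * x - s \<cdot>\<^sub>m y" using assms by (simp add: d mat_dim_distribs)
  ultimately show ?thesis unfolding commutator_def using assms by (auto intro!: eq_matI simp del: index_mult_mat(1))
qed

locale lower_functional =
  fixes a b :: nat and A C D :: "complex mat" and \<phi> :: "complex mat \<Rightarrow> complex"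
  assumes A: "A \<in> carrier_mat a a" and C: "C \<in> carrier_mat b a" and D: "D \<in> carrier_mat b b" and n: "0 < a + b"
    and tr: "mat_trace (four_block_mat A (0\<^sub>m a b) C D) = 0"
    and rep: "\<And>x. x \<in> parabolic a b \<Longrightarrow> \<phi> x = mat_trace (four_block_mat A (0\<^sub>m a b) C D * x)"
begin

abbreviation "F \<equiv> four_block_mat A (0\<^sub>m a b) C D"

lemma F: "F \<in> carrier_mat (a + b) (a + b)" using A D by auto

lemma functional_commutator:
  assumes "x \<in> block_upper a b" "y \<in> block_upper a b"
  shows "\<phi> (commutator x y) = mat_trace ((F * x - x * F) * y)"
proof -
  have c: "x \<in> carrier_mat (a + b) (a + b)" "y \<in> carrier_mat (a + b) (a + b)" using assms block_upper_carrier by auto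
  have "\<phi> (commutator x y) = mat_trace (F * (x * y - y * x))"
    using rep[OF commutator_in_parabolic[OF assms]] by (simp add: commutator_def)
  also have "F * (x * y - y * x) = F * x * y - F * y * x" by (rule commutator_expand[OF F c])
  also have "mat_trace \<dots> = mat_trace (F * x * y) - mat_trace (F * y * x)"
    using F c by (intro mat_trace_linear(2)[of _ "a + b"]) (auto intro!: carrier_matI)
  also have "mat_trace (F * y * x) = mat_trace (x * (F * y))"
    using F c by (intro mat_trace_comm[of _ "a + b" "a + b"]) auto
  also have "mat_trace (F * x * y) - mat_trace (x * (F * y)) = mat_trace (F * x * y - x * (F * y))"
    using F c by (intro mat_trace_linear(2)[of _ "a + b", symmetric]) (auto intro!: carrier_matI)
  also have "F * x * y - x * (F * y) = (F * x - x * F) * y" by (rule commutator_expand[OF F c])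
  finally show ?thesis .
qed

lemma commutator_blocks:
  assumes "X \<in> carrier_mat a a" "Z \<in> carrier_mat a b" "Y \<in> carrier_mat b b"
  shows "F * four_block_mat X Z (0\<^sub>m b a) Y - four_block_mat X Z (0\<^sub>m b a) Y * F =
    four_block_mat (A * X - (X * A + Z * C)) (A * Z - Z * D) (C * X - Y * C) (C * Z + D * Y - Y * D)"
  using assms A C D
  by (simp add: mult_four_block_mat[where ?nr1.0 = a and ?n1.0 = a and ?n2.0 = b and ?nr2.0 = b and ?nc1.0 = a and ?nc2.0 = b]
      minus_four_block[of _ a a _ b _ b])

lemma trace_upper_right:
  assumes "W \<in> carrier_mat a b" "y \<in> block_upper a b"
  shows "mat_trace (four_block_mat (0\<^sub>m a a) W (0\<^sub>m b a) (0\<^sub>m b b) * y) = 0"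
proof -
  obtain X Z Y where y: "X \<in> carrier_mat a a" "Z \<in> carrier_mat a b" "Y \<in> carrier_mat b b" "y = four_block_mat X Z (0\<^sub>m b a) Y"
    using block_upper_blocks[OF assms(2)] .
  have "four_block_mat (0\<^sub>m a a) W (0\<^sub>m b a) (0\<^sub>m b b) * y = four_block_mat (0\<^sub>m a a) (W * Y) (0\<^sub>m b a) (0\<^sub>m b b)"
    unfolding y(4) using y assms
    by (subst mult_four_block_mat[where ?nr1.0 = a and ?n1.0 = a and ?n2.0 = b and ?nr2.0 = b and ?nc1.0 = a and ?nc2.0 = b]) auto
  moreover have "mat_trace \<dots> = mat_trace (0\<^sub>m a a) + mat_trace (0\<^sub>m b b)" using y assms by (intro mat_trace_four_block) auto
  ultimately show ?thesis by (simp add: mat_trace_def)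
qed

text \<open>\<open>M2\<close> pairs only with the lower left block of \<open>y\<close>, which is 0;
  the other blocks are detected up to a scalar matrix, and the trace condition excludes that
  scalar.\<close>

lemma blocks_vanish:
  assumes M: "M1 \<in> carrier_mat a a" "M2 \<in> carrier_mat a b" "M3 \<in> carrier_mat b a" "M4 \<in> carrier_mat b b"
    and tr: "mat_trace (four_block_mat M1 M2 M3 M4) = 0"
  shows "(\<forall>y\<in>parabolic a b. mat_trace (four_block_mat M1 M2 M3 M4 * y) = 0) \<longleftrightarrow> M1 = 0\<^sub>m a a \<and> M3 = 0\<^sub>m b a \<and> M4 = 0\<^sub>m b b"
proof
  assume v: "\<forall>y\<in>parabolic a b. mat_trace (four_block_mat M1 M2 M3 M4 * y) = 0"
  have z: "four_block_mat M1 M2 M3 M4 $$ (j, i) = 0" if "i < a + b" "j < a + b" "\<not> (a \<le> i \<and> j < a)" for i j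
    using that v M by (intro trace_vanish[OF _ tr n]) auto
  have "M1 $$ (i, j) = 0" if "i < a" "j < a" for i j using z[of j i] that M by simp
  moreover have "M3 $$ (i, j) = 0" if "i < b" "j < a" for i j using z[of j "a + i"] that M by simp
  moreover have "M4 $$ (i, j) = 0" if "i < b" "j < b" for i j using z[of "a + j" "a + i"] that M by simp
  ultimately show "M1 = 0\<^sub>m a a \<and> M3 = 0\<^sub>m b a \<and> M4 = 0\<^sub>m b b" using M by (auto intro!: eq_matI)
next
  assume "M1 = 0\<^sub>m a a \<and> M3 = 0\<^sub>m b a \<and> M4 = 0\<^sub>m b b"
  then show "\<forall>y\<in>parabolic a b. mat_trace (four_block_mat M1 M2 M3 M4 * y) = 0"
    using trace_upper_right[OF M(2)] by (auto simp: parabolic_iff)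
qed

lemma radical_iff:
  assumes X: "X \<in> carrier_mat a a" and Z: "Z \<in> carrier_mat a b" and Y: "Y \<in> carrier_mat b b"
  shows "(\<forall>y\<in>parabolic a b. \<phi> (commutator (four_block_mat X Z (0\<^sub>m b a) Y) y) = 0) \<longleftrightarrow>
    A * X - X * A = Z * C \<and> C * X = Y * C \<and> Y * D - D * Y = C * Z"
proof -
  let ?x = "four_block_mat X Z (0\<^sub>m b a) Y"
  have x: "?x \<in> block_upper a b" using X Z Y by (rule four_block_in_block_upper)
  have xc: "?x \<in> carrier_mat (a + b) (a + b)" using x by (rule block_upper_carrier)
  have "mat_trace (F * ?x - ?x * F) = 0"
    using F xc by (subst mat_trace_linear(2)[of _ "a + b"]) (auto simp: mat_trace_comm[OF F xc] intro!: carrier_matI)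
  then have t: "mat_trace (four_block_mat (A * X - (X * A + Z * C)) (A * Z - Z * D) (C * X - Y * C) (C * Z + D * Y - Y * D)) = 0"
    unfolding commutator_blocks[OF X Z Y] .
  have "(\<forall>y\<in>parabolic a b. \<phi> (commutator ?x y) = 0) \<longleftrightarrow> (\<forall>y\<in>parabolic a b. mat_trace ((F * ?x - ?x * F) * y) = 0)"
    using functional_commutator[OF x] by (auto simp: parabolic_iff)
  also have "\<dots> \<longleftrightarrow> A * X - (X * A + Z * C) = 0\<^sub>m a a \<and> C * X - Y * C = 0\<^sub>m b a \<and> C * Z + D * Y - Y * D = 0\<^sub>m b b"
    unfolding commutator_blocks[OF X Z Y] by (rule blocks_vanish[OF _ _ _ _ t]) (use A C D X Y Z in \<open>auto intro!: carrier_matI\<close>)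
  also have "A * X - (X * A + Z * C) = 0\<^sub>m a a \<longleftrightarrow> A * X - X * A = Z * C"
  proof -
    have "A * X - (X * A + Z * C) = (A * X - X * A) - Z * C" using A C X Z by (auto intro!: eq_matI simp del: index_mult_mat(1))
    moreover have "A * X - X * A \<in> carrier_mat a a" "Z * C \<in> carrier_mat a a" using A C X Z by (auto intro!: carrier_matI)
    ultimately show ?thesis using minus_eq_zero_mat by metis
  qed
  also have "C * X - Y * C = 0\<^sub>m b a \<longleftrightarrow> C * X = Y * C" using C X Y by (intro minus_eq_zero_mat) auto
  also have "C * Z + D * Y - Y * D = 0\<^sub>m b b \<longleftrightarrow> Y * D - D * Y = C * Z"
  proof -
    have "C * Z + D * Y - Y * D = C * Z - (Y * D - D * Y)" using C D Y Z by (auto intro!: eq_matI simp del: index_mult_mat(1))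
    moreover have "C * Z \<in> carrier_mat b b" "Y * D - D * Y \<in> carrier_mat b b" using C D Y Z by (auto intro!: carrier_matI)
    ultimately show ?thesis using minus_eq_zero_mat by metis
  qed
  finally show ?thesis .
qed

lemma principal_iff:
  assumes X: "P \<in> carrier_mat a a" and Z: "R \<in> carrier_mat a b" and Y: "Q \<in> carrier_mat b b"
  shows "(\<forall>y\<in>parabolic a b. \<phi> (commutator (four_block_mat P R (0\<^sub>m b a) Q) y) = \<phi> y) \<longleftrightarrow> principal_triple a b A C D P R Q"
proof -
  let ?x = "four_block_mat P R (0\<^sub>m b a) Q"
  have x: "?x \<in> block_upper a b" using X Z Y by (rule four_block_in_block_upper)
  have xc: "?x \<in> carrier_mat (a + b) (a + b)" using x by (rule block_upper_carrier)
  let ?M = "four_block_mat (A * P - (P * A + R * C) - A) (A * R - R * D - 0\<^sub>m a b) (C * P - Q * C - C) (C * R + D * Q - Q * D - D)"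
  have M: "F * ?x - ?x * F - F = ?M"
    unfolding commutator_blocks[OF X Z Y] using A C D X Y Z by (intro minus_four_block[of _ a a _ b _ b]) (auto intro!: carrier_matI)
  have Fx: "F * ?x - ?x * F \<in> carrier_mat (a + b) (a + b)" using F xc by (auto intro!: carrier_matI)
  have "mat_trace (F * ?x - ?x * F) = 0"
    using F xc by (subst mat_trace_linear(2)[of _ "a + b"]) (auto simp: mat_trace_comm[OF F xc] intro!: carrier_matI)
  then have t: "mat_trace ?M = 0" unfolding M[symmetric] mat_trace_linear(2)[OF Fx F] using tr by simp
  have "\<phi> (commutator ?x y) = \<phi> y \<longleftrightarrow> mat_trace (?M * y) = 0" if y: "y \<in> parabolic a b" for y
  proof -
    have yc: "y \<in> block_upper a b" "y \<in> carrier_mat (a + b) (a + b)" using y block_upper_carrier by (auto simp: parabolic_iff)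
    have "?M * y = (F * ?x - ?x * F) * y - F * y" unfolding M[symmetric] by (rule minus_mult_distrib_mat[OF Fx F yc(2)])
    also have "mat_trace \<dots> = mat_trace ((F * ?x - ?x * F) * y) - mat_trace (F * y)"
      using Fx F yc(2) by (intro mat_trace_linear(2)[of _ "a + b"]) (auto intro!: carrier_matI)
    finally show ?thesis using functional_commutator[OF x yc(1)] rep[OF y] by simp
  qed
  then have "(\<forall>y\<in>parabolic a b. \<phi> (commutator ?x y) = \<phi> y) \<longleftrightarrow> (\<forall>y\<in>parabolic a b. mat_trace (?M * y) = 0)" by blast
  also have "\<dots> \<longleftrightarrow> A * P - (P * A + R * C) - A = 0\<^sub>m a a \<and> C * P - Q * C - C = 0\<^sub>m b a \<and> C * R + D * Q - Q * D - D = 0\<^sub>m b b"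
    by (rule blocks_vanish[OF _ _ _ _ t]) (use A C D X Y Z in \<open>auto intro!: carrier_matI\<close>)
  also have "A * P - (P * A + R * C) - A = 0\<^sub>m a a \<longleftrightarrow> A * P - P * A - R * C = A"
  proof -
    have "A * P - (P * A + R * C) = A * P - P * A - R * C" using A C X Z by (auto intro!: eq_matI simp del: index_mult_mat(1))
    moreover have "A * P - P * A - R * C \<in> carrier_mat a a" using A C X Z by (auto intro!: carrier_matI)
    ultimately show ?thesis using A minus_eq_zero_mat by metis
  qed
  also have "C * P - Q * C - C = 0\<^sub>m b a \<longleftrightarrow> C * P - Q * C = C" using C X Y by (intro minus_eq_zero_mat) (auto intro!: carrier_matI)
  also have "C * R + D * Q - Q * D - D = 0\<^sub>m b b \<longleftrightarrow> C * R + (D * Q - Q * D) = D"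
  proof -
    have "C * R + D * Q - Q * D = C * R + (D * Q - Q * D)" using C D Y Z by (auto intro!: eq_matI simp del: index_mult_mat(1))
    moreover have "C * R + (D * Q - Q * D) \<in> carrier_mat b b" using C D Y Z by (auto intro!: carrier_matI)
    ultimately show ?thesis using D minus_eq_zero_mat by metis
  qed
  finally show ?thesis unfolding principal_triple_def using X Y Z by blast
qed

lemma rigid_imp_nondegenerate:
  assumes r: "rigid a b A C D" and x: "x \<in> parabolic a b" and v: "\<forall>y\<in>parabolic a b. \<phi> (commutator x y) = 0"
  shows "x = 0\<^sub>m (a + b) (a + b)"
proof -
  have x': "x \<in> block_upper a b" "mat_trace x = 0" using x by (auto simp: parabolic_iff)
  obtain X Z Y where b: "X \<in> carrier_mat a a" "Z \<in> carrier_mat a b" "Y \<in> carrier_mat b b" "x = four_block_mat X Z (0\<^sub>m b a) Y"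
    using block_upper_blocks[OF x'(1)] .
  obtain t where t: "X = t \<cdot>\<^sub>m 1\<^sub>m a" "Y = t \<cdot>\<^sub>m 1\<^sub>m b" "Z = 0\<^sub>m a b"
    using v radical_iff[OF b(1-3)] b(1-3) r unfolding b(4) rigid_def by blast
  have xt: "x = t \<cdot>\<^sub>m 1\<^sub>m (a + b)" unfolding b(4) t by (intro eq_matI) auto
  have "mat_trace x = t * of_nat (a + b)"
    unfolding xt mat_trace_linear(3)[OF one_carrier_mat one_carrier_mat] by (simp add: mat_trace_def)
  moreover have "(of_nat (a + b) :: complex) \<noteq> 0" unfolding of_nat_eq_0_iff using n by simp
  ultimately have "t = 0" using x'(2) by (metis mult_eq_0_iff)
  then show ?thesis unfolding xt by (intro eq_matI) auto
qed

text \<open>A solution of the block equations becomes an element of trace zero after subtracting a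
  scalar. Scalars commute with everything, so it stays in the radical and must vanish.\<close>

lemma nondegenerate_imp_rigid:
  assumes nd: "\<And>x. x \<in> parabolic a b \<Longrightarrow> (\<forall>y\<in>parabolic a b. \<phi> (commutator x y) = 0) \<Longrightarrow> x = 0\<^sub>m (a + b) (a + b)"
  shows "rigid a b A C D"
  unfolding rigid_def
proof (intro conjI ballI impI)
  fix X Y Z assume X: "X \<in> carrier_mat a a" and Y: "Y \<in> carrier_mat b b" and Z: "Z \<in> carrier_mat a b"
    and e: "A * X - X * A = Z * C" "C * X = Y * C" "Y * D - D * Y = C * Z"
  let ?x = "four_block_mat X Z (0\<^sub>m b a) Y"
  have x: "?x \<in> block_upper a b" using X Z Y by (rule four_block_in_block_upper)
  obtain s where s: "?x - s \<cdot>\<^sub>m 1\<^sub>m (a + b) \<in> parabolic a b" using parabolic_minus_scalar[OF x n] .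
  have xc: "?x \<in> carrier_mat (a + b) (a + b)" using x by (rule block_upper_carrier)
  have "commutator (?x - s \<cdot>\<^sub>m 1\<^sub>m (a + b)) y = commutator ?x y" if y: "y \<in> carrier_mat (a + b) (a + b)" for y
    by (rule commutator_minus_scalar[OF xc y])
  moreover have "\<forall>y\<in>parabolic a b. \<phi> (commutator ?x y) = 0" using radical_iff[OF X Z Y] e by blast
  ultimately have "\<forall>y\<in>parabolic a b. \<phi> (commutator (?x - s \<cdot>\<^sub>m 1\<^sub>m (a + b)) y) = 0"
    using block_upper_carrier by (simp add: parabolic_iff)
  from nd[OF s this] have z: "?x - s \<cdot>\<^sub>m 1\<^sub>m (a + b) = 0\<^sub>m (a + b) (a + b)" .
  then have "?x = s \<cdot>\<^sub>m 1\<^sub>m (a + b)" using xc by (subst (asm) minus_eq_zero_mat) auto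
  also have "\<dots> = four_block_mat (s \<cdot>\<^sub>m 1\<^sub>m a) (0\<^sub>m a b) (0\<^sub>m b a) (s \<cdot>\<^sub>m 1\<^sub>m b)" by (intro eq_matI) auto
  finally have eq: "?x = four_block_mat (s \<cdot>\<^sub>m 1\<^sub>m a) (0\<^sub>m a b) (0\<^sub>m b a) (s \<cdot>\<^sub>m 1\<^sub>m b)" .
  have "X = s \<cdot>\<^sub>m 1\<^sub>m a \<and> Z = 0\<^sub>m a b \<and> 0\<^sub>m b a = (0\<^sub>m b a :: complex mat) \<and> Y = s \<cdot>\<^sub>m 1\<^sub>m b"
    by (rule iffD1[OF four_block_inject[of _ a a _ b _ b] eq]) (use X Y Z in auto)
  then show "\<exists>t. X = t \<cdot>\<^sub>m 1\<^sub>m a \<and> Y = t \<cdot>\<^sub>m 1\<^sub>m b \<and> Z = 0\<^sub>m a b" by blast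
qed (use A C D in auto)

end

section \<open>The spectrum in terms of integer differences\<close>

lemma mdiff_image:
  assumes "\<And>i j. f i - f j = g (i - j)"
  shows "mdiff (image_mset f p) (image_mset f q) = image_mset g (mdiff p q)"
  by (induction p) (simp_all add: multiset.map_comp o_def assms)

text \<open>The unknown shift of the eigenvalues is common to both blocks and cancels in every
  difference, so the spectrum depends on neither the functional nor the bases.\<close>

lemma ooms_spectrum_unique:
  assumes s: "principal_spec a b p q" and n: "0 < a + b" and o: "ooms_spectrum (a + b) (parabolic a b) M"
  shows "M + {#0#} = image_mset of_int (mdiff p p + mdiff q q + mdiff p q)"
proof -
  obtain \<phi> h bs B where f: "frobenius_functional (a + b) (parabolic a b) \<phi>" and p: "principal_element (parabolic a b) \<phi> h"
    and bs: "ordered_basis (a + b) (parabolic a b) bs" "matrix_of_operator (a + b) bs (commutator h) B" "M = proots (char_poly B)"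
    using o unfolding ooms_spectrum_def by blast
  have lin: "linear_functional_on (parabolic a b) \<phi>" using f by (simp add: frobenius_functional_def)
  obtain A C D where F: "A \<in> carrier_mat a a" "C \<in> carrier_mat b a" "D \<in> carrier_mat b b"
    "mat_trace (four_block_mat A (0\<^sub>m a b) C D) = 0"
    "\<And>x. x \<in> parabolic a b \<Longrightarrow> \<phi> x = mat_trace (four_block_mat A (0\<^sub>m a b) C D * x)"
    by (rule functional_representation[OF lin n]) (rule that)
  interpret lower_functional a b A C D \<phi> using F n by unfold_locales
  have r: "rigid a b A C D" using f by (intro nondegenerate_imp_rigid) (auto simp: frobenius_functional_def)
  have h: "h \<in> block_upper a b" "\<forall>y\<in>parabolic a b. \<phi> (commutator h y) = \<phi> y" using p by (auto simp: principal_element_def parabolic_iff)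
  obtain P R Q where b: "P \<in> carrier_mat a a" "R \<in> carrier_mat a b" "Q \<in> carrier_mat b b" "h = four_block_mat P R (0\<^sub>m b a) Q"
    using block_upper_blocks[OF h(1)] .
  have "principal_triple a b A C D P R Q" using h(2) principal_iff[OF b(1-3)] unfolding b(4) by blast
  from principal_spec_unique[OF s r this] obtain t where t: "eig P = shifted t p" "eig Q = shifted t q" by blast
  have "M + {#0#} = mdiff (eig P) (eig P) + mdiff (eig Q) (eig Q) + mdiff (eig P) (eig Q)"
    using ad_spectrum[OF b n bs(1,2)] bs(3) by (simp add: eig_def)
  then show ?thesis unfolding t by (simp add: mdiff_image[where g = of_int])
qed

lemma ooms_spectrum_exists:
  assumes s: "principal_spec a b p q" and n: "0 < a + b"
  shows "\<exists>M. ooms_spectrum (a + b) (parabolic a b) M"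
proof -
  obtain A C D P R Q where r: "rigid a b A C D" and p: "principal_triple a b A C D P R Q"
    using principal_spec_exists[OF s] by blast
  have c: "A \<in> carrier_mat a a" "C \<in> carrier_mat b a" "D \<in> carrier_mat b b" using rigid_carrier[OF r] by auto
  have pc: "P \<in> carrier_mat a a" "R \<in> carrier_mat a b" "Q \<in> carrier_mat b b" using principal_triple_carrier[OF p] by auto
  define F where "F = four_block_mat A (0\<^sub>m a b) C D"
  have Fc: "F \<in> carrier_mat (a + b) (a + b)" using c by (auto simp: F_def)
  \<comment> \<open>The principal equations normalize the trace by themselves: commutators drop out,
    and the traces of \<open>R * C\<close> and \<open>C * R\<close> cancel.\<close>
  have "mat_trace F = mat_trace A + mat_trace D" unfolding F_def using c by (intro mat_trace_four_block) auto
  also have "mat_trace A = mat_trace (A * P - P * A - R * C)" using p by (simp add: principal_triple_def)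
  also have "\<dots> = - mat_trace (R * C)"
    using c pc by (subst mat_trace_linear(2)[of _ a], (auto intro!: carrier_matI)[2], subst mat_trace_linear(2)[of _ a]) (auto simp: mat_trace_comm[OF c(1) pc(1)])
  also have "mat_trace D = mat_trace (C * R + (D * Q - Q * D))" using p by (simp add: principal_triple_def)
  also have "\<dots> = mat_trace (C * R)"
    using c pc by (subst mat_trace_linear(1)[of _ b], (auto intro!: carrier_matI)[2], subst mat_trace_linear(2)[of _ b]) (auto simp: mat_trace_comm[OF c(3) pc(3)])
  also have "- mat_trace (R * C) + mat_trace (C * R) = 0" using mat_trace_comm[OF pc(2) c(2)] by simp
  finally have tr: "mat_trace F = 0" .
  define \<phi> where "\<phi> x = mat_trace (F * x)" for x
  interpret lower_functional a b A C D \<phi> using c n tr by unfold_locales (auto simp: F_def \<phi>_def)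
  let ?n = "a + b"
  have gc: "x \<in> carrier_mat ?n ?n" if "x \<in> parabolic a b" for x using that block_upper_carrier by (auto simp: parabolic_iff)
  have "linear_functional_on (parabolic a b) \<phi>"
    unfolding linear_functional_on_def
  proof (intro conjI ballI allI)
    fix x y assume "x \<in> parabolic a b" "y \<in> parabolic a b"
    then show "\<phi> (x + y) = \<phi> x + \<phi> y"
      using gc Fc unfolding \<phi>_def by (simp add: mult_add_distrib_mat[of _ ?n ?n _ ?n] mat_trace_linear(1)[of _ ?n])
  next
    fix k x assume "x \<in> parabolic a b"
    then show "\<phi> (k \<cdot>\<^sub>m x) = k * \<phi> x"
      using gc Fc unfolding \<phi>_def by (simp add: mult_smult_distrib[of _ ?n ?n _ ?n] mat_trace_linear(3)[of _ ?n "F * x"])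
  qed
  then have f: "frobenius_functional ?n (parabolic a b) \<phi>"
    unfolding frobenius_functional_def using rigid_imp_nondegenerate[OF r] by blast
  let ?h = "four_block_mat P R (0\<^sub>m b a) Q"
  have hV: "?h \<in> block_upper a b" using pc by (rule four_block_in_block_upper)
  have hc: "?h \<in> carrier_mat ?n ?n" using hV by (rule block_upper_carrier)
  \<comment> \<open>The triple yields a principal element of the larger algebra; removing a scalar
    moves it into the parabolic without affecting commutators.\<close>
  obtain s where s: "?h - s \<cdot>\<^sub>m 1\<^sub>m ?n \<in> parabolic a b" using parabolic_minus_scalar[OF hV n] .
  have "commutator (?h - s \<cdot>\<^sub>m 1\<^sub>m ?n) y = commutator ?h y" if y: "y \<in> carrier_mat ?n ?n" for y
    by (rule commutator_minus_scalar[OF hc y])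
  then have h: "principal_element (parabolic a b) \<phi> (?h - s \<cdot>\<^sub>m 1\<^sub>m ?n)"
    unfolding principal_element_def using s principal_iff[OF pc] p gc by auto
  obtain bs where bs: "ordered_basis ?n (parabolic a b) bs" using parabolic_basis(1)[OF n] by blast
  have "\<exists>c. c \<in> carrier_vec (length bs) \<and> commutator (?h - s \<cdot>\<^sub>m 1\<^sub>m ?n) (bs ! j) = mat_lincomb ?n bs c" if "j < length bs" for j
  proof -
    have "bs ! j \<in> parabolic a b" using bs that unfolding ordered_basis_def by auto
    then have "commutator (?h - s \<cdot>\<^sub>m 1\<^sub>m ?n) (bs ! j) \<in> parabolic a b"
      using s by (intro commutator_in_parabolic) (auto simp: parabolic_iff)
    then show ?thesis using bs unfolding ordered_basis_def by blast
  qed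
  then obtain g where g: "\<And>j. j < length bs \<Longrightarrow> g j \<in> carrier_vec (length bs) \<and> commutator (?h - s \<cdot>\<^sub>m 1\<^sub>m ?n) (bs ! j) = mat_lincomb ?n bs (g j)"
    by metis
  define B where "B = mat_of_cols (length bs) (map g [0..<length bs])"
  have "matrix_of_operator ?n bs (commutator (?h - s \<cdot>\<^sub>m 1\<^sub>m ?n)) B"
    unfolding matrix_of_operator_def B_def using g by (auto simp: col_mat_of_cols)
  with f h bs show ?thesis unfolding ooms_spectrum_def by blast
qed

section \<open>Multiplicities in the three families\<close>

lemma mdiff_add_right [simp]:
  "mdiff p (add_mset j q) = image_mset (\<lambda>i. i - j) p + mdiff p q"
  "mdiff p (q + q') = mdiff p q + mdiff p q'"
  by (induction p) auto

definition diff_count :: "int multiset \<Rightarrow> int multiset \<Rightarrow> int \<Rightarrow> int" where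
  "diff_count p q k = int (count (mdiff p q) k)"

lemma diff_count_add:
  "diff_count (p + p') q k = diff_count p q k + diff_count p' q k"
  "diff_count p (q + q') k = diff_count p q k + diff_count p q' k"
  by (simp_all add: diff_count_def)

lemma count_image_inj:
  assumes "inj f"
  shows "count (image_mset f M) (f x) = count M x"
  using assms by (induction M) (auto dest: injD)

lemma diff_count_shift:
  "diff_count p (image_mset (\<lambda>i. i - 1) q) k = diff_count p q (k - 1)"
  "diff_count (image_mset (\<lambda>i. i - 1) p) q k = diff_count p q (k + 1)"
proof -
  have i: "inj (\<lambda>i :: int. i + n)" for n by (simp add: inj_def)
  have "mdiff p (image_mset (\<lambda>i. i - 1) q) = image_mset (\<lambda>i. i + 1) (mdiff p q)"
    by (induction p) (simp_all add: multiset.map_comp o_def algebra_simps)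
  then show "diff_count p (image_mset (\<lambda>i. i - 1) q) k = diff_count p q (k - 1)"
    using count_image_inj[OF i[of 1], of "mdiff p q" "k - 1"] by (simp add: diff_count_def)
  have "mdiff (image_mset (\<lambda>i. i - 1) p) q = image_mset (\<lambda>i. i + - 1) (mdiff p q)"
    by (induction p) (simp_all add: multiset.map_comp o_def algebra_simps)
  then show "diff_count (image_mset (\<lambda>i. i - 1) p) q k = diff_count p q (k + 1)"
    using count_image_inj[OF i[of "- 1"], of "mdiff p q" "k + 1"] by (simp add: diff_count_def)
qed

lemma mdiff_swap: "mdiff q p = image_mset uminus (mdiff p q)" for p q :: "int multiset"
  by (induction p) (simp_all add: multiset.map_comp o_def)

lemma diff_count_swap: "diff_count q p k = diff_count p q (- k)"
  unfolding diff_count_def mdiff_swap[of q p]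
  using count_image_inj[of uminus "mdiff p q" "- k"] by (simp add: inj_def)

lemma diff_count_uminus:
  "diff_count (image_mset uminus p) (image_mset uminus q) k = diff_count q p k"
  unfolding diff_count_def mdiff_swap[of q p] by (subst mdiff_image[of uminus uminus]) simp_all

text \<open>The rule \<open>dual\<close> keeps the identity because negation and exchange of the
  multisets cancel in each count. Under \<open>add\<close> all new counts are sums of translates of
  old ones, and the identity at the same \<open>k\<close> remains.\<close>

lemma principal_spec_balanced:
  "principal_spec a b p q \<Longrightarrow>
    (diff_count p p k + diff_count q q k - of_bool (k = 0)) -
    (diff_count p p (k - 1) + diff_count q q (k - 1) - of_bool (k = 1)) =
    diff_count q p (k - 1) - diff_count p q k"
proof (induction arbitrary: k rule: principal_spec.induct)
  case base
  then show ?case by (simp add: diff_count_def)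
next
  case (add a b p q)
  show ?case using add.IH[of k] by (simp add: diff_count_add diff_count_shift)
next
  case (dual a b p q)
  show ?case using dual.IH[of k] unfolding diff_count_uminus by linarith
qed

lemma diff_count_finite_support: "\<exists>N. \<forall>k. N < \<bar>k\<bar> \<longrightarrow> diff_count p q k = 0"
proof (intro exI allI impI)
  fix k assume k: "Max (abs ` set_mset (add_mset 0 (mdiff p q))) < \<bar>k\<bar>"
  have "k \<notin># mdiff p q"
  proof
    assume "k \<in># mdiff p q"
    then have "\<bar>k\<bar> \<le> Max (abs ` set_mset (add_mset 0 (mdiff p q)))" by (intro Max_ge) auto
    then show False using k by linarith
  qed
  then show "diff_count p q k = 0" by (simp add: diff_count_def count_eq_zero_iff)
qed

text \<open>\<open>F\<close> is symmetric about 1/2 and nondecreasing up to 0, so its support is an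
  interval \<open>{1 - t..t}\<close>. The multiplicities are thus the values of \<open>F\<close> at
  consecutive integers.\<close>

lemma W_log_concave_of_tail:
  assumes s: "principal_spec a b p q" and n: "0 < a + b"
    and tail: "log_concave_tail (\<lambda>k. diff_count p q k - diff_count p q (- k))"
  shows "W_log_concave a b"
proof -
  define F where "F j = diff_count p p j + diff_count q q j + diff_count p q j - of_bool (j = 0)" for j
  obtain N1 where N1: "\<forall>k. N1 < \<bar>k\<bar> \<longrightarrow> diff_count p p k = 0" using diff_count_finite_support by blast
  obtain N2 where N2: "\<forall>k. N2 < \<bar>k\<bar> \<longrightarrow> diff_count q q k = 0" using diff_count_finite_support by blast
  obtain N3 where N3: "\<forall>k. N3 < \<bar>k\<bar> \<longrightarrow> diff_count p q k = 0" using diff_count_finite_support by blast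
  define N where "N = max 0 (max N1 (max N2 N3))"
  have fin: "F j = 0" if "N < \<bar>j\<bar>" for j using that N1 N2 N3 by (simp add: F_def N_def)
  have diff: "F (1 - k) - F (- k) = diff_count p q k - diff_count p q (- k)" for k
    using principal_spec_balanced[OF s, of "1 - k"] diff_count_swap[of q p "- k"] by (simp add: F_def)
  have "\<And>k. diff_count p q (- k) - diff_count p q (- (- k)) = - (diff_count p q k - diff_count p q (- k))" by simp
  note tail_facts = log_concave_of_tail[OF diff this fin tail]
  have sym: "F (1 - j) = F j" and lc: "F (j - 1) * F (j + 1) \<le> (F j)\<^sup>2" and mono: "j \<le> 0 \<Longrightarrow> F (j - 1) \<le> F j" for j
    by (rule tail_facts; assumption)+
  have anti: "F j \<le> F i" if "1 \<le> i" "i \<le> j" for i j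
    using that(2)
  proof (induction j rule: int_ge_induct)
    case (step j)
    then show ?case using mono[of "1 - j"] sym[of "j + 1"] sym[of j] that(1) by simp
  qed simp
  define S where "S = {j. 0 < F j}"
  have "j \<in> {- N..N}" if "j \<in> S" for j using that fin[of j] by (cases "N < \<bar>j\<bar>") (auto simp: S_def)
  then have "S \<subseteq> {- N..N}" by blast
  then have finS: "finite S" using finite_subset by blast
  \<comment> \<open>The inserted 0 covers an empty support: then \<open>[1 - t..t]\<close> is empty
    as well.\<close>
  define t where "t = Max (insert 0 S)"
  have t0: "0 \<le> t" and tS: "j \<in> S \<Longrightarrow> j \<le> t" for j using finS by (simp_all add: t_def)
  have tin: "t = 0 \<or> t \<in> S" using Max_in[of "insert 0 S"] finS by (auto simp: t_def)
  have pos: "0 < F j" if "1 \<le> j" "j \<le> t" for j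
    using anti[OF that] tin that by (auto simp: S_def)
  have S: "j \<in> S \<longleftrightarrow> 1 - t \<le> j \<and> j \<le> t" for j
  proof
    assume j: "j \<in> S"
    then have "1 - j \<in> S" by (simp add: S_def sym)
    then show "1 - t \<le> j \<and> j \<le> t" using tS[OF j] tS[of "1 - j"] by simp
  next
    assume "1 - t \<le> j \<and> j \<le> t"
    then show "j \<in> S" using pos[of j] pos[of "1 - j"] sym[of j] by (cases "1 \<le> j") (auto simp: S_def)
  qed
  have "\<exists>c. multiplicity_sequence M c \<and> log_concave_seq c" if o: "ooms_spectrum (a + b) (parabolic a b) M" for M
  proof -
    note M = ooms_spectrum_unique[OF s n o]
    have inj: "inj (of_int :: int \<Rightarrow> complex)" by (simp add: inj_def)
    have cnt: "int (count M (of_int j)) = F j" for j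
      using arg_cong[OF M, of "\<lambda>M. count M (of_int j)"] unfolding count_image_inj[OF inj]
      by (cases "j = 0") (simp_all add: F_def diff_count_def)
    have mem: "of_int j \<in># M \<longleftrightarrow> j \<in> S" for j
      unfolding S_def mem_Collect_eq cnt[symmetric] of_nat_0_less_iff count_greater_zero_iff ..
    have sub: "x \<in> of_int ` S" if x: "x \<in># M" for x
    proof -
      have "x \<in># M + {#0#}" using x by simp
      then obtain j where j: "x = of_int j" unfolding M by auto
      then have "j \<in> S" using x mem by simp
      then show ?thesis using j by simp
    qed
    define es where "es = map real_of_int [1 - t..t]"
    define c where "c = map (\<lambda>e. count M (complex_of_real e)) es"
    have len: "length c = nat (2 * t)" by (simp add: c_def es_def)
    have nth: "int (c ! i) = F (1 - t + int i)" if "i < length c" for i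
      using that cnt[of "1 - t + int i"] by (simp add: c_def es_def)
    have "complex_of_real ` set es = of_int ` S"
    proof -
      have "S = {1 - t..t}" unfolding set_eq_iff atLeastAtMost_iff by (intro allI S)
      then show ?thesis unfolding es_def set_map set_upto image_image by simp
    qed
    moreover have "of_int ` S = set_mset M"
      using sub mem by blast
    ultimately have "complex_of_real ` set es = set_mset M" by simp
    moreover have "sorted_wrt (<) es"
      unfolding es_def sorted_wrt_map of_int_less_iff by (rule sorted_wrt_upto)
    ultimately have "multiplicity_sequence M c" unfolding multiplicity_sequence_def c_def by blast
    moreover have "log_concave_seq c" unfolding log_concave_seq_def
    proof (intro conjI ballI allI impI)
      fix x assume "x \<in> set c"
      then obtain i where i: "i < length c" "x = c ! i" by (auto simp: in_set_conv_nth)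
      then have "1 - t + int i \<in> S" unfolding S len using t0 by simp
      then show "0 < x" using nth[OF i(1)] i(2) by (simp add: S_def)
    next
      fix j assume j: "1 \<le> j \<and> j + 1 < length c"
      then obtain i where i: "j = Suc i" by (cases j) auto
      have "int (c ! (j - 1)) * int (c ! (j + 1)) \<le> (int (c ! j))\<^sup>2"
        using lc[of "1 - t + int j"] j nth[of i] nth[of "j + 1"] nth[of j]
        by (simp add: i algebra_simps)
      then show "c ! (j - 1) * c ! (j + 1) \<le> (c ! j)\<^sup>2"
        unfolding of_nat_mult[symmetric] of_nat_power[symmetric] of_nat_le_iff .
    qed
    ultimately show ?thesis by blast
  qed
  then show ?thesis using ooms_spectrum_exists[OF s n] unfolding W_log_concave_def by blast
qed

text \<open>A step translates the cross count by 1 and adds the equally translated self count of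
  \<open>q\<close>, which itself does not change. In second differences the added terms
  \<open>d k - d (k - 1)\<close> telescope.\<close>

lemma principal_spec_iterate:
  assumes s: "principal_spec a b p q"
    and u: "\<And>k. diff_count q q k - diff_count q q (k - 1) = d k"
    and h: "\<And>k. second_diff (diff_count p q) k = h k"
  shows "\<exists>p' q'. principal_spec (a + m * b) b p' q' \<and> (\<forall>k. diff_count q' q' k = diff_count q q k) \<and>
    (\<forall>k. second_diff (diff_count p' q') k = d k - d (k - int m) + h (k - int m))"
proof (induction m)
  case 0
  show ?case using s h by (intro exI[of _ p] exI[of _ q]) simp
next
  case (Suc m)
  then obtain p' q' where *: "principal_spec (a + m * b) b p' q'" "\<And>k. diff_count q' q' k = diff_count q q k"
    "\<And>k. second_diff (diff_count p' q') k = d k - d (k - int m) + h (k - int m)" by blast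
  let ?q = "image_mset (\<lambda>i. i - 1) q'"
  have "principal_spec (a + Suc m * b) b (p' + q') ?q"
    using principal_spec.add[OF *(1)] by (simp add: add.commute add.left_commute)
  moreover have "diff_count ?q ?q k = diff_count q q k" for k
    by (simp add: diff_count_shift *(2))
  moreover have "second_diff (diff_count (p' + q') ?q) k = d k - d (k - int (Suc m)) + h (k - int (Suc m))" for k
  proof -
    have "second_diff (diff_count (p' + q') ?q) k = second_diff (diff_count p' q') (k - 1) + second_diff (diff_count q q) (k - 1)"
      by (simp add: second_diff_def diff_count_add diff_count_shift *(2) algebra_simps)
    moreover have "second_diff (diff_count q q) (k - 1) = d k - d (k - 1)"
      using u[of k] u[of "k - 1"] by (simp add: second_diff_def)
    ultimately show ?thesis using *(3)[of "k - 1"] by (simp add: algebra_simps)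
  qed
  ultimately show ?case by blast
qed

section \<open>The explicit pairs and the two families\<close>

definition modulus :: "nat \<Rightarrow> nat" where "modulus t = (if t = 0 then 1 else if t = 1 then 2 else 3)"
definition residue :: "nat \<Rightarrow> nat" where "residue t = (if t = 0 then 0 else if t = 3 then 2 else 1)"

lemma residue_spec:
  assumes "t < 4"
  shows "\<exists>p q. principal_spec (residue t) (modulus t) p q \<and> (\<forall>k. diff_count p q k = cross_base t k) \<and>
    (\<forall>k. diff_count q q k = self_sum t (k + 1) - self_sum t k)"
proof -
  note base = principal_spec.base and add = principal_spec.add and dual = principal_spec.dual
  have one: "principal_spec 1 2 {#2#} {#0, 1#}"
    using dual[OF add[OF add[OF base]]] by (simp add: numeral_eq_Suc add_mset_commute)
  have two: "principal_spec 1 3 {#3#} {#0, 1, 2#}"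
    using dual[OF add[OF add[OF add[OF base]]]] by (simp add: numeral_eq_Suc add_mset_commute)
  have three: "principal_spec 2 3 {#0, 1#} {#0, -1, -2#}"
    using dual[OF add[OF one]] by (simp add: numeral_eq_Suc add_mset_commute)
  consider "t = 0" | "t = 1" | "t = 2" | "t = 3" using assms by linarith
  then show ?thesis
  proof cases
    case 1
    then show ?thesis using base
      by (intro exI[of _ "{#}"] exI[of _ "{#0#}"]) (auto simp: residue_def modulus_def diff_count_def cross_base_def self_sum_def)
  next
    case 2
    then show ?thesis using one
      by (intro exI[of _ "{#2#}"] exI[of _ "{#0, 1#}"]) (auto simp: residue_def modulus_def diff_count_def cross_base_def self_sum_def)
  next
    case 3
    then show ?thesis using two
      by (intro exI[of _ "{#3#}"] exI[of _ "{#0, 1, 2#}"]) (auto simp: residue_def modulus_def diff_count_def cross_base_def self_sum_def)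
  next
    case 4
    then show ?thesis using three
      by (intro exI[of _ "{#0, 1#}"] exI[of _ "{#0, -1, -2#}"]) (auto simp: residue_def modulus_def diff_count_def cross_base_def self_sum_def)
  qed
qed

lemma stage_spec:
  assumes "t < 4"
  shows "\<exists>p q. principal_spec (residue t + c * modulus t) (modulus t) p q \<and> (\<forall>k. diff_count p q k = cross t (int c) k) \<and>
    (\<forall>k. diff_count q q k = self_sum t (k + 1) - self_sum t k)"
proof (induction c)
  case 0
  show ?case using residue_spec[OF assms] by (simp add: cross_def)
next
  case (Suc c)
  then obtain p q where *: "principal_spec (residue t + c * modulus t) (modulus t) p q" "\<And>k. diff_count p q k = cross t (int c) k"
    "\<And>k. diff_count q q k = self_sum t (k + 1) - self_sum t k" by blast
  let ?q = "image_mset (\<lambda>i. i - 1) q"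
  have "principal_spec (residue t + Suc c * modulus t) (modulus t) (p + q) ?q"
    using principal_spec.add[OF *(1)] by (simp add: add.commute add.left_commute)
  moreover have "\<forall>k. diff_count (p + q) ?q k = cross t (int (Suc c)) k" "\<forall>k. diff_count ?q ?q k = self_sum t (k + 1) - self_sum t k"
    by (simp_all add: diff_count_add diff_count_shift * cross_def algebra_simps)
  ultimately show ?case by blast
qed

lemma stage_self_step:
  assumes "principal_spec a b p q" "\<And>k. diff_count p q k = cross t c k"
    "\<And>k. diff_count q q k = self_sum t (k + 1) - self_sum t k"
  shows "diff_count p p k - diff_count p p (k - 1) = self_step t c k"
  using principal_spec_balanced[OF assms(1), of k] diff_count_swap[of q p "k - 1"]
  by (cases "k = 0"; cases "k = 1") (simp_all add: assms(2,3) self_step_def self_excess_def)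

lemma self_excess_even: "self_excess t (- k) = self_excess t k"
  by (auto simp: self_excess_def self_sum_def)

text \<open>Beyond \<open>K\<close> the function is linear and eventually 0, hence 0 from
  \<open>K\<close> itself on. This locates the end of the support as sharply as the window
  requires.\<close>

lemma vanish_beyond:
  fixes v :: "int \<Rightarrow> int"
  assumes "\<And>k. K < k \<Longrightarrow> second_diff v k = 0" "\<And>k. N < k \<Longrightarrow> v k = 0" "K \<le> k"
  shows "v k = 0"
proof -
  have "v k = 0 \<and> v (k + 1) = 0" if "k \<le> max k N + 1" "K \<le> k" for k
    using that
  proof (induction k rule: int_le_induct)
    case base
    show ?case using assms(2) by simp
  next
    case (step i)
    then show ?case using assms(1)[of i] by (simp add: second_diff_def)
  qed
  then show ?thesis using assms(3) by simp
qed

lemma W_log_concave_of_profile: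
  assumes s: "principal_spec a b p q" "0 < a + b" and t: "t < 4" "1 \<le> c" "t = 0 \<Longrightarrow> 2 \<le> c" and m: "1 \<le> m"
    and h: "\<And>k. second_diff (diff_count p q) k = self_step t c k + edge \<sigma> t c (k - m)"
  shows "W_log_concave a b"
proof (rule W_log_concave_of_tail[OF s])
  let ?v = "\<lambda>k. diff_count p q k - diff_count p q (- k)"
  have e: "second_diff ?v k = profile \<sigma> t c m k" for k
  proof -
    have "second_diff ?v k = second_diff (diff_count p q) k - second_diff (diff_count p q) (- k)"
      by (simp add: second_diff_def minus_diff_commute[of k 1] algebra_simps)
    then show ?thesis unfolding h profile_def dip_def using self_excess_even[of t k] self_excess_even[of t "k + 1"] by (simp add: self_step_def minus_diff_commute[of k 1] algebra_simps)
  qed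
  obtain N where N: "\<forall>k. N < \<bar>k\<bar> \<longrightarrow> diff_count p q k = 0" using diff_count_finite_support by blast
  have "?v k = 0" if "m + c + 4 \<le> k" for k
  proof (rule vanish_beyond[OF _ _ that, where N = "max 0 N"])
    fix k assume k: "m + c + 4 < k"
    have "edge \<sigma> t c (k - m) = 0" using k t by (intro edge_zero) auto
    moreover have "edge \<sigma> t c (- k - m) = 0" using edge_zero(2)[of c "k + m" \<sigma> t] k t m by simp
    moreover have "dip t c k = 0" using k m t by (intro dip_zero) auto
    ultimately show "second_diff ?v k = 0" unfolding e profile_def by simp
  qed (use N in simp)
  then show "log_concave_tail ?v"
    using log_concave_tail_profile[OF t m, of ?v \<sigma>] e by simp
qed

text \<open>Euclid's steps, with r for \<open>modulus t\<close>, are (mb + r, b), (r, b), (b, r), (b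
  mod r, r), traversed backwards: \<open>c\<close> additions, one exchange, \<open>m\<close>
  additions.\<close>

lemma W_log_concave_plus:
  assumes t: "t < 4" "1 \<le> c" "t = 0 \<Longrightarrow> 2 \<le> c" and m: "1 \<le> m" and b: "b = c * modulus t + residue t"
  shows "W_log_concave (m * b + modulus t) b"
proof -
  obtain p q where s: "principal_spec (residue t + c * modulus t) (modulus t) p q"
    and pq: "\<And>k. diff_count p q k = cross t (int c) k" and qq: "\<And>k. diff_count q q k = self_sum t (k + 1) - self_sum t k"
    using stage_spec[OF t(1)] by blast
  have d: "principal_spec (modulus t) b (image_mset uminus q) (image_mset uminus p)"
    using principal_spec.dual[OF s] b by (simp add: add.commute)
  have u: "diff_count (image_mset uminus p) (image_mset uminus p) k - diff_count (image_mset uminus p) (image_mset uminus p) (k - 1) = self_step t c k" for k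
    unfolding diff_count_uminus by (rule stage_self_step[OF s pq qq])
  have h0: "second_diff (diff_count (image_mset uminus q) (image_mset uminus p)) k = second_diff (cross t c) k" for k
    unfolding second_diff_def diff_count_uminus pq ..
  obtain p' q' where s': "principal_spec (modulus t + m * b) b p' q'"
    and h: "\<And>k. second_diff (diff_count p' q') k = self_step t c k - self_step t c (k - int m) + second_diff (cross t c) (k - int m)"
    using principal_spec_iterate[OF d u h0, of m] by blast
  show ?thesis
  proof (rule W_log_concave_of_profile[where t = t and c = "int c" and m = "int m" and \<sigma> = True])
    show "principal_spec (m * b + modulus t) b p' q'" using s' by (simp add: add.commute)
    show "second_diff (diff_count p' q') k = self_step t c k + edge True t c (k - int m)" for k
      unfolding h by (simp add: edge_def edge_plus_def self_step_def second_diff_def)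
    show "0 < m * b + modulus t + b" by (simp add: modulus_def)
  qed (use t m in simp_all)
qed

text \<open>Here mb - r = (m - 1) b + (b - r), so only \<open>m - 1\<close> additions follow the
  pair (b - r, b). Its second multiset is the first one of (b, r), so \<open>self_step\<close>
  agrees with the other family; the cross count is reflected, whence the argument
  \<open>1 - j\<close> in \<open>edge\<close>.\<close>

lemma W_log_concave_minus:
  assumes t: "t < 4" "1 \<le> c" "t = 0 \<Longrightarrow> 2 \<le> c" and m: "1 \<le> m" and b: "b = c * modulus t + residue t"
  shows "W_log_concave (m * b - modulus t) b"
proof -
  obtain c' where c': "c = Suc c'" using t(2) by (cases c) auto
  obtain p q where s: "principal_spec (residue t + c' * modulus t) (modulus t) p q"
    and pq: "\<And>k. diff_count p q k = cross t (int c') k" and qq: "\<And>k. diff_count q q k = self_sum t (k + 1) - self_sum t k"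
    using stage_spec[OF t(1)] by blast
  let ?q = "image_mset (\<lambda>i. i - 1) q"
  have S: "principal_spec b (modulus t) (p + q) ?q"
    using principal_spec.add[OF s] b c' by (simp add: add.commute add.left_commute)
  have Spq: "diff_count (p + q) ?q k = cross t (int c) k" and Sqq: "diff_count ?q ?q k = self_sum t (k + 1) - self_sum t k" for k
    using c' by (simp_all add: diff_count_add diff_count_shift pq qq cross_def algebra_simps)
  note self_step = stage_self_step[OF S Spq Sqq]
  let ?p = "image_mset (\<lambda>i. i + 1) p"
  \<comment> \<open>From (b - r, r) the rules \<open>dual\<close>, \<open>add\<close>,
    \<open>dual\<close> lead through (r, b - r) and (b, b - r) to (b - r, b).\<close>
  have d: "principal_spec (residue t + c' * modulus t) b ?p (p + q)"
    using principal_spec.dual[OF principal_spec.add[OF principal_spec.dual[OF s]]] b c'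
    by (simp add: multiset.map_comp o_def ac_simps)
  \<comment> \<open>Writing \<open>p\<close> as \<open>p + q\<close> without \<open>q\<close> turns
    the count into self differences minus a swapped cross count. The swap reflects the argument, and
    the shift inside \<open>?q\<close> moves it on to \<open>2 - k\<close>.\<close>
  have up: "diff_count ?p (p + q) k = diff_count (p + q) (p + q) (k - 1) - cross t c (2 - k)" for k
  proof -
    have "diff_count ?p (p + q) k = diff_count (image_mset (\<lambda>i. i - 1) ?p) (p + q) (k - 1)"
      by (simp add: diff_count_shift)
    also have "\<dots> = diff_count p (p + q) (k - 1)" by (simp add: multiset.map_comp o_def)
    also have "\<dots> = diff_count (p + q) (p + q) (k - 1) - diff_count q (p + q) (k - 1)"
      by (simp add: diff_count_add)
    also have "diff_count q (p + q) (k - 1) = cross t c (2 - k)"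
      using diff_count_swap[of q "p + q" "k - 1"] Spq[of "2 - k"] by (simp add: diff_count_shift algebra_simps)
    finally show ?thesis .
  qed
  let ?h = "\<lambda>k. self_step t c k - self_step t c (k - 1) - second_diff (\<lambda>k. cross t c (2 - k)) k"
  have h0: "second_diff (diff_count ?p (p + q)) k = ?h k" for k
    unfolding second_diff_def up using self_step[of k] self_step[of "k - 1"] by simp
  obtain p' q' where s': "principal_spec (residue t + c' * modulus t + (m - 1) * b) b p' q'"
    and h: "\<And>k. second_diff (diff_count p' q') k = self_step t c k - self_step t c (k - int (m - 1)) + ?h (k - int (m - 1))"
    using principal_spec_iterate[OF d self_step h0, of "m - 1"] by blast
  have i: "int (m - 1) = int m - 1" using m by simp
  have mb: "m * b = (m - 1) * b + b" using m by (cases m) simp_all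
  have a: "m * b - modulus t = residue t + c' * modulus t + (m - 1) * b" unfolding mb using b c' by simp
  show ?thesis
  proof (rule W_log_concave_of_profile[where t = t and c = "int c" and m = "int m" and \<sigma> = False])
    show "principal_spec (m * b - modulus t) b p' q'"
      unfolding a by (rule s')
    show "second_diff (diff_count p' q') k = self_step t c k + edge False t c (k - int m)" for k
      unfolding h i using self_excess_even[of t "k - int m"] self_excess_even[of t "k - int m - 1"]
      by (simp add: edge_def edge_plus_def self_step_def second_diff_def algebra_simps)
    show "0 < m * b - modulus t + b" using t b by (auto simp: modulus_def residue_def)
  qed (use t m in simp_all)
qed

theorem theorem1p2:
  fixes m :: nat
  assumes "m \<ge> 1"
  shows "(\<forall>b::nat. b \<ge> 2 \<longrightarrow>
            W_log_concave (m * b + 1) b \<and>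
            (m * b - 1 > 0 \<longrightarrow> W_log_concave (m * b - 1) b)) \<and>
         (\<forall>b::nat. b \<ge> 3 \<and> odd b \<longrightarrow>
            W_log_concave (m * b + 2) b \<and> W_log_concave (m * b - 2) b) \<and>
         (\<forall>b::nat. b \<ge> 4 \<and> \<not> 3 dvd b \<longrightarrow>
            W_log_concave (m * b + 3) b \<and> W_log_concave (m * b - 3) b)"
proof (intro conjI allI impI; (elim conjE)?)
  note family = W_log_concave_plus W_log_concave_minus
  fix b :: nat
  \<comment> \<open>With r = 1 the quotient \<open>c\<close> is \<open>b\<close> itself.\<close>
  show "W_log_concave (m * b + 1) b" "W_log_concave (m * b - 1) b" if "b \<ge> 2"
    using that assms family[of 0 b m b] by (simp_all add: modulus_def residue_def)
  show "W_log_concave (m * b + 2) b" "W_log_concave (m * b - 2) b" if "b \<ge> 3" "odd b"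
  proof -
    have "b = b div 2 * 2 + 1" "1 \<le> b div 2" using that by presburger+
    then show "W_log_concave (m * b + 2) b" "W_log_concave (m * b - 2) b"
      using assms family[of 1 "b div 2" m b] by (simp_all add: modulus_def residue_def)
  qed
  show "W_log_concave (m * b + 3) b" "W_log_concave (m * b - 3) b" if "b \<ge> 4" "\<not> 3 dvd b"
  proof -
    have c: "1 \<le> b div 3" using that by simp
    \<comment> \<open>The residues 1 and 2 modulo 3 are the indices 2 and 3.\<close>
    have "b = b div 3 * 3 + 1 \<or> b = b div 3 * 3 + 2" using that by presburger
    then show "W_log_concave (m * b + 3) b" "W_log_concave (m * b - 3) b"
      using assms c family[of 2 "b div 3" m b] family[of 3 "b div 3" m b] by (auto simp: modulus_def residue_def)
  qed
qed

end
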